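(* Consider the discrete NLS lattice with purely nonlinear nearest-neighbour coupling on the periodic ring $\mathcal J=\{-N,\dots,N\}$ with $6\le N\le 10$, i.e. $\mathrm i\dot\psi_j=\partial H/\partial\overline{\psi_j}$ with $$H=\sum_{j\in\mathcal J}|\psi_j|^2+\tfrac12\sum_{j\in\mathcal J}|\psi_j|^4+\varepsilon\sum_{j\in\mathcal J}|\psi_{j+1}-\psi_j|^4 .$$ Let $S=\{-1,0,1\}$, let $I^*>0$ be such that $\omega=1+I^*$ satisfies $k\omega\pm1\neq0$ and $k\omega\pm2\neq0$ for all $k\in\mathbb Z\setminus\{0\}$, and let $T=2\pi/\omega$. Write $q_2=\theta_0-\theta_{-1}$ and $q_3=\theta_1-\theta_0$. Then the four unperturbed periodic orbits on the resonant torus (excited sites $S$, common action $I^*$) with $(q_2,q_3)\in\{(0,0),(0,\pi),(\pi,0),(\pi,\pi)\}$ can be continued to $\varepsilon>0$ small as $T$-periodic solutions. For $\varepsilon>0$ small, the continuation of $(0,0)$ is linearly stable, while the continuations of $(0,\pi)$, $(\pi,0)$ and $(\pi,\pi)$ are linearly unstable.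
   Context: Site indices are taken modulo $2N+1$ (periodic boundary conditions). At $\varepsilon=0$, the unperturbed periodic orbits on the resonant torus are $\psi^{(0)}_j(t)=\sqrt{I^*}\,e^{-\mathrm i(\omega t+\theta_j)}$ for $j\in S$ and $\psi^{(0)}_j(t)=0$ for $j\in\mathcal J\setminus S$; up to time translation they are labelled by the phase differences of the $\theta_j$. An unperturbed orbit "can be continued" if there is $\varepsilon^*>0$ such that for every $0<\varepsilon<\varepsilon^*$ the system has a $T$-periodic solution $\psi^{\varepsilon}$, with $\psi^\varepsilon\to\psi^{(0)}$ uniformly in $t$ as $\varepsilon\to0^+$. A periodic solution is linearly stable if all the Floquet multipliers of its monodromy matrix (over the period $T$, viewing the system as a real Hamiltonian system) lie on the unit circle, and linearly unstable if at least one Floquet multiplier lies outside the unit circle. *)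

theory Defs
  imports "HOL-Analysis.Analysis"
begin

text \<open>
  The ring {-N,...,N} with site indices modulo 2N+1 is the type 'n bit1 of HOL-Library, i.e. the
  integers modulo 2 * CARD('n) + 1, with N = CARD('n).  Its addition is addition modulo 2N+1, and
  the sites -1, 0, 1 are the ring elements of that name.
\<close>

type_synonym 'n site = "'n bit1"

type_synonym 'n state = "complex ^ 'n site"

definition hamiltonian :: "real \<Rightarrow> 'n::finite state \<Rightarrow> real" where
  "hamiltonian \<epsilon> \<psi> =
     (\<Sum>j\<in>UNIV. (cmod (\<psi> $ j))^2) + 1/2 * (\<Sum>j\<in>UNIV. (cmod (\<psi> $ j))^4)
     + \<epsilon> * (\<Sum>j\<in>UNIV. (cmod (\<psi> $ (j + 1) - \<psi> $ j))^4)"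

text \<open>
  The Wirtinger derivative with respect to the conjugate of the j-th coordinate, namely
  (d/dx + i d/dy) / 2 where x and y are the real and imaginary parts of that coordinate.
\<close>

definition dbar :: "('n::finite state \<Rightarrow> real) \<Rightarrow> 'n state \<Rightarrow> 'n site \<Rightarrow> complex" where
  "dbar H \<psi> j =
     (complex_of_real (frechet_derivative H (at \<psi>) (axis j 1))
      + \<i> * complex_of_real (frechet_derivative H (at \<psi>) (axis j \<i>))) / 2"

definition vector_field :: "real \<Rightarrow> 'n::finite state \<Rightarrow> 'n state" where
  "vector_field \<epsilon> \<psi> = (\<chi> j. - \<i> * dbar (hamiltonian \<epsilon>) \<psi> j)"

definition is_solution :: "real \<Rightarrow> (real \<Rightarrow> 'n::finite state) \<Rightarrow> bool" where
  "is_solution \<epsilon> \<psi> \<longleftrightarrow>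
     (\<forall>t. (\<psi> has_vector_derivative vector_field \<epsilon> (\<psi> t)) (at t))"

definition is_periodic_solution :: "real \<Rightarrow> real \<Rightarrow> (real \<Rightarrow> 'n::finite state) \<Rightarrow> bool" where
  "is_periodic_solution \<epsilon> T \<psi> \<longleftrightarrow> is_solution \<epsilon> \<psi> \<and> (\<forall>t. \<psi> (t + T) = \<psi> t)"

text \<open>The frequency of the unperturbed motion with action I on the excited sites S is 1 + I.\<close>

definition unperturbed_orbit ::
    "'n::finite site set \<Rightarrow> real \<Rightarrow> ('n site \<Rightarrow> real) \<Rightarrow> real \<Rightarrow> 'n state" where
  "unperturbed_orbit S I \<theta> t =
     (\<chi> j. if j \<in> S
           then complex_of_real (sqrt I) * exp (- \<i> * complex_of_real ((1 + I) * t + \<theta> j))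
           else 0)"

text \<open>The value of the family at parameters outside (0, e) for small e is irrelevant.\<close>

definition is_continuation ::
    "real \<Rightarrow> (real \<Rightarrow> 'n::finite state) \<Rightarrow> (real \<Rightarrow> real \<Rightarrow> 'n state) \<Rightarrow> bool" where
  "is_continuation T \<psi>0 \<psi> \<longleftrightarrow>
     (\<exists>\<epsilon>star>0. \<forall>\<epsilon>. 0 < \<epsilon> \<and> \<epsilon> < \<epsilon>star \<longrightarrow> is_periodic_solution \<epsilon> T (\<psi> \<epsilon>))
     \<and> uniform_limit UNIV \<psi> \<psi>0 (at_right 0)"

definition can_be_continued :: "real \<Rightarrow> (real \<Rightarrow> 'n::finite state) \<Rightarrow> bool" where
  "can_be_continued T \<psi>0 \<longleftrightarrow> (\<exists>\<psi>. is_continuation T \<psi>0 \<psi>)"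

text \<open>
  Real form of the system, with coordinates (Re, Im).  The canonical coordinates are sqrt 2 times
  these; a common scaling of all coordinates leaves the Jacobian, and hence the monodromy matrix,
  unchanged.
\<close>

definition to_real :: "'n::finite state \<Rightarrow> real ^ ('n site + 'n site)" where
  "to_real \<psi> = (\<chi> k. case k of Inl j \<Rightarrow> Re (\<psi> $ j) | Inr j \<Rightarrow> Im (\<psi> $ j))"

definition from_real :: "real ^ ('n::finite site + 'n site) \<Rightarrow> 'n state" where
  "from_real x = (\<chi> j. Complex (x $ Inl j) (x $ Inr j))"

definition real_vector_field ::
    "real \<Rightarrow> real ^ ('n::finite site + 'n site) \<Rightarrow> real ^ ('n site + 'n site)" where
  "real_vector_field \<epsilon> x = to_real (vector_field \<epsilon> (from_real x))"

definition is_monodromy_matrix ::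
    "real \<Rightarrow> real \<Rightarrow> (real \<Rightarrow> 'n::finite state)
      \<Rightarrow> real ^ ('n site + 'n site) ^ ('n site + 'n site) \<Rightarrow> bool" where
  "is_monodromy_matrix \<epsilon> T \<psi> M \<longleftrightarrow>
     (\<exists>\<Phi>. \<Phi> 0 = mat 1
        \<and> (\<forall>t. (\<Phi> has_vector_derivative
                 jacobian (real_vector_field \<epsilon>) (at (to_real (\<psi> t))) ** \<Phi> t) (at t))
        \<and> M = \<Phi> T)"

definition is_complex_eigenvalue :: "real ^ 'k ^ 'k::finite \<Rightarrow> complex \<Rightarrow> bool" where
  "is_complex_eigenvalue M \<mu> \<longleftrightarrow>
     (\<exists>v :: complex ^ 'k. v \<noteq> 0 \<and> (\<chi> a b. complex_of_real (M $ a $ b)) *v v = \<mu> *s v)"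

text \<open>
  The variational equation is linear, so there is exactly one monodromy matrix; the existential
  quantifier keeps both notions from holding vacuously.
\<close>

definition linearly_stable :: "real \<Rightarrow> real \<Rightarrow> (real \<Rightarrow> 'n::finite state) \<Rightarrow> bool" where
  "linearly_stable \<epsilon> T \<psi> \<longleftrightarrow>
     (\<exists>M. is_monodromy_matrix \<epsilon> T \<psi> M \<and> (\<forall>\<mu>. is_complex_eigenvalue M \<mu> \<longrightarrow> cmod \<mu> = 1))"

definition linearly_unstable :: "real \<Rightarrow> real \<Rightarrow> (real \<Rightarrow> 'n::finite state) \<Rightarrow> bool" where
  "linearly_unstable \<epsilon> T \<psi> \<longleftrightarrow>
     (\<exists>M. is_monodromy_matrix \<epsilon> T \<psi> M \<and> (\<exists>\<mu>. is_complex_eigenvalue M \<mu> \<and> cmod \<mu> > 1))"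

end

theory Submission
  imports Defs "HOL-Computational_Algebra.Fundamental_Theorem_Algebra" "HOL-Library.Periodic_Fun"
begin

text \<open>
Why the theorem holds.  In the frame rotating with frequency 1 + I the lattice equations stay
  autonomous, T-periodic solutions stay T-periodic, and the unperturbed orbits become equilibria.
  A T-periodic solution that stays close to such an equilibrium is constant in that frame (lemma
  rigidity): its time increments satisfy, up to a small relative error, a constant-coefficient
  linear system, and the components along which that system has zero frequency vanish at some
  time because they are increments of periodic functions.  Hence every continuation consists of
  standing waves exp(-i(1+I)t) phi, no matter how degenerate the resonant torus is, and both
  stability questions become questions about one equilibrium.

  The real and the imaginary part of phi lie in the kernel of the same symmetric
  nearest-neighbour operator Lm on the ring.  Two vectors in this kernel have a constant
  Wronskian.  Among the unexcited sites all amplitudes are of order eps, so the Wronskian there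
  is of order eps^5; on a bond between excited sites the coefficient is at least of order eps^3.
  The latter is the delicate point when the two phases agree: the bond is then weak, but the
  outer neighbours detune the amplitudes of the sites -1, 0, 1 by different amounts of order
  eps, so the two ends of the bond differ by order eps (lemma ev_jump_lower).  Therefore the
  kernel is one-dimensional and phi is real up to a global phase (lemma ev_real).

  For real phi the linearisation splits into u' = Lm v, v' = -Lp u, so the squares of the
  exponents are the eigenvalues of -Lm Lp.  The form of Lm - (I^2/2) Lp^(-1) is negative
  definite, which makes these eigenvalues real (lemma ev_definite_pencil).  For the in-phase wave
  the Wronskian estimate shows that Lm is nonnegative on the vectors it annihilates off the
  excited sites, and this excludes positive eigenvalues (lemmas ev_positive and
  ev_no_positive_eigenvalue): all exponents are imaginary and all multipliers lie on the unit
  circle.  If some bond of the core is out of phase, Lm has a negative direction of order eps on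
  the core; a real exponent of order sqrt eps is continued from a simple eigenvalue of a
  three-site problem (lemma ev_growing_mode).  Both this mode and the standing waves themselves
  are found with Brouwer's theorem (lemma brouwer_implicit_zero).  The passage between exponents
  and multipliers uses an explicit matrix exponential in the rotating frame.
\<close>

section \<open>Vector field and lattice symmetries\<close>

text \<open>
  Statements about all sufficiently small positive values of the coupling.
\<close>

abbreviation eventually_small :: "(real \<Rightarrow> bool) \<Rightarrow> bool"  (binder "\<forall>\<^sub>0" 10) where
  "\<forall>\<^sub>0\<epsilon>. P \<epsilon> \<equiv> eventually P (at_right 0)"

definition cubic :: "complex \<Rightarrow> complex" where
  "cubic z = of_real ((cmod z)\<^sup>2) * z"

lemma has_derivative_cmod_sq:
  fixes f :: "'a::real_normed_vector \<Rightarrow> complex"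
  assumes "(f has_derivative f') (at x)"
  shows "((\<lambda>x. (cmod (f x))\<^sup>2) has_derivative (\<lambda>h. 2 * (f x \<bullet> f' h))) (at x)"
  unfolding power2_norm_eq_inner
  by (rule has_derivative_eq_rhs, rule has_derivative_inner[OF assms assms]) (simp add: inner_commute)

lemma has_derivative_cmod_4:
  fixes f :: "'a::real_normed_vector \<Rightarrow> complex"
  assumes "(f has_derivative f') (at x)"
  shows "((\<lambda>x. (cmod (f x))^4) has_derivative (\<lambda>h. 4 * (cubic (f x) \<bullet> f' h))) (at x)"
proof -
  have eq: "(\<lambda>x. (cmod (f x))^4) = (\<lambda>x. ((cmod (f x))\<^sup>2)\<^sup>2)" by simp
  show ?thesis unfolding eq
    by (rule has_derivative_eq_rhs, rule has_derivative_power[OF has_derivative_cmod_sq[OF assms]])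
       (auto simp: fun_eq_iff cubic_def inner_complex_def algebra_simps)
qed

lemma has_derivative_nth: "((\<lambda>x::'a::real_normed_vector^'n. x $ j) has_derivative (\<lambda>h. h $ j)) (at x)"
  by (rule bounded_linear_imp_has_derivative) (rule bounded_linear_vec_nth)

lemma has_derivative_hamiltonian:
  "(hamiltonian \<epsilon> has_derivative (\<lambda>h. (\<Sum>j\<in>UNIV. 2 * (\<psi> $ j \<bullet> h $ j)) + 1/2 * (\<Sum>j\<in>UNIV. 4 * (cubic (\<psi> $ j) \<bullet> h $ j))
     + \<epsilon> * (\<Sum>j\<in>UNIV. 4 * (cubic (\<psi> $ (j+1) - \<psi> $ j) \<bullet> (h $ (j+1) - h $ j))))) (at \<psi>)"
  unfolding hamiltonian_def[abs_def]
  by (intro derivative_intros has_derivative_cmod_sq has_derivative_cmod_4 has_derivative_nth) 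

lemma sum_axis_inner: "(\<Sum>j\<in>UNIV. c j \<bullet> (axis k z :: complex^'n::finite) $ j) = c k \<bullet> z"
proof -
  have "(\<Sum>j\<in>UNIV. c j \<bullet> (axis k z :: complex^'n) $ j) = (\<Sum>j\<in>UNIV. if j = k then c j \<bullet> z else 0)"
    by (rule sum.cong) (auto simp: axis_def)
  then show ?thesis by simp
qed

lemma sum_shift:
  fixes f :: "'n::finite site \<Rightarrow> 'a::comm_monoid_add"
  shows "(\<Sum>j\<in>UNIV. f (j + c)) = (\<Sum>j\<in>UNIV. f j)"
  by (rule sum.reindex_bij_witness[of _ "\<lambda>j. j - c" "\<lambda>j. j + c"]) auto

lemma cubic_minus: "cubic (- z) = - cubic z"
  by (simp add: cubic_def)

definition coupling :: "'n::finite state \<Rightarrow> 'n site \<Rightarrow> complex" where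
  "coupling \<psi> j = cubic (\<psi> $ j - \<psi> $ (j+1)) + cubic (\<psi> $ j - \<psi> $ (j-1))"

text \<open>
  The factor 2 in front of the coupling comes from differentiating a fourth power by the
  Wirtinger derivative: the derivative of |z|^4 is 2 |z|^2 z.
\<close>

lemma dbar_hamiltonian:
  "dbar (hamiltonian \<epsilon>) \<psi> j = \<psi> $ j + cubic (\<psi> $ j) + 2 * of_real \<epsilon> * coupling \<psi> j"
proof -
  define g where "g = \<psi> $ j + cubic (\<psi> $ j) + 2 * of_real \<epsilon> * coupling \<psi> j"
  have D: "frechet_derivative (hamiltonian \<epsilon>) (at \<psi>) (axis j z) = 2 * (g \<bullet> z)" for z
  proof -
    let ?h = "axis j z :: complex^'a bit1"
    have sh: "?h $ (i + 1) = (axis (j - 1) z :: complex^'a bit1) $ i" for i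
      by (auto simp: axis_def)
    have s3: "(\<Sum>i\<in>UNIV. cubic (\<psi> $ (i+1) - \<psi> $ i) \<bullet> (?h $ (i+1) - ?h $ i)) = coupling \<psi> j \<bullet> z"
      using cubic_minus[of "\<psi> $ (j+1) - \<psi> $ j"]
      by (simp add: inner_diff_right sum_subtractf sh sum_axis_inner coupling_def inner_add_left inner_diff_left)
    have "frechet_derivative (hamiltonian \<epsilon>) (at \<psi>) ?h =
       2 * (\<Sum>i\<in>UNIV. \<psi> $ i \<bullet> ?h $ i) + 1/2 * (4 * (\<Sum>i\<in>UNIV. cubic (\<psi> $ i) \<bullet> ?h $ i))
       + \<epsilon> * (4 * (\<Sum>i\<in>UNIV. cubic (\<psi> $ (i+1) - \<psi> $ i) \<bullet> (?h $ (i+1) - ?h $ i)))"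
      by (subst frechet_derivative_at[OF has_derivative_hamiltonian, symmetric])
         (simp add: sum_distrib_left)
    also have "\<dots> = 2 * (g \<bullet> z)"
      by (simp only: s3 sum_axis_inner) (simp add: g_def inner_complex_def algebra_simps)
    finally show ?thesis .
  qed
  show ?thesis unfolding dbar_def D g_def[symmetric]
    by (simp add: complex_eq_iff inner_complex_def)
qed

lemma vector_field_nth:
  "vector_field \<epsilon> \<psi> $ j = - \<i> * (\<psi> $ j + cubic (\<psi> $ j) + 2 * of_real \<epsilon> * coupling \<psi> j)"
  by (simp add: vector_field_def dbar_hamiltonian)

text \<open>
  Together with the next lemma this is the gauge symmetry of the lattice, which makes the
  system autonomous in the rotating frame.
\<close>

lemma cubic_mult: "cubic (c * z) = of_real ((cmod c)\<^sup>2) * (c * cubic z)"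
  by (simp add: cubic_def norm_mult power_mult_distrib)

lemma coupling_phase:
  assumes "cmod c = 1" shows "coupling (\<chi> j. c * \<psi> $ j) j = c * coupling \<psi> j"
  using assms unfolding coupling_def
  by (simp add: right_diff_distrib[symmetric] cubic_mult distrib_left[symmetric])

text \<open>
  The ring has at least 13 sites.
\<close>

lemma site_numeral_neq_0:
  assumes "6 \<le> CARD('n::finite)" and "numeral w \<le> (12::nat)"
  shows "(numeral w :: 'n site) \<noteq> 0"
proof -
  have "CARD('n site) > numeral w"
    using assms by (simp only: card_bit1)
  then have "\<not> CARD('n site) dvd numeral w"
    by (meson dvd_imp_le not_less zero_less_numeral)
  moreover have "CHAR('n site) = CARD('n site)" by (rule bit1.CHAR_eq)
  ultimately show ?thesis
    using of_nat_eq_0_iff_char_dvd[of "numeral w", where 'a="'n site"] by simp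
qed

text \<open>
  The estimates in the outer region use one bond between unexcited sites on each side of the
  core, namely 2-3 and (-3)-(-2).
\<close>

lemma sites_distinct:
  assumes "6 \<le> CARD('n::finite)" and "S = ({-1, 0, 1} :: 'n site set)"
  shows "(2::'n site) \<notin> S" "(3::'n site) \<notin> S" "(-2::'n site) \<notin> S" "(-3::'n site) \<notin> S"
    "(1::'n site) \<noteq> -1" "(-1::'n site) \<noteq> 1"
proof -
  note nz = site_numeral_neq_0[OF assms(1)]
  have 2: "(2::'n site) \<noteq> 0" and 3: "(3::'n site) \<noteq> 0" and 4: "(4::'n site) \<noteq> 0"
    by (rule nz, simp)+
  show "(2::'n site) \<notin> S" using 2 3 assms(2)
    by (auto simp: eq_neg_iff_add_eq_0 dest: arg_cong[where f="\<lambda>x. x - 1"])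
  show "(3::'n site) \<notin> S" using 2 3 4 assms(2)
    by (auto simp: eq_neg_iff_add_eq_0 dest: arg_cong[where f="\<lambda>x. x - 1"])
  show "(-2::'n site) \<notin> S" using 2 3 assms(2)
    by (auto simp: neg_eq_iff_add_eq_0 dest: arg_cong[where f="\<lambda>x. x + 2"])
  show "(-3::'n site) \<notin> S" using 2 3 4 assms(2)
    by (auto simp: neg_eq_iff_add_eq_0 dest: arg_cong[where f="\<lambda>x. x + 3"])
  show "(1::'n site) \<noteq> -1" "(-1::'n site) \<noteq> 1" using 2
    by (auto simp: eq_neg_iff_add_eq_0 dest: arg_cong[where f="\<lambda>x. x + 1"])
qed

section \<open>Linearised operators on the ring\<close>

text \<open>
  A discrete Sturm-Liouville operator: potential q on the sites, conductance k j on the bond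
  between j and j + 1.  Both blocks of the linearisation have this form.
\<close>

definition ring_op :: "('n::finite site \<Rightarrow> real) \<Rightarrow> ('n site \<Rightarrow> real) \<Rightarrow> real ^ 'n site \<Rightarrow> real ^ 'n site" where
  "ring_op q k y = (\<chi> j. q j * y $ j + k j * (y $ j - y $ (j+1)) + k (j-1) * (y $ j - y $ (j-1)))"

lemma ring_op_nth:
  "ring_op q k y $ j = q j * y $ j + k j * (y $ j - y $ (j+1)) + k (j-1) * (y $ j - y $ (j-1))"
  by (simp add: ring_op_def)

lemma linear_ring_op: "linear (ring_op q k)"
  by (rule linearI) (simp_all add: vec_eq_iff ring_op_nth algebra_simps)

lemma inner_ring_op:
  "y \<bullet> ring_op q k z = (\<Sum>j\<in>UNIV. q j * y $ j * z $ j + k j * (y $ j - y $ (j+1)) * (z $ j - z $ (j+1)))"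
proof -
  have "(\<Sum>j\<in>UNIV. k (j-1) * y $ j * (z $ j - z $ (j-1))) = (\<Sum>j\<in>UNIV. k j * y $ (j+1) * (z $ (j+1) - z $ j))"
    using sum_shift[of "\<lambda>j. k (j-1) * y $ j * (z $ j - z $ (j-1))" 1] by simp
  then show ?thesis
    by (simp add: inner_vec_def ring_op_nth algebra_simps sum.distrib sum_subtractf)
qed

text \<open>
  Summation by parts: each bond contributes the same bilinear form to both sides.
\<close>

lemma ring_op_self_adjoint: "y \<bullet> ring_op q k z = ring_op q k y \<bullet> z"
  by (subst inner_commute[of "ring_op q k y"]) (simp add: inner_ring_op mult_ac)

lemma ring_op_near_diagonal:
  assumes "\<And>j. \<bar>q j - D j\<bar> \<le> \<eta>" "\<And>j. \<bar>k j\<bar> \<le> \<eta>"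
  shows "norm (ring_op q k y - (\<chi> j. D j * y $ j)) \<le> real CARD('n site) * (5 * \<eta>) * norm (y :: real ^ 'n::finite site)"
proof -
  have comp: "\<bar>y $ j\<bar> \<le> norm y" for j by (rule component_le_norm_cart)
  have \<eta>: "\<eta> \<ge> 0" using assms(2)[of 0] by simp
  have "\<bar>(ring_op q k y - (\<chi> j. D j * y $ j)) $ j\<bar> \<le> 5 * \<eta> * norm y" for j
  proof -
    have a: "\<bar>(q j - D j) * y $ j\<bar> \<le> \<eta> * norm y"
      unfolding abs_mult by (intro mult_mono assms comp \<eta>) auto
    have d: "\<bar>k i * (y $ j - y $ l)\<bar> \<le> \<eta> * (2 * norm y)" for i l
      unfolding abs_mult using comp[of j] comp[of l] by (intro mult_mono assms \<eta>) auto
    have "(ring_op q k y - (\<chi> j. D j * y $ j)) $ j =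
        (q j - D j) * y $ j + k j * (y $ j - y $ (j+1)) + k (j-1) * (y $ j - y $ (j-1))"
      by (simp add: ring_op_nth algebra_simps)
    then show ?thesis using a d[of j "j+1"] d[of "j-1" "j-1"] by linarith
  qed
  then have "(\<Sum>j\<in>UNIV. \<bar>(ring_op q k y - (\<chi> j. D j * y $ j)) $ j\<bar>) \<le> (\<Sum>j\<in>(UNIV::'n site set). 5 * \<eta> * norm y)"
    by (intro sum_mono)
  then show ?thesis
    using norm_le_l1_cart[of "ring_op q k y - (\<chi> j. D j * y $ j)"] by (simp add: mult_ac)
qed

text \<open>
  The limit of both blocks of the linearisation for vanishing coupling.
\<close>

definition site_diag :: "'n::finite site set \<Rightarrow> real \<Rightarrow> real \<Rightarrow> real ^ 'n site \<Rightarrow> real ^ 'n site" where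
  "site_diag S c d y = (\<chi> j. (if j \<in> S then c else d) * y $ j)"

lemma site_diag_nth [simp]: "site_diag S c d y $ j = (if j \<in> S then c else d) * y $ j"
  by (simp add: site_diag_def)

lemma linear_site_diag: "linear (site_diag S c d)"
  by (rule linearI) (simp_all add: vec_eq_iff algebra_simps)

lemma norm_site_diag:
  assumes "\<bar>c\<bar> \<le> K" "\<bar>d\<bar> \<le> K" shows "norm (site_diag S c d y) \<le> K * norm y"
proof -
  have K: "K \<ge> 0" using assms by linarith
  have "norm (site_diag S c d y) \<le> norm (K *\<^sub>R y)"
  proof (rule norm_le_componentwise_cart)
    fix j show "norm (site_diag S c d y $ j) \<le> norm ((K *\<^sub>R y) $ j)"
      using assms K by (auto simp: abs_mult intro!: mult_right_mono)
  qed
  then show ?thesis using K by simp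
qed

lemma inner_site_diag_ge:
  assumes "c \<ge> K" "d \<ge> K" shows "y \<bullet> site_diag S c d y \<ge> K * (norm y)\<^sup>2"
proof -
  have "K * (norm y)\<^sup>2 = (\<Sum>j\<in>UNIV. K * (y $ j * y $ j))"
    by (simp add: power2_norm_eq_inner inner_vec_def sum_distrib_left)
  also have "\<dots> \<le> (\<Sum>j\<in>UNIV. (if j \<in> S then c else d) * (y $ j * y $ j))"
    using assms by (intro sum_mono mult_right_mono) auto
  finally show ?thesis by (simp add: inner_vec_def mult_ac)
qed

text \<open>
  The current through the bond from j to j + 1.
\<close>

definition wronskian :: "('n::finite site \<Rightarrow> real) \<Rightarrow> real ^ 'n site \<Rightarrow> real ^ 'n site \<Rightarrow> 'n site \<Rightarrow> real" where
  "wronskian k x y j = k j * (x $ j * y $ (j+1) - x $ (j+1) * y $ j)"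

text \<open>
  The Lagrange identity: the current changes only at sites where one of the two vectors fails to
  be annihilated.
\<close>

lemma wronskian_step:
  "x $ j * ring_op q k y $ j - y $ j * ring_op q k x $ j = wronskian k x y (j-1) - wronskian k x y j"
  by (simp add: ring_op_nth wronskian_def algebra_simps)

text \<open>
  The equation of a standing wave with frequency 1 + I.
\<close>

definition stationary :: "real \<Rightarrow> real \<Rightarrow> 'n::finite state \<Rightarrow> bool" where
  "stationary I \<epsilon> \<phi> \<longleftrightarrow>
     (\<forall>j. of_real ((cmod (\<phi> $ j))\<^sup>2 - I) * \<phi> $ j + 2 * of_real \<epsilon> * coupling \<phi> j = 0)"

definition jump :: "'n::finite state \<Rightarrow> 'n site \<Rightarrow> real" where
  "jump \<phi> j = (cmod (\<phi> $ (j+1) - \<phi> $ j))\<^sup>2"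

text \<open>
  For real phi these two operators are the blocks of the linearisation at the standing wave,
  acting on imaginary and on real perturbations respectively.  The factor 3 in Lp is the derivative
  of a real cube.  Lm also makes sense for complex phi and is then the operator whose kernel
  contains both parts of phi.
\<close>

definition Lm :: "real \<Rightarrow> real \<Rightarrow> 'n::finite state \<Rightarrow> real ^ 'n site \<Rightarrow> real ^ 'n site" where
  "Lm I \<epsilon> \<phi> = ring_op (\<lambda>j. (cmod (\<phi> $ j))\<^sup>2 - I) (\<lambda>j. 2 * \<epsilon> * jump \<phi> j)"

definition Lp :: "real \<Rightarrow> real \<Rightarrow> 'n::finite state \<Rightarrow> real ^ 'n site \<Rightarrow> real ^ 'n site" where
  "Lp I \<epsilon> \<phi> = ring_op (\<lambda>j. 3 * (cmod (\<phi> $ j))\<^sup>2 - I) (\<lambda>j. 6 * \<epsilon> * jump \<phi> j)"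

definition re_part :: "'n::finite state \<Rightarrow> real ^ 'n site" where "re_part \<phi> = (\<chi> j. Re (\<phi> $ j))"
definition im_part :: "'n::finite state \<Rightarrow> real ^ 'n site" where "im_part \<phi> = (\<chi> j. Im (\<phi> $ j))"

lemma coupling_jump: "coupling \<phi> j = of_real (jump \<phi> j) * (\<phi> $ j - \<phi> $ (j+1)) + of_real (jump \<phi> (j-1)) * (\<phi> $ j - \<phi> $ (j-1))"
  by (simp add: coupling_def cubic_def jump_def norm_minus_commute)

text \<open>
  The coefficients of the standing wave equation depend on moduli only and are therefore real.
\<close>

lemma stationary_kernel:
  assumes "stationary I \<epsilon> \<phi>"
  shows "Lm I \<epsilon> \<phi> (re_part \<phi>) = 0" "Lm I \<epsilon> \<phi> (im_part \<phi>) = 0"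
proof -
  have st: "of_real ((cmod (\<phi> $ j))\<^sup>2 - I) * \<phi> $ j + 2 * of_real \<epsilon> * coupling \<phi> j = 0" for j
    using assms by (simp add: stationary_def)
  show "Lm I \<epsilon> \<phi> (re_part \<phi>) = 0"
    using arg_cong[OF st, of Re]
    by (simp add: vec_eq_iff Lm_def ring_op_nth re_part_def coupling_jump algebra_simps)
  show "Lm I \<epsilon> \<phi> (im_part \<phi>) = 0"
    using arg_cong[OF st, of Im]
    by (simp add: vec_eq_iff Lm_def ring_op_nth im_part_def coupling_jump algebra_simps)
qed

section \<open>Asymptotics of a family of standing waves\<close>

text \<open>
  A family of standing waves whose limit at zero coupling has the signs sigma on the core.  The
  waves may be complex and need not depend continuously on the coupling.
\<close>

locale standing_wave_family =
  fixes I :: real and S :: "'n::finite site set" and \<phi> :: "real \<Rightarrow> 'n state" and \<sigma> :: "'n site \<Rightarrow> real"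
  assumes card_ge: "6 \<le> CARD('n)" and S_def: "S = {-1, 0, 1}" and I_pos: "I > 0"
    and sign: "\<And>j. j \<in> S \<Longrightarrow> \<sigma> j = 1 \<or> \<sigma> j = - 1" and sign_0: "\<sigma> 0 = 1"
    and sign_off: "\<And>j. j \<notin> S \<Longrightarrow> \<sigma> j = 0"
    and ev_stationary: "\<forall>\<^sub>0\<epsilon>. stationary I \<epsilon> (\<phi> \<epsilon>)"
    and limit: "\<And>j. ((\<lambda>\<epsilon>. \<phi> \<epsilon> $ j) \<longlongrightarrow> of_real (\<sigma> j * sqrt I)) (at_right 0)"
begin

text \<open>
  For decay_at and small_flux_at, M is a bound on the core values of a vector that is
  annihilated off the core; the flux is the Wronskian with the real part of the wave.
\<close>

abbreviation "LM \<epsilon> \<equiv> Lm I \<epsilon> (\<phi> \<epsilon>)"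
abbreviation "LP \<epsilon> \<equiv> Lp I \<epsilon> (\<phi> \<epsilon>)"
abbreviation "outer_null \<epsilon> y \<equiv> \<forall>j. j \<notin> S \<longrightarrow> LM \<epsilon> y $ j = 0"
abbreviation "core_le y M \<equiv> \<forall>j\<in>S. \<bar>y $ j\<bar> \<le> M"
abbreviation "flux \<epsilon> \<equiv> wronskian (\<lambda>j. 2 * \<epsilon> * jump (\<phi> \<epsilon>) j) (re_part (\<phi> \<epsilon>))"
abbreviation "decay_at C \<epsilon> \<equiv> \<forall>y M. outer_null \<epsilon> y \<longrightarrow> core_le y M \<longrightarrow> (\<forall>j. j \<notin> S \<longrightarrow> \<bar>y $ j\<bar> \<le> C * \<epsilon> * M)"
abbreviation "small_flux_at C \<epsilon> \<equiv> \<forall>y M. outer_null \<epsilon> y \<longrightarrow> core_le y M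
  \<longrightarrow> \<bar>flux \<epsilon> y 1\<bar> \<le> C * \<epsilon> ^ 5 * M \<and> \<bar>flux \<epsilon> y (-2)\<bar> \<le> C * \<epsilon> ^ 5 * M"

lemmas distinct = sites_distinct[OF card_ge S_def]

lemma in_S: "-1 \<in> S" "0 \<in> S" "1 \<in> S" by (simp_all add: S_def)

lemma ev_pos: "\<forall>\<^sub>0\<epsilon>. \<epsilon> > 0"
  by (rule eventually_at_right_less)

lemma ev_le: "c > 0 \<Longrightarrow> \<forall>\<^sub>0\<epsilon>. \<epsilon> \<le> c"
  by (intro eventually_at_rightI[of 0 c]) auto

lemma limit_sq: "((\<lambda>\<epsilon>. (cmod (\<phi> \<epsilon> $ j))\<^sup>2) \<longlongrightarrow> (if j \<in> S then I else 0)) (at_right 0)"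
proof -
  have "((\<lambda>\<epsilon>. (cmod (\<phi> \<epsilon> $ j))\<^sup>2) \<longlongrightarrow> (cmod (of_real (\<sigma> j * sqrt I)))\<^sup>2) (at_right 0)"
    by (intro tendsto_intros limit)
  also have "(cmod (of_real (\<sigma> j * sqrt I)))\<^sup>2 = (if j \<in> S then I else 0)"
    using sign[of j] sign_off[of j] I_pos by (auto simp: norm_mult power_mult_distrib)
  finally show ?thesis .
qed

lemma limit_coupling:
  "((\<lambda>\<epsilon>. coupling (\<phi> \<epsilon>) j) \<longlongrightarrow> coupling (\<chi> j. of_real (\<sigma> j * sqrt I)) j) (at_right 0)"
  unfolding coupling_def cubic_def vec_lambda_beta by (intro tendsto_intros limit)

lemma limit_jump: "((\<lambda>\<epsilon>. jump (\<phi> \<epsilon>) j) \<longlongrightarrow> (\<sigma> (j+1) - \<sigma> j)\<^sup>2 * I) (at_right 0)"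
proof -
  have "((\<lambda>\<epsilon>. jump (\<phi> \<epsilon>) j) \<longlongrightarrow> (cmod (of_real (\<sigma> (j+1) * sqrt I) - of_real (\<sigma> j * sqrt I)))\<^sup>2) (at_right 0)"
    unfolding jump_def by (intro tendsto_intros limit)
  also have "(cmod (of_real (\<sigma> (j+1) * sqrt I) - of_real (\<sigma> j * sqrt I)))\<^sup>2 = (\<sigma> (j+1) - \<sigma> j)\<^sup>2 * I"
    unfolding of_real_diff[symmetric] norm_of_real left_diff_distrib[symmetric]
    using I_pos by (simp add: power_mult_distrib)
  finally show ?thesis .
qed

lemma ev_ball:
  assumes "\<And>j. ((\<lambda>\<epsilon>. f \<epsilon> j) \<longlongrightarrow> (L j :: real)) (at_right 0)" "\<eta> > 0"
  shows "\<forall>\<^sub>0\<epsilon>. \<forall>j::'n site. \<bar>f \<epsilon> j - L j\<bar> \<le> \<eta>"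
proof (rule eventually_all_finite)
  fix j
  have "\<forall>\<^sub>0\<epsilon>. dist (f \<epsilon> j) (L j) < \<eta>" using assms tendstoD by blast
  then show "\<forall>\<^sub>0\<epsilon>. \<bar>f \<epsilon> j - L j\<bar> \<le> \<eta>" by eventually_elim (simp add: dist_real_def)
qed

lemma ev_jump_bounded: "\<forall>\<^sub>0\<epsilon>. \<forall>j. 0 \<le> jump (\<phi> \<epsilon>) j \<and> jump (\<phi> \<epsilon>) j \<le> 4 * I + 1"
proof -
  have b: "(\<sigma> (j+1) - \<sigma> j)\<^sup>2 * I \<le> 4 * I" for j
  proof -
    have s: "\<bar>\<sigma> i\<bar> \<le> 1" for i using sign[of i] sign_off[of i] by (cases "i \<in> S") auto
    have "\<bar>\<sigma> (j+1) - \<sigma> j\<bar> \<le> 2" using s[of j] s[of "j+1"] by linarith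
    then have "(\<sigma> (j+1) - \<sigma> j)\<^sup>2 \<le> 2\<^sup>2" by (metis abs_le_square_iff abs_numeral)
    then show ?thesis using I_pos by (simp add: mult_right_mono)
  qed
  have "\<forall>\<^sub>0\<epsilon>. \<forall>j. \<bar>jump (\<phi> \<epsilon>) j - (\<sigma> (j+1) - \<sigma> j)\<^sup>2 * I\<bar> \<le> 1"
    by (rule ev_ball[OF limit_jump zero_less_one])
  then show ?thesis
  proof eventually_elim
    case (elim \<epsilon>)
    show ?case
    proof
      fix j
      have "\<bar>jump (\<phi> \<epsilon>) j - (\<sigma> (j+1) - \<sigma> j)\<^sup>2 * I\<bar> \<le> 1" using elim by blast
      then show "0 \<le> jump (\<phi> \<epsilon>) j \<and> jump (\<phi> \<epsilon>) j \<le> 4 * I + 1"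
        using b[of j] by (auto simp: jump_def)
    qed
  qed
qed

lemma ev_near_diagonal:
  assumes "c > 0" "\<eta> > 0"
  shows "\<forall>\<^sub>0\<epsilon>. \<forall>j. \<bar>c * \<epsilon> * jump (\<phi> \<epsilon>) j\<bar> \<le> \<eta>"
proof -
  have "\<eta> / (c * (4 * I + 1)) > 0" using assms I_pos by simp
  from ev_jump_bounded ev_pos ev_le[OF this] show ?thesis
  proof eventually_elim
  case (elim \<epsilon>)
  show ?case
  proof
  fix j
  have "c * \<epsilon> * jump (\<phi> \<epsilon>) j \<le> c * \<epsilon> * (4 * I + 1)"
    using elim assms by (intro mult_left_mono) auto
  also have "\<dots> \<le> c * (\<eta> / (c * (4 * I + 1))) * (4 * I + 1)"
    using elim assms I_pos by (intro mult_right_mono mult_left_mono) auto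
  also have "c * (\<eta> / (c * d)) * d = \<eta>" if "d > 0" for d
    using assms that by simp
  then have "c * (\<eta> / (c * (4 * I + 1))) * (4 * I + 1) = \<eta>"
    using I_pos by simp
  finally show "\<bar>c * \<epsilon> * jump (\<phi> \<epsilon>) j\<bar> \<le> \<eta>" using elim assms by (simp add: abs_mult)
  qed
  qed
qed

lemma ev_Lm_near:
  assumes "\<eta> > 0"
  shows "\<forall>\<^sub>0\<epsilon>. \<forall>y. norm (LM \<epsilon> y - site_diag S 0 (- I) y) \<le> \<eta> * norm y"
proof -
  define \<delta> where "\<delta> = \<eta> / (real CARD('n site) * 5)"
  have \<delta>: "\<delta> > 0" using assms by (simp add: \<delta>_def)
  have "((\<lambda>\<epsilon>. (cmod (\<phi> \<epsilon> $ j))\<^sup>2 - I) \<longlongrightarrow> (if j \<in> S then 0 else - I)) (at_right 0)" for j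
    using tendsto_diff[OF limit_sq[of j] tendsto_const[of I]] by (auto split: if_splits)
  then have "\<forall>\<^sub>0\<epsilon>. \<forall>j. \<bar>(cmod (\<phi> \<epsilon> $ j))\<^sup>2 - I - (if j \<in> S then 0 else - I)\<bar> \<le> \<delta>"
    by (intro ev_ball \<delta>)
  moreover have "\<forall>\<^sub>0\<epsilon>. \<forall>j. \<bar>2 * \<epsilon> * jump (\<phi> \<epsilon>) j\<bar> \<le> \<delta>"
    by (rule ev_near_diagonal) (use \<delta> in auto)
  ultimately show ?thesis
  proof eventually_elim
    case (elim \<epsilon>)
    have "norm (LM \<epsilon> y - site_diag S 0 (- I) y) \<le> real CARD('n site) * (5 * \<delta>) * norm y" for y
      unfolding Lm_def site_diag_def by (rule ring_op_near_diagonal) (use elim in auto)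
    then show ?case by (simp add: \<delta>_def del: card_bit1)
  qed
qed

lemma ev_Lp_near:
  assumes "\<eta> > 0"
  shows "\<forall>\<^sub>0\<epsilon>. \<forall>y. norm (LP \<epsilon> y - site_diag S (2 * I) (- I) y) \<le> \<eta> * norm y"
proof -
  define \<delta> where "\<delta> = \<eta> / (real CARD('n site) * 5)"
  have \<delta>: "\<delta> > 0" using assms by (simp add: \<delta>_def)
  have "((\<lambda>\<epsilon>. 3 * (cmod (\<phi> \<epsilon> $ j))\<^sup>2 - I) \<longlongrightarrow> (if j \<in> S then 2 * I else - I)) (at_right 0)" for j
    using tendsto_diff[OF tendsto_mult[OF tendsto_const[of 3] limit_sq[of j]] tendsto_const[of I]]
    by (auto split: if_splits)
  then have "\<forall>\<^sub>0\<epsilon>. \<forall>j. \<bar>3 * (cmod (\<phi> \<epsilon> $ j))\<^sup>2 - I - (if j \<in> S then 2 * I else - I)\<bar> \<le> \<delta>"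
    by (intro ev_ball \<delta>)
  moreover have "\<forall>\<^sub>0\<epsilon>. \<forall>j. \<bar>6 * \<epsilon> * jump (\<phi> \<epsilon>) j\<bar> \<le> \<delta>"
    by (rule ev_near_diagonal) (use \<delta> in auto)
  ultimately show ?thesis
  proof eventually_elim
    case (elim \<epsilon>)
    have "norm (LP \<epsilon> y - site_diag S (2 * I) (- I) y) \<le> real CARD('n site) * (5 * \<delta>) * norm y" for y
      unfolding Lp_def site_diag_def by (rule ring_op_near_diagonal) (use elim in auto)
    then show ?case by (simp add: \<delta>_def del: card_bit1)
  qed
qed

lemma ev_amplitude_off: "\<forall>\<^sub>0\<epsilon>. \<forall>j. j \<notin> S \<longrightarrow> (cmod (\<phi> \<epsilon> $ j))\<^sup>2 - I \<le> - I / 2"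
proof -
  have "\<forall>\<^sub>0\<epsilon>. \<forall>j. \<bar>(cmod (\<phi> \<epsilon> $ j))\<^sup>2 - (if j \<in> S then I else 0)\<bar> \<le> I / 2"
    by (rule ev_ball[OF limit_sq]) (use I_pos in auto)
  then show ?thesis
  proof eventually_elim
    case (elim \<epsilon>)
    show ?case
    proof safe
      fix j assume "j \<notin> S"
      then have "\<bar>(cmod (\<phi> \<epsilon> $ j))\<^sup>2\<bar> \<le> I / 2" using elim by (metis diff_zero)
      then show "(cmod (\<phi> \<epsilon> $ j))\<^sup>2 - I \<le> - I / 2" by simp
    qed
  qed
qed

text \<open>
  At an unexcited site the potential is close to -I, so the standing wave equation can be solved
  for the amplitude, and the right-hand side carries a factor eps.
\<close>

lemma ev_off_small: "\<exists>C>0. \<forall>\<^sub>0\<epsilon>. \<forall>j. j \<notin> S \<longrightarrow> cmod (\<phi> \<epsilon> $ j) \<le> C * \<epsilon>"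
proof -
  let ?a = "\<chi> j. complex_of_real (\<sigma> j * sqrt I)"
  define K where "K = (\<Sum>j\<in>UNIV. cmod (coupling ?a j)) + 1"
  have K: "K > 0" unfolding K_def by (intro add_nonneg_pos sum_nonneg) auto
  have "\<forall>\<^sub>0\<epsilon>. \<forall>j. \<bar>cmod (coupling (\<phi> \<epsilon>) j) - cmod (coupling ?a j)\<bar> \<le> 1"
    by (rule ev_ball) (intro tendsto_norm limit_coupling, simp)
  then have cb: "\<forall>\<^sub>0\<epsilon>. \<forall>j. cmod (coupling (\<phi> \<epsilon>) j) \<le> K"
  proof eventually_elim
    case (elim \<epsilon>)
    have aK: "cmod (coupling ?a j) \<le> K - 1" for j
      unfolding K_def using member_le_sum[of j UNIV "\<lambda>j. cmod (coupling ?a j)"] by simp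
    show ?case
    proof
      fix j
      have "\<bar>cmod (coupling (\<phi> \<epsilon>) j) - cmod (coupling ?a j)\<bar> \<le> 1" using elim by blast
      then show "cmod (coupling (\<phi> \<epsilon>) j) \<le> K" using aK[of j] by linarith
    qed
  qed
  show ?thesis
  proof (intro exI conjI)
    show "4 * K / I > 0" using K I_pos by simp
    show "\<forall>\<^sub>0\<epsilon>. \<forall>j. j \<notin> S \<longrightarrow> cmod (\<phi> \<epsilon> $ j) \<le> 4 * K / I * \<epsilon>"
      using cb ev_amplitude_off ev_stationary ev_pos
    proof eventually_elim
      case (elim \<epsilon>)
      show ?case
      proof safe
        fix j assume j: "j \<notin> S"
        let ?q = "(cmod (\<phi> \<epsilon> $ j))\<^sup>2 - I"
        have q: "?q \<le> - I / 2" using elim(2) j by blast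
        have "of_real ?q * \<phi> \<epsilon> $ j = - (2 * of_real \<epsilon> * coupling (\<phi> \<epsilon>) j)"
          using elim(3) by (simp add: stationary_def eq_neg_iff_add_eq_0)
        from arg_cong[OF this, of cmod]
        have "\<bar>?q\<bar> * cmod (\<phi> \<epsilon> $ j) = 2 * \<epsilon> * cmod (coupling (\<phi> \<epsilon>) j)"
          using elim(4) by (simp only: norm_mult norm_minus_cancel norm_of_real norm_numeral abs_of_pos)
        also have "\<dots> \<le> 2 * \<epsilon> * K" using elim by (intro mult_left_mono) auto
        finally have u: "\<bar>?q\<bar> * cmod (\<phi> \<epsilon> $ j) \<le> 2 * \<epsilon> * K" .
        have "I / 2 \<le> \<bar>?q\<bar>" using q I_pos by linarith
        then have "I / 2 * cmod (\<phi> \<epsilon> $ j) \<le> 2 * \<epsilon> * K"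
          by (rule order_trans[OF mult_right_mono[OF _ norm_ge_zero] u])
        then show "cmod (\<phi> \<epsilon> $ j) \<le> 4 * K / I * \<epsilon>" using I_pos by (simp add: field_simps)
      qed
    qed
  qed
qed

text \<open>
  Dividing the standing wave equation by eps phi_j expresses the amplitude shift of a core site
  through its couplings, whose limits are known.
\<close>

lemma limit_detuning:
  assumes j: "j \<in> S"
  shows "((\<lambda>\<epsilon>. ((cmod (\<phi> \<epsilon> $ j))\<^sup>2 - I) / \<epsilon>) \<longlongrightarrow>
     - 2 * I * \<sigma> j * ((\<sigma> j - \<sigma> (j+1)) ^ 3 + (\<sigma> j - \<sigma> (j-1)) ^ 3)) (at_right 0)"
proof -
  let ?a = "\<chi> j. complex_of_real (\<sigma> j * sqrt I)"
  have sj: "\<sigma> j \<noteq> 0" "\<sigma> j * \<sigma> j = 1" using sign[OF j] by auto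
  have nz: "complex_of_real (\<sigma> j * sqrt I) \<noteq> 0" using sj I_pos by simp
  have l: "((\<lambda>\<epsilon>. Re (- 2 * coupling (\<phi> \<epsilon>) j / (\<phi> \<epsilon> $ j))) \<longlongrightarrow> Re (- 2 * coupling ?a j / of_real (\<sigma> j * sqrt I))) (at_right 0)"
    by (intro tendsto_intros limit limit_coupling nz)
  have cb: "cubic (of_real (x * sqrt I) - of_real (y * sqrt I)) = of_real (I * sqrt I * (x - y) ^ 3)" for x y
  proof -
    have "cubic (of_real (x * sqrt I) - of_real (y * sqrt I)) = of_real (((x - y) * sqrt I)\<^sup>2 * ((x - y) * sqrt I))"
      unfolding cubic_def of_real_diff[symmetric] norm_of_real by (simp add: left_diff_distrib[symmetric] flip: of_real_mult of_real_power)
    also have "((x - y) * sqrt I)\<^sup>2 * ((x - y) * sqrt I) = I * sqrt I * (x - y) ^ 3"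
      using I_pos by (simp add: power_mult_distrib power2_eq_square power3_eq_cube algebra_simps)
    finally show ?thesis .
  qed
  have "- 2 * coupling ?a j / of_real (\<sigma> j * sqrt I)
     = of_real (- 2 * (I * sqrt I * ((\<sigma> j - \<sigma> (j+1)) ^ 3 + (\<sigma> j - \<sigma> (j-1)) ^ 3)) / (\<sigma> j * sqrt I))"
    unfolding coupling_def vec_lambda_beta cb by (simp add: distrib_left)
  also have "Re \<dots> = - 2 * (I * sqrt I * ((\<sigma> j - \<sigma> (j+1)) ^ 3 + (\<sigma> j - \<sigma> (j-1)) ^ 3)) / (\<sigma> j * sqrt I)"
    by (rule Re_complex_of_real)
  also have "\<dots> = - 2 * I * ((\<sigma> j - \<sigma> (j+1)) ^ 3 + (\<sigma> j - \<sigma> (j-1)) ^ 3) / \<sigma> j"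
    using I_pos sj by (simp add: field_simps)
  also have "\<dots> = - 2 * I * \<sigma> j * ((\<sigma> j - \<sigma> (j+1)) ^ 3 + (\<sigma> j - \<sigma> (j-1)) ^ 3)"
    using sign[OF j] by auto
  finally have lim: "Re (- 2 * coupling ?a j / of_real (\<sigma> j * sqrt I)) = \<dots>" .
  have "\<forall>\<^sub>0\<epsilon>. \<phi> \<epsilon> $ j \<noteq> 0" using limit nz by (rule tendsto_imp_eventually_ne)
  then have "\<forall>\<^sub>0\<epsilon>. Re (- 2 * coupling (\<phi> \<epsilon>) j / (\<phi> \<epsilon> $ j)) = ((cmod (\<phi> \<epsilon> $ j))\<^sup>2 - I) / \<epsilon>"
    using ev_stationary ev_pos
  proof eventually_elim
    case (elim \<epsilon>)
    let ?q = "(cmod (\<phi> \<epsilon> $ j))\<^sup>2 - I"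
    have "of_real ?q * \<phi> \<epsilon> $ j + 2 * of_real \<epsilon> * coupling (\<phi> \<epsilon>) j = 0"
      using elim(2) unfolding stationary_def by blast
    then have "- 2 * coupling (\<phi> \<epsilon>) j * of_real \<epsilon> = of_real ?q * \<phi> \<epsilon> $ j"
      by (simp add: add_eq_0_iff mult_ac)
    then have "- 2 * coupling (\<phi> \<epsilon>) j / \<phi> \<epsilon> $ j = of_real (?q / \<epsilon>)"
      using elim by (simp add: field_simps)
    then show ?case by simp
  qed
  with l show ?thesis unfolding lim by (rule Lim_transform_eventually)
qed

text \<open>
  Out of phase, the ends of the bond differ by about 2 sqrt I.  In phase they differ because their
  amplitudes are detuned at different rates, which is the condition on the cubes.
\<close>

lemma ev_jump_lower_edge:
  assumes i: "i \<in> S" "i + 1 \<in> S"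
    and ne: "\<sigma> (i+1) = \<sigma> i \<Longrightarrow> (\<sigma> (i+1) - \<sigma> (i+1+1)) ^ 3 \<noteq> (\<sigma> i - \<sigma> (i-1)) ^ 3"
  shows "\<exists>c>0. \<forall>\<^sub>0\<epsilon>. c * \<epsilon>\<^sup>2 \<le> jump (\<phi> \<epsilon>) i"
proof (cases "\<sigma> (i+1) = \<sigma> i")
  case False
  then have "(\<sigma> (i+1) - \<sigma> i)\<^sup>2 = 4" using sign[OF i(1)] sign[OF i(2)] by auto
  then have "\<forall>\<^sub>0\<epsilon>. I < jump (\<phi> \<epsilon>) i"
    using limit_jump[of i] I_pos by (intro order_tendstoD(1)[OF limit_jump]) auto
  then have "\<forall>\<^sub>0\<epsilon>. I * \<epsilon>\<^sup>2 \<le> jump (\<phi> \<epsilon>) i"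
    using ev_le[OF zero_less_one] ev_pos
  proof eventually_elim
    case (elim \<epsilon>)
    have "\<epsilon>\<^sup>2 \<le> 1" using elim by (simp add: power_le_one)
    then have "I * \<epsilon>\<^sup>2 \<le> I" using I_pos by simp
    with elim show ?case by linarith
  qed
  then show ?thesis using I_pos by blast
next
  case True
  define d where "d = - 2 * I * \<sigma> i * ((\<sigma> (i+1) - \<sigma> (i+1+1)) ^ 3 - (\<sigma> i - \<sigma> (i-1)) ^ 3)"
  have d: "d \<noteq> 0" using ne[OF True] I_pos sign[OF i(1)] by (auto simp: d_def)
  have "((\<lambda>\<epsilon>. ((cmod (\<phi> \<epsilon> $ (i+1)))\<^sup>2 - I) / \<epsilon> - ((cmod (\<phi> \<epsilon> $ i))\<^sup>2 - I) / \<epsilon>) \<longlongrightarrow> d) (at_right 0)"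
    using tendsto_diff[OF limit_detuning[OF i(2)] limit_detuning[OF i(1)]] True
    by (simp add: d_def algebra_simps)
  then have gap: "\<forall>\<^sub>0\<epsilon>. \<bar>d\<bar> / 2 < \<bar>((cmod (\<phi> \<epsilon> $ (i+1)))\<^sup>2 - I) / \<epsilon> - ((cmod (\<phi> \<epsilon> $ i))\<^sup>2 - I) / \<epsilon>\<bar>"
    using d by (intro order_tendstoD(1)[OF tendsto_rabs]) auto
  have b: "\<forall>\<^sub>0\<epsilon>. cmod (\<phi> \<epsilon> $ j) < 2 * sqrt I" if "j \<in> S" for j
  proof -
    have "cmod (of_real (\<sigma> j * sqrt I)) < 2 * sqrt I"
      using sign[OF that] I_pos by (auto simp: norm_mult)
    then show ?thesis using order_tendstoD(2)[OF tendsto_norm[OF limit]] by blast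
  qed
  have "\<forall>\<^sub>0\<epsilon>. (\<bar>d\<bar> / (8 * sqrt I))\<^sup>2 * \<epsilon>\<^sup>2 \<le> jump (\<phi> \<epsilon>) i"
    using gap b[OF i(1)] b[OF i(2)] ev_pos
  proof eventually_elim
    case (elim \<epsilon>)
    let ?x = "cmod (\<phi> \<epsilon> $ (i+1))" and ?y = "cmod (\<phi> \<epsilon> $ i)" and ?D = "cmod (\<phi> \<epsilon> $ (i+1) - \<phi> \<epsilon> $ i)"
    have "\<bar>d\<bar> / 2 * \<epsilon> \<le> \<bar>(?x\<^sup>2 - I) / \<epsilon> - (?y\<^sup>2 - I) / \<epsilon>\<bar> * \<epsilon>"
      using elim by (intro mult_right_mono) auto
    also have "\<dots> = \<bar>((?x\<^sup>2 - I) / \<epsilon> - (?y\<^sup>2 - I) / \<epsilon>) * \<epsilon>\<bar>" using elim by (simp add: abs_mult)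
    also have "((?x\<^sup>2 - I) / \<epsilon> - (?y\<^sup>2 - I) / \<epsilon>) * \<epsilon> = (?x - ?y) * (?x + ?y)"
      using elim by (simp add: field_simps power2_eq_square)
    also have "\<bar>(?x - ?y) * (?x + ?y)\<bar> = \<bar>?x - ?y\<bar> * (?x + ?y)" by (simp add: abs_mult)
    also have "\<dots> \<le> ?D * (4 * sqrt I)"
      using elim by (intro mult_mono norm_triangle_ineq3) auto
    finally have "\<bar>d\<bar> / (8 * sqrt I) * \<epsilon> \<le> ?D" using I_pos by (simp add: field_simps)
    then have "(\<bar>d\<bar> / (8 * sqrt I) * \<epsilon>)\<^sup>2 \<le> ?D\<^sup>2"
      using elim I_pos by (intro power_mono) auto
    then show ?case unfolding jump_def power_mult_distrib[symmetric] .
  qed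
  moreover have "(\<bar>d\<bar> / (8 * sqrt I))\<^sup>2 > 0" using d I_pos by simp
  ultimately show ?thesis by blast
qed

text \<open>
  The detuning rates do differ on every in-phase bond: for an end site the contribution of its
  unexcited neighbour is 1, while the contribution to the centre from its other bond is 0 or 8.
\<close>

lemma ev_jump_lower:
  "\<exists>c>0. \<forall>\<^sub>0\<epsilon>. c * \<epsilon>\<^sup>2 \<le> jump (\<phi> \<epsilon>) 0 \<and> c * \<epsilon>\<^sup>2 \<le> jump (\<phi> \<epsilon>) (-1)"
proof -
  have s2: "\<sigma> 2 = 0" "\<sigma> (-2) = 0" using distinct sign_off by auto
  have s1: "\<sigma> 1 = 1 \<or> \<sigma> 1 = -1" "\<sigma> (-1) = 1 \<or> \<sigma> (-1) = -1" using sign in_S by auto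
  have "\<exists>c>0. \<forall>\<^sub>0\<epsilon>. c * \<epsilon>\<^sup>2 \<le> jump (\<phi> \<epsilon>) 0"
    by (rule ev_jump_lower_edge) (use in_S s1 s2 sign_0 in auto)
  moreover have "\<exists>c>0. \<forall>\<^sub>0\<epsilon>. c * \<epsilon>\<^sup>2 \<le> jump (\<phi> \<epsilon>) (-1)"
    by (rule ev_jump_lower_edge) (use in_S s1 s2 sign_0 in auto)
  ultimately obtain c c' where c: "c > 0" "c' > 0" "\<forall>\<^sub>0\<epsilon>. c * \<epsilon>\<^sup>2 \<le> jump (\<phi> \<epsilon>) 0"
    "\<forall>\<^sub>0\<epsilon>. c' * \<epsilon>\<^sup>2 \<le> jump (\<phi> \<epsilon>) (-1)" by blast
  have "\<forall>\<^sub>0\<epsilon>. min c c' * \<epsilon>\<^sup>2 \<le> jump (\<phi> \<epsilon>) 0 \<and> min c c' * \<epsilon>\<^sup>2 \<le> jump (\<phi> \<epsilon>) (-1)"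
    using c(3,4)
  proof eventually_elim
    case (elim \<epsilon>)
    have "min c c' * \<epsilon>\<^sup>2 \<le> c * \<epsilon>\<^sup>2" "min c c' * \<epsilon>\<^sup>2 \<le> c' * \<epsilon>\<^sup>2" by (intro mult_right_mono; simp)+
    with elim show ?case by linarith
  qed
  then show ?thesis using c(1,2) by (intro exI[of _ "min c c'"]) simp
qed

text \<open>
  Unless the vector vanishes, its largest entry sits on the core, since off the core each entry is
  at most C eps times the largest one.
\<close>

lemma ev_decay:
  "\<exists>C>0. \<forall>\<^sub>0\<epsilon>. decay_at C \<epsilon>"
proof -
  define K where "K = 4 * I + 1"
  have K: "K > 0" using I_pos by (simp add: K_def)
  define C where "C = 16 * K / I"
  have C: "C > 0" using K I_pos by (simp add: C_def)
  have "1 / (2 * C) > 0" using C by simp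
  from ev_le[OF this] ev_jump_bounded ev_amplitude_off ev_pos
  have "\<forall>\<^sub>0\<epsilon>. decay_at C \<epsilon>"
  proof eventually_elim
    case (elim \<epsilon>)
    show ?case
    proof safe
      fix y M j
      assume off: "outer_null \<epsilon> y" and M: "core_le y M" and j: "j \<notin> S"
      define m where "m = Max (range (\<lambda>j. \<bar>y $ j\<bar>))"
      have m: "\<bar>y $ i\<bar> \<le> m" for i unfolding m_def by (rule Max_ge) auto
      have "m \<in> range (\<lambda>j. \<bar>y $ j\<bar>)" unfolding m_def by (rule Max_in) auto
      then obtain i0 where i0: "m = \<bar>y $ i0\<bar>" by auto
      have bd: "\<bar>y $ i\<bar> \<le> C * \<epsilon> * m" if i: "i \<notin> S" for i
      proof -
        define q where "q = (cmod (\<phi> \<epsilon> $ i))\<^sup>2 - I"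
        define k where "k = (\<lambda>i. 2 * \<epsilon> * jump (\<phi> \<epsilon>) i)"
        have t: "\<bar>k l * (y $ i - y $ i')\<bar> \<le> (2 * \<epsilon> * K) * (2 * m)" for l i'
          unfolding abs_mult
        proof (rule mult_mono)
          show "\<bar>k l\<bar> \<le> 2 * \<epsilon> * K"
            using elim by (auto simp: abs_mult K_def k_def)
          show "\<bar>y $ i - y $ i'\<bar> \<le> 2 * m" using m[of i] m[of i'] by linarith
        qed (use elim K in auto)
        have "q * y $ i + k i * (y $ i - y $ (i+1)) + k (i-1) * (y $ i - y $ (i-1)) = 0"
          using off i by (simp add: Lm_def ring_op_nth q_def k_def)
        then have "\<bar>q * y $ i\<bar> \<le> 2 * ((2 * \<epsilon> * K) * (2 * m))"
          using t[of i "i+1"] t[of "i-1" "i-1"] by linarith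
        moreover have "I / 2 * \<bar>y $ i\<bar> \<le> \<bar>q * y $ i\<bar>"
          unfolding abs_mult using elim(3)[rule_format, OF i] I_pos
          by (intro mult_right_mono) (auto simp: q_def)
        ultimately have "I / 2 * \<bar>y $ i\<bar> \<le> 2 * ((2 * \<epsilon> * K) * (2 * m))" by linarith
        then show ?thesis using I_pos by (simp add: C_def field_simps)
      qed
      have "m \<le> M"
      proof (cases "i0 \<in> S")
        case False
        have "C * \<epsilon> * m \<le> C * (1 / (2 * C)) * m"
          using elim C i0 by (intro mult_right_mono mult_left_mono) auto
        also have "\<dots> = m / 2" using C by simp
        finally have "m \<le> 0" using bd[OF False] i0 by linarith
        moreover have "\<bar>y $ 0\<bar> \<le> M" using M in_S by blast
        ultimately show ?thesis by linarith
      qed (use M i0 in auto)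
      then have "C * \<epsilon> * m \<le> C * \<epsilon> * M" using C elim by (intro mult_left_mono) auto
      then show "\<bar>y $ j\<bar> \<le> C * \<epsilon> * M" using bd[OF j] by linarith
    qed
  qed
  then show ?thesis using C by blast
qed

text \<open>
  The flux is constant across the site 2, so it may be evaluated on the bond 2-3, where the
  conductance is of order eps^3 and each product of entries is of order eps^2.  The same works on
  the other side.
\<close>

lemma ev_flux_small:
  "\<exists>C>0. \<forall>\<^sub>0\<epsilon>. small_flux_at C \<epsilon>"
proof -
  obtain A where A: "A > 0" "\<forall>\<^sub>0\<epsilon>. \<forall>j. j \<notin> S \<longrightarrow> cmod (\<phi> \<epsilon> $ j) \<le> A * \<epsilon>"
    using ev_off_small by blast
  obtain B where B: "B > 0" "\<forall>\<^sub>0\<epsilon>. decay_at B \<epsilon>" using ev_decay by blast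
  have "\<forall>\<^sub>0\<epsilon>. small_flux_at (16 * A ^ 3 * B) \<epsilon>"
    using A(2) B(2) ev_stationary ev_pos
  proof eventually_elim
    case (elim \<epsilon>)
    let ?k = "\<lambda>j. 2 * \<epsilon> * jump (\<phi> \<epsilon>) j" and ?x = "re_part (\<phi> \<epsilon>)"
    show ?case
    proof (intro allI impI)
      fix y M
      assume off: "outer_null \<epsilon> y" and M: "core_le y M"
      have "\<bar>y $ 0\<bar> \<le> M" using M in_S by blast
      then have M0: "M \<ge> 0" by linarith
      have y: "\<bar>y $ j\<bar> \<le> B * \<epsilon> * M" if "j \<notin> S" for j using elim(2) off M that by blast
      have x: "\<bar>?x $ j\<bar> \<le> A * \<epsilon>" if "j \<notin> S" for j
        using elim(1) that abs_Re_le_cmod[of "\<phi> \<epsilon> $ j"] by (auto simp: re_part_def intro: order_trans)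
      have small: "\<bar>flux \<epsilon> y j\<bar> \<le> 16 * A ^ 3 * B * \<epsilon> ^ 5 * M" if j: "j \<notin> S" "j + 1 \<notin> S" for j
      proof -
        have "cmod (\<phi> \<epsilon> $ (j+1) - \<phi> \<epsilon> $ j) \<le> 2 * A * \<epsilon>"
          using elim(1)[rule_format, OF j(1)] elim(1)[rule_format, OF j(2)]
            norm_triangle_ineq4[of "\<phi> \<epsilon> $ (j+1)" "\<phi> \<epsilon> $ j"] by linarith
        then have "jump (\<phi> \<epsilon>) j \<le> (2 * A * \<epsilon>)\<^sup>2" unfolding jump_def by (intro power_mono) auto
        then have k: "\<bar>?k j\<bar> \<le> 2 * \<epsilon> * (2 * A * \<epsilon>)\<^sup>2"
          using elim(4) by (simp add: abs_mult jump_def)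
        have p: "\<bar>?x $ l * y $ l'\<bar> \<le> (A * \<epsilon>) * (B * \<epsilon> * M)" if "l \<notin> S" "l' \<notin> S" for l l'
          unfolding abs_mult using x y that A B elim(4) by (intro mult_mono) auto
        have "\<bar>?x $ j * y $ (j+1) - ?x $ (j+1) * y $ j\<bar> \<le> 2 * ((A * \<epsilon>) * (B * \<epsilon> * M))"
          using p[OF j] p[OF j(2) j(1)] by linarith
        then have "\<bar>flux \<epsilon> y j\<bar> \<le> (2 * \<epsilon> * (2 * A * \<epsilon>)\<^sup>2) * (2 * ((A * \<epsilon>) * (B * \<epsilon> * M)))"
          unfolding wronskian_def abs_mult[of "?k j"] using k elim(4) by (intro mult_mono) auto
        also have "\<dots> = 16 * A ^ 3 * B * \<epsilon> ^ 5 * M"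
          by (simp add: power2_eq_square power3_eq_cube eval_nat_numeral)
        finally show ?thesis .
      qed
      have step: "flux \<epsilon> y (j-1) = flux \<epsilon> y j" if "j \<notin> S" for j
        using wronskian_step[of ?x j "\<lambda>j. (cmod (\<phi> \<epsilon> $ j))\<^sup>2 - I" ?k y] off that
          stationary_kernel(1)[OF elim(3)]
        by (simp add: Lm_def)
      show "\<bar>flux \<epsilon> y 1\<bar> \<le> 16 * A ^ 3 * B * \<epsilon> ^ 5 * M
       \<and> \<bar>flux \<epsilon> y (-2)\<bar> \<le> 16 * A ^ 3 * B * \<epsilon> ^ 5 * M"
      proof
        have "flux \<epsilon> y 1 = flux \<epsilon> y 2"
          using step[OF distinct(1)] by simp
        then show "\<bar>flux \<epsilon> y 1\<bar> \<le> 16 * A ^ 3 * B * \<epsilon> ^ 5 * M"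
          using small[of 2] distinct by simp
        have "flux \<epsilon> y (-2) = flux \<epsilon> y (-3)"
          using step[OF distinct(3)] by simp
        then show "\<bar>flux \<epsilon> y (-2)\<bar> \<le> 16 * A ^ 3 * B * \<epsilon> ^ 5 * M"
          using small[of "-3"] distinct by simp
      qed
    qed
  qed
  moreover have "16 * A ^ 3 * B > 0" using A B by simp
  ultimately show ?thesis by blast
qed

section \<open>Kernel, definiteness and spectrum\<close>

lemma ev_core_re:
  assumes "j \<in> S" "\<sigma> j = 1"
  shows "\<forall>\<^sub>0\<epsilon>. sqrt I / 2 < re_part (\<phi> \<epsilon>) $ j \<and> re_part (\<phi> \<epsilon>) $ j < 2 * sqrt I"
proof -
  have "((\<lambda>\<epsilon>. Re (\<phi> \<epsilon> $ j)) \<longlongrightarrow> sqrt I) (at_right 0)"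
    using tendsto_Re[OF limit[of j]] assms by simp
  from order_tendstoD(1)[OF this, of "sqrt I / 2"] order_tendstoD(2)[OF this, of "2 * sqrt I"]
  have "\<forall>\<^sub>0\<epsilon>. sqrt I / 2 < Re (\<phi> \<epsilon> $ j)" "\<forall>\<^sub>0\<epsilon>. Re (\<phi> \<epsilon> $ j) < 2 * sqrt I"
    using I_pos by simp_all
  then show ?thesis unfolding re_part_def by eventually_elim simp
qed

text \<open>
  With y 0 = 0 the flux through the bond 0-1 is the conductance, at least of order eps^3, times
  x 0 y 1, and it equals the flux of order eps^5 leaving the core.  So each end value is at most
  half of the larger one.
\<close>

lemma ev_kernel_simple: "\<forall>\<^sub>0\<epsilon>. \<forall>y. LM \<epsilon> y = 0 \<and> y $ 0 = 0 \<longrightarrow> y = 0"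
proof -
  obtain C where C: "C > 0" "\<forall>\<^sub>0\<epsilon>. small_flux_at C \<epsilon>"
    using ev_flux_small by blast
  obtain B where B: "B > 0" "\<forall>\<^sub>0\<epsilon>. decay_at B \<epsilon>" using ev_decay by blast
  obtain c where c: "c > 0" "\<forall>\<^sub>0\<epsilon>. c * \<epsilon>\<^sup>2 \<le> jump (\<phi> \<epsilon>) 0 \<and> c * \<epsilon>\<^sup>2 \<le> jump (\<phi> \<epsilon>) (-1)"
    using ev_jump_lower by blast
  have "c * sqrt I / (2 * C) > 0" using c C I_pos by simp
  note small = ev_le[OF this]
  show ?thesis
    using C(2) B(2) c(2) small ev_le[OF zero_less_one] ev_pos ev_stationary ev_core_re[OF in_S(2) sign_0]
  proof eventually_elim
    case (elim \<epsilon>)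
    let ?k = "\<lambda>j. 2 * \<epsilon> * jump (\<phi> \<epsilon>) j" and ?x = "re_part (\<phi> \<epsilon>)"
    show ?case
    proof safe
      fix y assume y: "LM \<epsilon> y = 0" "y $ 0 = 0"
      define M where "M = max \<bar>y $ 1\<bar> \<bar>y $ (-1)\<bar>"
      have M: "core_le y M" using y(2) by (auto simp: S_def M_def)
      have off: "outer_null \<epsilon> y" using y by simp
      have W: "\<bar>flux \<epsilon> y 1\<bar> \<le> C * \<epsilon> ^ 5 * M" "\<bar>flux \<epsilon> y (-2)\<bar> \<le> C * \<epsilon> ^ 5 * M"
        using elim(1) off M by blast+
      have step: "flux \<epsilon> y (j-1) = flux \<epsilon> y j" for j
        using wronskian_step[of ?x j "\<lambda>j. (cmod (\<phi> \<epsilon> $ j))\<^sup>2 - I" ?k y] y(1)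
          stationary_kernel(1)[OF elim(7)]
        by (simp add: Lm_def)
      have bound: "\<bar>z\<bar> \<le> M / 2" if J: "c * \<epsilon>\<^sup>2 \<le> J" and le: "2 * \<epsilon> * J * (?x $ 0 * \<bar>z\<bar>) \<le> C * \<epsilon> ^ 5 * M" for J z
      proof -
        have "\<epsilon> ^ 3 * (c * sqrt I * \<bar>z\<bar>) = 2 * \<epsilon> * (c * \<epsilon>\<^sup>2) * (sqrt I / 2 * \<bar>z\<bar>)"
          by (simp add: power2_eq_square power3_eq_cube)
        also have "\<dots> \<le> 2 * \<epsilon> * J * (?x $ 0 * \<bar>z\<bar>)"
        proof -
          have "0 \<le> c * \<epsilon>\<^sup>2" using c by simp
          then have "0 \<le> J" using J by linarith
          then show ?thesis using J elim(6,8) c(1) I_pos by (intro mult_mono mult_nonneg_nonneg) auto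
        qed
        also note le
        also have "C * \<epsilon> ^ 5 * M = \<epsilon> ^ 3 * (C * (\<epsilon> * \<epsilon>) * M)"
          by (simp add: power3_eq_cube eval_nat_numeral)
        finally have "c * sqrt I * \<bar>z\<bar> \<le> C * (\<epsilon> * \<epsilon>) * M" using elim(6) by simp
        also have "\<dots> \<le> C * (1 * (c * sqrt I / (2 * C))) * M"
          using elim C by (intro mult_right_mono mult_left_mono mult_mono) (auto simp: M_def)
        also have "\<dots> = (c * sqrt I) * (M / 2)" using C by simp
        finally show ?thesis using c I_pos by (simp add: mult_le_cancel_left_pos)
      qed
      have x0: "?x $ 0 > 0" using elim(8) I_pos by (smt (verit) half_gt_zero_iff real_sqrt_gt_0_iff)
      have "flux \<epsilon> y 0 = flux \<epsilon> y 1" using step[of 1] by simp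
      moreover have "flux \<epsilon> y 0 = ?k 0 * (?x $ 0 * y $ 1)" by (simp add: wronskian_def y(2))
      ultimately have "\<bar>?k 0 * (?x $ 0 * y $ 1)\<bar> \<le> C * \<epsilon> ^ 5 * M" using W(1) by metis
      then have "2 * \<epsilon> * jump (\<phi> \<epsilon>) 0 * (?x $ 0 * \<bar>y $ 1\<bar>) \<le> C * \<epsilon> ^ 5 * M"
        using x0 elim(6) by (simp add: abs_mult jump_def)
      then have 1: "\<bar>y $ 1\<bar> \<le> M / 2" using bound elim(3) by blast
      have "flux \<epsilon> y (-1) = flux \<epsilon> y (-2)" using step[of "-1"] by simp
      moreover have "flux \<epsilon> y (-1) = - (?k (-1) * (?x $ 0 * y $ (-1)))"
        by (simp add: wronskian_def y(2))
      ultimately have "\<bar>?k (-1) * (?x $ 0 * y $ (-1))\<bar> \<le> C * \<epsilon> ^ 5 * M" using W(2) by (metis abs_minus_cancel)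
      then have "2 * \<epsilon> * jump (\<phi> \<epsilon>) (-1) * (?x $ 0 * \<bar>y $ (-1)\<bar>) \<le> C * \<epsilon> ^ 5 * M"
        using x0 elim(6) by (simp add: abs_mult jump_def)
      then have 2: "\<bar>y $ (-1)\<bar> \<le> M / 2" using bound elim(3) by blast
      have "M \<le> 0" using 1 2 unfolding M_def by linarith
      moreover have "M \<ge> 0" by (simp add: M_def le_max_iff_disj)
      ultimately have "M = 0" by simp
      have "y $ j = 0" for j
      proof (cases "j \<in> S")
        case True then show ?thesis using M \<open>M = 0\<close> by auto
      next
        case False
        then have "\<bar>y $ j\<bar> \<le> B * \<epsilon> * M" using elim(2) off M by blast
        then show ?thesis using \<open>M = 0\<close> by simp
      qed
      then show "y = 0" by (simp add: vec_eq_iff)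
    qed
  qed
qed

lemma ev_real:
  assumes "\<forall>\<^sub>0\<epsilon>. Im (\<phi> \<epsilon> $ 0) = 0"
  shows "\<forall>\<^sub>0\<epsilon>. im_part (\<phi> \<epsilon>) = 0"
  using assms ev_kernel_simple ev_stationary
  by eventually_elim (metis im_part_def stationary_kernel(2) vec_lambda_beta)

text \<open>
  Subtracting a multiple of the kernel vector does not change the form and makes the central
  entry vanish.  The form is then the sum of the two bond energies, of order eps^3, and of the
  fluxes out of the core, which contribute order eps^5.
\<close>

lemma ev_positive:
  assumes in_phase: "\<sigma> 1 = 1" "\<sigma> (-1) = 1"
  shows "\<forall>\<^sub>0\<epsilon>. \<forall>a. outer_null \<epsilon> a \<longrightarrow> a \<bullet> LM \<epsilon> a \<ge> 0"
proof -
  obtain C where C: "C > 0" "\<forall>\<^sub>0\<epsilon>. small_flux_at C \<epsilon>"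
    using ev_flux_small by blast
  obtain c where c: "c > 0" "\<forall>\<^sub>0\<epsilon>. c * \<epsilon>\<^sup>2 \<le> jump (\<phi> \<epsilon>) 0 \<and> c * \<epsilon>\<^sup>2 \<le> jump (\<phi> \<epsilon>) (-1)"
    using ev_jump_lower by blast
  define r where "r = sqrt I"
  have r: "r > 0" using I_pos by (simp add: r_def)
  have "c * r / (8 * C) > 0" using c C r by simp
  note small = ev_le[OF this]
  show ?thesis
    using C(2) c(2) small ev_le[OF zero_less_one] ev_pos ev_stationary
      ev_core_re[OF in_S(2) sign_0] ev_core_re[OF in_S(1) in_phase(2)] ev_core_re[OF in_S(3) in_phase(1)]
  proof eventually_elim
    case (elim \<epsilon>)
    let ?k = "\<lambda>j. 2 * \<epsilon> * jump (\<phi> \<epsilon>) j" and ?x = "re_part (\<phi> \<epsilon>)" and ?L = "LM \<epsilon>"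
    have linL: "linear ?L" unfolding Lm_def by (rule linear_ring_op)
    have Lx: "?L ?x = 0" by (rule stationary_kernel(1)[OF elim(6)])
    have x: "r / 2 < ?x $ j" "?x $ j < 2 * r" if "j \<in> S" for j
      using elim(7-9) that by (auto simp: S_def r_def)
    show ?case
    proof (intro allI impI)
      fix a assume off: "\<forall>j. j \<notin> S \<longrightarrow> ?L a $ j = 0"
      \<comment> \<open>The kernel vector is the wave itself, so its central entry is nonzero.\<close>
      define b where "b = a - (a $ 0 / ?x $ 0) *\<^sub>R ?x"
      have b0: "b $ 0 = 0" using x[OF in_S(2)] r by (simp add: b_def)
      have Lb: "?L b = ?L a" by (simp add: b_def linear_diff[OF linL] linear_scale[OF linL] Lx)
      have "?x \<bullet> ?L a = ?L ?x \<bullet> a" unfolding Lm_def by (rule ring_op_self_adjoint)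
      then have eq: "a \<bullet> ?L a = b \<bullet> ?L b" unfolding Lb by (simp add: b_def inner_diff_left Lx)
      have bL: "b \<bullet> ?L b = b $ (-1) * ?L b $ (-1) + b $ 1 * ?L b $ 1"
      proof -
        have "b \<bullet> ?L b = (\<Sum>j\<in>S. b $ j * ?L b $ j)"
          unfolding inner_vec_def inner_real_def
          by (rule sum.mono_neutral_right) (use off Lb in auto)
        also have "\<dots> = b $ (-1) * ?L b $ (-1) + b $ 1 * ?L b $ 1"
          using distinct(5,6) b0 unfolding S_def by simp
        finally show ?thesis .
      qed
      define M where "M = max \<bar>b $ 1\<bar> \<bar>b $ (-1)\<bar>"
      have M: "core_le b M" using b0 by (auto simp: S_def M_def)
      have W: "\<bar>flux \<epsilon> b 1\<bar> \<le> C * \<epsilon> ^ 5 * M" "\<bar>flux \<epsilon> b (-2)\<bar> \<le> C * \<epsilon> ^ 5 * M"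
        using elim(1) off M unfolding Lb[symmetric] by blast+
      have step: "?x $ j * ?L b $ j = flux \<epsilon> b (j-1) - flux \<epsilon> b j" for j
        using wronskian_step[of ?x j "\<lambda>j. (cmod (\<phi> \<epsilon> $ j))\<^sup>2 - I" ?k b] Lx
        by (simp add: Lm_def)
      \<comment> \<open>Contribution of one end site: z is its entry, y the wave there, J the jump across its core bond and w the flux leaving the core.\<close>
      have edge: "z * l \<ge> c / 2 * \<epsilon> ^ 3 * z\<^sup>2 - 2 * C / r * \<epsilon> ^ 5 * M\<^sup>2"
        if e: "y * l = 2 * \<epsilon> * J * ?x $ 0 * z + w" and y: "r / 2 < y" "y < 2 * r"
          and J: "c * \<epsilon>\<^sup>2 \<le> J" and w: "\<bar>w\<bar> \<le> C * \<epsilon> ^ 5 * M" and z: "\<bar>z\<bar> \<le> M" for y l J z w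
      proof -
        have y0: "y > 0" using y r by linarith
        have "z * l = (2 * \<epsilon> * J * ?x $ 0 * z\<^sup>2) / y + z * w / y"
        proof -
          have "z * l = z * (y * l) / y" using y0 by simp
          also have "\<dots> = (2 * \<epsilon> * J * ?x $ 0 * z\<^sup>2) / y + z * w / y"
            unfolding e by (simp add: add_divide_distrib distrib_left power2_eq_square)
          finally show ?thesis .
        qed
        moreover have "(2 * \<epsilon> * J * ?x $ 0 * z\<^sup>2) / y \<ge> c / 2 * \<epsilon> ^ 3 * z\<^sup>2"
        proof -
          have "c / 2 * \<epsilon> ^ 3 * z\<^sup>2 = (2 * \<epsilon> * (c * \<epsilon>\<^sup>2) * (r / 2) * z\<^sup>2) / (2 * r)"
            using r by (simp add: power2_eq_square power3_eq_cube)
          also have "\<dots> \<le> (2 * \<epsilon> * J * ?x $ 0 * z\<^sup>2) / y"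
          proof -
            have "0 \<le> c * \<epsilon>\<^sup>2" using c by simp
            then have "0 \<le> J" using J by linarith
            then show ?thesis
              using x[OF in_S(2)] y y0 J elim(5) c(1) r by (intro frac_le mult_mono mult_nonneg_nonneg) auto
          qed
          finally show ?thesis .
        qed
        moreover have "\<bar>z * w / y\<bar> \<le> 2 * C / r * \<epsilon> ^ 5 * M\<^sup>2"
        proof -
          have "\<bar>z * w / y\<bar> = \<bar>z\<bar> * \<bar>w\<bar> / y" using y0 by (simp add: abs_mult)
          also have "\<dots> \<le> (M * (C * \<epsilon> ^ 5 * M)) / (r / 2)"
            using z w y y0 r C elim(5) by (intro frac_le mult_mono) auto
          also have "\<dots> = 2 * C / r * \<epsilon> ^ 5 * M\<^sup>2" using r by (simp add: power2_eq_square)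
          finally show ?thesis .
        qed
        moreover have "P - R \<le> A" if "A = X + Y" "P \<le> X" "\<bar>Y\<bar> \<le> R" for A X Y P R :: real
          using that by linarith
        ultimately show ?thesis by blast
      qed
      have t1: "b $ 1 * ?L b $ 1 \<ge> c / 2 * \<epsilon> ^ 3 * (b $ 1)\<^sup>2 - 2 * C / r * \<epsilon> ^ 5 * M\<^sup>2"
      proof (rule edge)
        show "?x $ 1 * ?L b $ 1 = 2 * \<epsilon> * jump (\<phi> \<epsilon>) 0 * ?x $ 0 * b $ 1 + - flux \<epsilon> b 1"
          using step[of 1] b0 by (simp add: wronskian_def)
      qed (use x[OF in_S(3)] elim(2) W M in_S in auto)
      have t2: "b $ (-1) * ?L b $ (-1) \<ge> c / 2 * \<epsilon> ^ 3 * (b $ (-1))\<^sup>2 - 2 * C / r * \<epsilon> ^ 5 * M\<^sup>2"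
      proof (rule edge)
        show "?x $ (-1) * ?L b $ (-1) = 2 * \<epsilon> * jump (\<phi> \<epsilon>) (-1) * ?x $ 0 * b $ (-1) + flux \<epsilon> b (-2)"
          using step[of "-1"] b0 by (simp add: wronskian_def)
      qed (use x[OF in_S(1)] elim(2) W M in_S in auto)
      have "M\<^sup>2 \<le> (b $ 1)\<^sup>2 + (b $ (-1))\<^sup>2" by (auto simp: M_def max_def)
      then have "c / 2 * \<epsilon> ^ 3 * M\<^sup>2 \<le> c / 2 * \<epsilon> ^ 3 * ((b $ 1)\<^sup>2 + (b $ (-1))\<^sup>2)"
        using c elim(5) by (intro mult_left_mono) auto
      moreover have "4 * C / r * \<epsilon> ^ 5 * M\<^sup>2 \<le> c / 2 * \<epsilon> ^ 3 * M\<^sup>2"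
      proof (rule mult_right_mono)
        have "4 * C / r * \<epsilon> ^ 5 = 4 * C / r * \<epsilon> ^ 3 * (\<epsilon> * \<epsilon>)" by (simp add: power3_eq_cube eval_nat_numeral)
        also have "\<dots> \<le> 4 * C / r * \<epsilon> ^ 3 * (1 * (c * r / (8 * C)))"
          using elim C r by (intro mult_left_mono mult_mono) auto
        also have "\<dots> = c / 2 * \<epsilon> ^ 3" using C r by simp
        finally show "4 * C / r * \<epsilon> ^ 5 \<le> c / 2 * \<epsilon> ^ 3" .
      qed simp
      ultimately show "a \<bullet> ?L a \<ge> 0" unfolding eq bL using t1 t2 by (simp add: distrib_left)
    qed
  qed
qed

lemma linear_Lm: "linear (Lm I \<epsilon> \<psi>)" and linear_Lp: "linear (Lp I \<epsilon> \<psi>)"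
  unfolding Lm_def Lp_def by (rule linear_ring_op)+

lemma Lm_self_adjoint: "y \<bullet> Lm I \<epsilon> \<psi> z = Lm I \<epsilon> \<psi> y \<bullet> z"
  and Lp_self_adjoint: "y \<bullet> Lp I \<epsilon> \<psi> z = Lp I \<epsilon> \<psi> y \<bullet> z"
  unfolding Lm_def Lp_def by (rule ring_op_self_adjoint)+

text \<open>
  By the decay estimate the operator that equals Lm off the core and the identity on the core is
  injective, hence onto.
\<close>

lemma ev_extension:
  assumes "\<eta> > 0"
  shows "\<forall>\<^sub>0\<epsilon>. \<forall>v. \<exists>a. (\<forall>j\<in>S. a $ j = v $ j) \<and> outer_null \<epsilon> a
     \<and> norm (a - site_diag S 1 0 v) \<le> \<eta> * norm v"
proof -
  obtain B where B: "B > 0" "\<forall>\<^sub>0\<epsilon>. decay_at B \<epsilon>" using ev_decay by blast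
  define n where "n = real CARD('n site)"
  have n: "n > 0" by (simp add: n_def)
  have "\<eta> / (n * B) > 0" using n B assms by simp
  from B(2) ev_le[OF this] ev_pos show ?thesis
  proof eventually_elim
    case (elim \<epsilon>)
    let ?L = "LM \<epsilon>"
    show ?case
    proof
      fix v :: "real ^ 'n site"
      define T where "T y = (\<chi> j. if j \<in> S then y $ j else ?L y $ j)" for y
      have lin: "linear T"
        by (rule linearI) (simp_all add: T_def vec_eq_iff linear_add[OF linear_Lm] linear_scale[OF linear_Lm])
      have "y = 0" if "T y = 0" for y
      proof -
        have S0: "\<forall>j\<in>S. \<bar>y $ j\<bar> \<le> 0" and off: "\<forall>j. j \<notin> S \<longrightarrow> ?L y $ j = 0"
          using that by (auto simp: T_def vec_eq_iff split: if_splits)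
        have "\<forall>j. j \<notin> S \<longrightarrow> \<bar>y $ j\<bar> \<le> B * \<epsilon> * 0" using elim(1) off S0 by blast
        with S0 show ?thesis by (auto simp: vec_eq_iff)
      qed
      then have "inj T" using lin by (simp add: linear_injective_0)
      then have "surj T" by (rule linear_injective_imp_surjective[OF lin]) (rule refl)
      then obtain a where a: "T a = site_diag S 1 0 v" by (metis surjD)
      have aS: "\<forall>j\<in>S. a $ j = v $ j" and off: "\<forall>j. j \<notin> S \<longrightarrow> ?L a $ j = 0"
        using a by (auto simp: T_def vec_eq_iff split: if_splits)
      have vM: "\<forall>j\<in>S. \<bar>a $ j\<bar> \<le> norm v" using aS component_le_norm_cart by metis
      have dec: "\<forall>j. j \<notin> S \<longrightarrow> \<bar>a $ j\<bar> \<le> B * \<epsilon> * norm v" using elim(1) off vM by blast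
      have "norm (a - site_diag S 1 0 v) \<le> (\<Sum>j\<in>UNIV. \<bar>(a - site_diag S 1 0 v) $ j\<bar>)"
        by (rule norm_le_l1_cart)
      also have "\<dots> \<le> (\<Sum>j\<in>(UNIV :: 'n site set). B * \<epsilon> * norm v)"
        using aS dec B(1) elim(3) by (intro sum_mono) auto
      also have "\<dots> = n * B * norm v * \<epsilon>" by (simp add: n_def)
      also have "\<dots> \<le> n * B * norm v * (\<eta> / (n * B))"
        using elim n B by (intro mult_left_mono) auto
      also have "\<dots> = \<eta> * norm v" using n B by simp
      finally show "\<exists>a. (\<forall>j\<in>S. a $ j = v $ j) \<and> (\<forall>j. j \<notin> S \<longrightarrow> ?L a $ j = 0)
           \<and> norm (a - site_diag S 1 0 v) \<le> \<eta> * norm v"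
        using aS off by blast
    qed
  qed
qed

lemma ev_off_negative:
  "\<forall>\<^sub>0\<epsilon>. \<forall>b. (\<forall>j\<in>S. b $ j = 0) \<longrightarrow> b \<bullet> LM \<epsilon> b \<le> 0"
  using ev_Lm_near[OF I_pos]
proof eventually_elim
  case (elim \<epsilon>)
  show ?case
  proof (intro allI impI)
    fix b :: "real ^ 'n site" assume b: "\<forall>j\<in>S. b $ j = 0"
    let ?r = "LM \<epsilon> b - site_diag S 0 (- I) b"
    have "site_diag S 0 (- I) b = - I *\<^sub>R b" using b by (auto simp: vec_eq_iff)
    then have "b \<bullet> LM \<epsilon> b = - I * (norm b)\<^sup>2 + b \<bullet> ?r"
      by (simp add: inner_diff_right inner_add_right power2_norm_eq_inner)
    also have "b \<bullet> ?r \<le> norm b * (I * norm b)"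
      using norm_cauchy_schwarz[of b ?r] elim mult_left_mono[OF _ norm_ge_zero] by (meson order_trans)
    finally show "b \<bullet> LM \<epsilon> b \<le> 0" by (simp add: power2_eq_square)
  qed
qed

text \<open>
  In the limit the form is diagonal with entries -I^3 on the core and -I^3 / 2 off the core.  It
  is stated for v = Lp p, which avoids inverting Lp.
\<close>

lemma ev_definite_pencil:
  "\<forall>\<^sub>0\<epsilon>. \<forall>p. p \<noteq> 0 \<longrightarrow>
     LP \<epsilon> p \<bullet> LM \<epsilon> (LP \<epsilon> p) < I\<^sup>2 / 2 * (p \<bullet> LP \<epsilon> p)"
proof -
  \<comment> \<open>Any small multiple of I would do; the resulting error is below one tenth of I^3, against the gap I^3 / 2.\<close>
  define \<eta> where "\<eta> = I / 100"
  have \<eta>: "\<eta> > 0" using I_pos by (simp add: \<eta>_def)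
  from ev_Lm_near[OF \<eta>] ev_Lp_near[OF \<eta>] show ?thesis
  proof eventually_elim
    case (elim \<epsilon>)
    show ?case
    proof (intro allI impI)
      fix p :: "real ^ 'n site" assume "p \<noteq> 0"
      define N where "N = norm p"
      have N: "N > 0" using \<open>p \<noteq> 0\<close> by (simp add: N_def)
      let ?L = "LM \<epsilon>" and ?Dp = "site_diag S (2 * I) (- I)" and ?Dm = "site_diag S 0 (- I)"
      define v where "v = LP \<epsilon> p"
      define r where "r = v - ?Dp p"
      define s where "s = ?L v - ?Dm v"
      have r: "norm r \<le> \<eta> * N" using elim(2) by (simp add: r_def v_def N_def)
      have Dp: "norm (?Dp x) \<le> 2 * I * norm x" for x using I_pos by (intro norm_site_diag) auto
      have Dm: "norm (?Dm x) \<le> I * norm x" for x using I_pos by (intro norm_site_diag) auto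
      have v: "norm v \<le> (2 * I + \<eta>) * N"
        using norm_triangle_ineq[of "?Dp p" r] r Dp[of p] by (simp add: r_def N_def algebra_simps)
      have s: "norm s \<le> \<eta> * ((2 * I + \<eta>) * N)"
        using elim(1) v \<eta> unfolding s_def by (meson mult_left_mono order_trans less_imp_le)
      have sym: "x \<bullet> ?Dm y = ?Dm x \<bullet> y" for x y by (simp add: inner_vec_def mult_ac)
      have cs: "x \<bullet> y \<le> a * b" if "norm x \<le> a" "norm y \<le> b" for x y :: "real ^ 'n site" and a b
        using norm_cauchy_schwarz[of x y] mult_mono[OF that(1,2)] that norm_ge_zero by (smt (verit))
      have e: "v = ?Dp p + r" "?L v = ?Dm v + s" by (simp_all add: r_def s_def)
      have Dv: "?Dm (?Dp p + r) = ?Dm (?Dp p) + ?Dm r" by (rule linear_add[OF linear_site_diag])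
      have "v \<bullet> ?L v = v \<bullet> ?Dm v + v \<bullet> s" by (simp add: e(2) inner_add_right)
      also have "v \<bullet> ?Dm v = ?Dp p \<bullet> ?Dm (?Dp p) + 2 * (r \<bullet> ?Dm (?Dp p)) + r \<bullet> ?Dm r"
        unfolding e(1) Dv using sym[of "?Dp p" r]
        by (simp add: inner_add_left inner_add_right inner_commute)
      finally have vLv: "v \<bullet> ?L v = ?Dp p \<bullet> ?Dm (?Dp p) + 2 * (r \<bullet> ?Dm (?Dp p)) + r \<bullet> ?Dm r + v \<bullet> s" .
      have pv: "p \<bullet> v = p \<bullet> ?Dp p + p \<bullet> r" by (simp add: e(1) inner_add_right)
      have main: "?Dp p \<bullet> ?Dm (?Dp p) - I\<^sup>2 / 2 * (p \<bullet> ?Dp p) \<le> - (I ^ 3 / 2) * N\<^sup>2"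
      proof -
        have "p \<bullet> site_diag S (I ^ 3) (I ^ 3 / 2) p \<ge> (I ^ 3 / 2) * (norm p)\<^sup>2"
          using I_pos by (intro inner_site_diag_ge) auto
        moreover have "?Dp p \<bullet> ?Dm (?Dp p) - I\<^sup>2 / 2 * (p \<bullet> ?Dp p) = - (p \<bullet> site_diag S (I ^ 3) (I ^ 3 / 2) p)"
          unfolding inner_vec_def sum_distrib_left sum_subtractf[symmetric] sum_negf[symmetric]
          by (intro sum.cong refl) (simp add: power2_eq_square power3_eq_cube field_simps)
        ultimately show ?thesis by (simp add: N_def)
      qed
      have "r \<bullet> ?Dm (?Dp p) \<le> (\<eta> * N) * (I * (2 * I * N))"
        using r order_trans[OF Dm mult_left_mono[OF Dp]] I_pos by (intro cs) (auto simp: N_def)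
      moreover have "r \<bullet> ?Dm r \<le> (\<eta> * N) * (I * (\<eta> * N))"
        using r order_trans[OF Dm mult_left_mono[OF r]] I_pos by (intro cs) auto
      moreover have "v \<bullet> s \<le> ((2 * I + \<eta>) * N) * (\<eta> * ((2 * I + \<eta>) * N))" by (rule cs[OF v s])
      moreover have "- (p \<bullet> r) \<le> N * (\<eta> * N)" using cs[of "- p" N r] r by (simp add: N_def)
      then have "- (I\<^sup>2 / 2 * (p \<bullet> r)) \<le> I\<^sup>2 / 2 * (N * (\<eta> * N))"
        using mult_left_mono[of "- (p \<bullet> r)" _ "I\<^sup>2 / 2"] by fastforce
      ultimately have "v \<bullet> ?L v - I\<^sup>2 / 2 * (p \<bullet> v) \<le> - (I ^ 3 / 2) * N\<^sup>2
          + 2 * ((\<eta> * N) * (I * (2 * I * N))) + (\<eta> * N) * (I * (\<eta> * N))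
          + ((2 * I + \<eta>) * N) * (\<eta> * ((2 * I + \<eta>) * N)) + I\<^sup>2 / 2 * (N * (\<eta> * N))"
        using main unfolding vLv pv distrib_left by linarith
      also have "\<dots> = - (I ^ 3 * N\<^sup>2) * (1/2 - (4/100 + 1/10000 + (201/100)\<^sup>2 / 100 + 1/200))"
        by (simp add: \<eta>_def power2_eq_square power3_eq_cube field_simps)
      also have "\<dots> < 0" using I_pos N by (simp add: power2_eq_square)
      finally show "LP \<epsilon> p \<bullet> ?L (LP \<epsilon> p) < I\<^sup>2 / 2 * (p \<bullet> LP \<epsilon> p)"
        by (simp add: v_def)
    qed
  qed
qed

text \<open>
  Split v = Lp p into an extension a of its core values and a remainder b off the core.  The parts
  are orthogonal for the form of Lm, which is nonnegative at a and nonpositive at b, so a positive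
  eigenvalue would give (a, p) nonpositive and (b, p) nonnegative.  But in the limit p is v / (2 I)
  on the core and -v / I off the core, which makes (a - b, p) positive.
\<close>

lemma ev_no_positive_eigenvalue:
  assumes in_phase: "\<sigma> 1 = 1" "\<sigma> (-1) = 1"
  shows "\<forall>\<^sub>0\<epsilon>. \<forall>p l. l > 0 \<longrightarrow> LM \<epsilon> (LP \<epsilon> p) = - l *\<^sub>R p \<longrightarrow> p = 0"
proof -
  define \<eta> where "\<eta> = I / 100"
  have \<eta>: "\<eta> > 0" using I_pos by (simp add: \<eta>_def)
  have th: "(1/100 :: real) > 0" by simp
  from ev_Lp_near[OF \<eta>] ev_extension[OF th] ev_off_negative ev_positive[OF in_phase]
  show ?thesis
  proof eventually_elim
    case (elim \<epsilon>)
    let ?L = "LM \<epsilon>" and ?Dp = "site_diag S (2 * I) (- I)"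
    show ?case
    proof (intro allI impI, rule ccontr)
      fix p :: "real ^ 'n site" and l :: real
      assume l: "l > 0" and eig: "?L (LP \<epsilon> p) = - l *\<^sub>R p" and "p \<noteq> 0"
      define N where "N = norm p"
      have N: "N > 0" using \<open>p \<noteq> 0\<close> by (simp add: N_def)
      define v where "v = LP \<epsilon> p"
      define r where "r = v - ?Dp p"
      have r: "norm r \<le> \<eta> * N" using elim(1) by (simp add: r_def v_def N_def)
      have Dp: "norm (?Dp p) \<le> 2 * I * norm p" using I_pos by (intro norm_site_diag) auto
      have v: "norm v \<le> (2 * I + \<eta>) * N"
        using norm_triangle_ineq[of "?Dp p" r] r Dp by (simp add: r_def N_def algebra_simps)
      obtain a where a: "\<forall>j\<in>S. a $ j = v $ j" "\<forall>j. j \<notin> S \<longrightarrow> ?L a $ j = 0"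
          "norm (a - site_diag S 1 0 v) \<le> 1/100 * norm v"
        using elim(2) by blast
      define b where "b = v - a"
      have bS: "\<forall>j\<in>S. b $ j = 0" using a(1) by (simp add: b_def)
      have ab: "b \<bullet> ?L a = 0"
        unfolding inner_vec_def using bS a(2) by (intro sum.neutral ballI) auto
      have Lv: "?L v = ?L a + ?L b" by (simp add: b_def linear_add[OF linear_Lm, symmetric])
      have "a \<bullet> ?L v = a \<bullet> ?L a" unfolding Lv using ab Lm_self_adjoint[of a \<epsilon> "\<phi> \<epsilon>" b]
        by (simp add: inner_add_right inner_commute)
      then have "a \<bullet> ?L v \<ge> 0" using elim(4) a(2) by simp
      then have "a \<bullet> p \<le> 0" using eig l by (simp add: v_def mult_le_0_iff)
      moreover have "b \<bullet> ?L v \<le> 0" unfolding Lv using ab elim(3) bS by (simp add: inner_add_right)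
      then have "b \<bullet> p \<ge> 0" using eig l by (simp add: v_def zero_le_mult_iff)
      ultimately have le: "(a - b) \<bullet> p \<le> 0" by (simp add: inner_diff_left)
      define e where "e = a - site_diag S 1 0 v"
      have e: "norm e \<le> 1/100 * ((2 * I + \<eta>) * N)" using a(3) v by (simp add: e_def)
      have "a - b = site_diag S 1 (- 1) v + 2 *\<^sub>R e"
        by (auto simp: b_def e_def vec_eq_iff)
      also have "v = ?Dp p + r" by (simp add: r_def)
      also have "site_diag S 1 (- 1) (?Dp p + r) = site_diag S (2 * I) I p + site_diag S 1 (- 1) r"
        by (auto simp: vec_eq_iff algebra_simps)
      finally have "(a - b) \<bullet> p = p \<bullet> site_diag S (2 * I) I p + site_diag S 1 (- 1) r \<bullet> p + 2 * (e \<bullet> p)"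
        by (simp add: inner_add_left inner_add_right inner_commute[of _ p])
      moreover have "p \<bullet> site_diag S (2 * I) I p \<ge> I * (norm p)\<^sup>2"
        using I_pos by (intro inner_site_diag_ge) auto
      moreover have "\<bar>site_diag S 1 (- 1) r \<bullet> p\<bar> \<le> (\<eta> * N) * N"
      proof -
        have "norm (site_diag S 1 (- 1) r) \<le> 1 * norm r" by (rule norm_site_diag) auto
        then have "norm (site_diag S 1 (- 1) r) \<le> \<eta> * N" using r by simp
        then show ?thesis using Cauchy_Schwarz_ineq2[of "site_diag S 1 (- 1) r" p] N
          by (metis N_def mult_right_mono norm_ge_zero order_trans)
      qed
      moreover have "\<bar>e \<bullet> p\<bar> \<le> 1/100 * ((2 * I + \<eta>) * N) * N"
        using Cauchy_Schwarz_ineq2[of e p] e by (metis N_def mult_right_mono norm_ge_zero order_trans)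
      ultimately have "0 \<ge> I * N\<^sup>2 - (\<eta> * N) * N - 2 * (1/100 * ((2 * I + \<eta>) * N) * N)"
        using le unfolding N_def by linarith
      also have "I * N\<^sup>2 - (\<eta> * N) * N - 2 * (1/100 * ((2 * I + \<eta>) * N) * N) = I * N\<^sup>2 * (1 - 1/100 - 2/100 * (201/100))"
        by (simp add: \<eta>_def power2_eq_square field_simps)
      also have "\<dots> > 0" using I_pos N by simp
      finally show False by simp
    qed
  qed
qed

text \<open>
  The complex eigenvalue equation Lm Lp p = -(l1 + i l2) p is written in real and imaginary parts.
  With s the form of Lp at p, self-adjointness gives l2 s = 0, and the definite pencil excludes
  s = 0.
\<close>

lemma ev_eigenvalues_nonpositive:
  assumes in_phase: "\<sigma> 1 = 1" "\<sigma> (-1) = 1"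
  shows "\<forall>\<^sub>0\<epsilon>. \<forall>p1 p2 l1 l2.
     LM \<epsilon> (LP \<epsilon> p1) = - (l1 *\<^sub>R p1 - l2 *\<^sub>R p2) \<longrightarrow>
     LM \<epsilon> (LP \<epsilon> p2) = - (l1 *\<^sub>R p2 + l2 *\<^sub>R p1) \<longrightarrow>
     p1 \<noteq> 0 \<or> p2 \<noteq> 0 \<longrightarrow> l2 = 0 \<and> l1 \<le> 0"
  using ev_definite_pencil ev_no_positive_eigenvalue[OF in_phase]
proof eventually_elim
  case (elim \<epsilon>)
  let ?Lm = "LM \<epsilon>" and ?Lp = "LP \<epsilon>"
  show ?case
  proof (intro allI impI)
    fix p1 p2 :: "real ^ 'n site" and l1 l2 :: real
    assume eq1: "?Lm (?Lp p1) = - (l1 *\<^sub>R p1 - l2 *\<^sub>R p2)"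
      and eq2: "?Lm (?Lp p2) = - (l1 *\<^sub>R p2 + l2 *\<^sub>R p1)"
      and nz: "p1 \<noteq> 0 \<or> p2 \<noteq> 0"
    define s where "s = p1 \<bullet> ?Lp p1 + p2 \<bullet> ?Lp p2"
    have sym: "?Lp p1 \<bullet> p2 = ?Lp p2 \<bullet> p1" using Lp_self_adjoint[of p2 \<epsilon> "\<phi> \<epsilon>" p1] by (simp add: inner_commute)
    have t: "?Lp p1 \<bullet> ?Lm (?Lp p1) + ?Lp p2 \<bullet> ?Lm (?Lp p2) = - l1 * s"
      unfolding eq1 eq2 s_def using sym
      by (simp add: inner_diff_right inner_add_right inner_commute algebra_simps)
    have "?Lp p2 \<bullet> ?Lm (?Lp p1) = ?Lp p1 \<bullet> ?Lm (?Lp p2)"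
      using Lm_self_adjoint[of "?Lp p2" \<epsilon> "\<phi> \<epsilon>" "?Lp p1"] by (simp add: inner_commute)
    then have "l2 * s = 0"
      unfolding eq1 eq2 s_def using sym
      by (simp add: inner_diff_right inner_add_right inner_commute algebra_simps)
    have "?Lp p \<bullet> ?Lm (?Lp p) \<le> I\<^sup>2 / 2 * (p \<bullet> ?Lp p)" for p
      using elim(1)[rule_format, of p] by (cases "p = 0") (auto simp: linear_0[OF linear_Lp] less_imp_le)
    then have "- l1 * s < I\<^sup>2 / 2 * s"
      using elim(1)[rule_format, of p1] elim(1)[rule_format, of p2] nz
      unfolding t[symmetric] unfolding s_def distrib_left by (metis add_le_less_mono add_less_le_mono)
    then have "s \<noteq> 0" by auto
    with \<open>l2 * s = 0\<close> have "l2 = 0" by simp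
    moreover have "l1 \<le> 0"
    proof (rule ccontr)
      assume "\<not> l1 \<le> 0"
      moreover have "?Lm (?Lp p1) = - l1 *\<^sub>R p1" "?Lm (?Lp p2) = - l1 *\<^sub>R p2" using eq1 eq2 \<open>l2 = 0\<close> by simp_all
      ultimately show False using elim(2) nz by (metis not_le)
    qed
    ultimately show "l2 = 0 \<and> l1 \<le> 0" by simp
  qed
qed

end

section \<open>Rigidity of nearby periodic solutions\<close>

text \<open>
  The increment is nonpositive where P is maximal and nonnegative one shift earlier.
\<close>

lemma periodic_increment_has_zero:
  fixes P :: "real \<Rightarrow> real"
  assumes cont: "continuous_on UNIV P" and per: "\<And>t. P (t + T) = P t" and T: "T > 0"
  shows "\<exists>t. P (t + h) - P t = 0"
proof -
  interpret periodic_fun_simple P T by unfold_locales (rule per)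
  obtain m where m: "m \<in> {0..T}" "\<And>s. s \<in> {0..T} \<Longrightarrow> P s \<le> P m"
  proof -
    have "\<exists>x\<in>{0..T}. \<forall>y\<in>{0..T}. P y \<le> P x"
      by (rule continuous_attains_sup) (use T in \<open>auto intro: continuous_on_subset[OF cont]\<close>)
    then show thesis using that by blast
  qed
  have max: "P t \<le> P m" for t
  proof -
    define s where "s = t - of_int \<lfloor>t / T\<rfloor> * T"
    have "P s = P t" unfolding s_def by (rule minus_of_int)
    moreover have "s \<in> {0..T}"
      using floor_divide_lower[OF T, of t] floor_divide_upper[OF T, of t] by (auto simp: s_def algebra_simps)
    ultimately show ?thesis using m(2) by metis
  qed
  let ?g = "\<lambda>t. P (t + h) - P t"
  have "continuous_on UNIV ?g"
    by (intro continuous_intros continuous_on_compose2[OF cont] cont) auto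
  then have conn: "connected (range ?g)" by (rule connected_continuous_image) (rule connected_UNIV)
  have "?g m \<le> 0" using max by simp
  moreover have "0 \<le> ?g (m - h)" using max by simp
  ultimately have "0 \<in> range ?g" by (rule connectedD_interval[OF conn rangeI rangeI])
  then obtain t where "0 = ?g t" by (rule rangeE)
  then show ?thesis by (intro exI[of _ t]) (rule sym)
qed

lemma vector_derivative_lipschitz:
  fixes f :: "real \<Rightarrow> 'a::real_normed_vector"
  assumes "\<And>t. (f has_vector_derivative f' t) (at t)" "\<And>t. norm (f' t) \<le> m"
  shows "norm (f y - f x) \<le> m * \<bar>y - x\<bar>"
proof -
  have "norm (f y - f x) \<le> m * norm (y - x)"
  proof (rule differentiable_bound[of UNIV f "\<lambda>t h. h *\<^sub>R f' t"])
    fix t :: real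
    show "(f has_derivative (\<lambda>h. h *\<^sub>R f' t)) (at t)"
      using assms(1) by (simp add: has_vector_derivative_def)
    show "onorm (\<lambda>h. h *\<^sub>R f' t) \<le> m"
      using assms(2)[of t] by (intro onorm_le) (simp add: mult.commute[of m] mult_left_mono)
  qed auto
  then show ?thesis by simp
qed

lemma periodic_with_zero_bound:
  fixes p :: "real \<Rightarrow> real"
  assumes deriv: "\<And>t. (p has_vector_derivative p' t) (at t)" and bound: "\<And>t. \<bar>p' t\<bar> \<le> m"
    and per: "\<And>t. p (t + T) = p t" and T: "T > 0" and zero: "p t0 = 0"
  shows "\<bar>p t\<bar> \<le> T * m"
proof -
  interpret periodic_fun_simple p T by unfold_locales (rule per)
  define s where "s = t - of_int \<lfloor>(t - t0) / T\<rfloor> * T"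
  have ps: "p s = p t" unfolding s_def by (rule minus_of_int)
  have s: "t0 \<le> s" "s \<le> t0 + T"
    using floor_divide_lower[OF T, of "t - t0"] floor_divide_upper[OF T, of "t - t0"] by (auto simp: s_def algebra_simps)
  have m: "m \<ge> 0" using bound[of 0] by linarith
  have "norm (p s - p t0) \<le> m * \<bar>s - t0\<bar>"
    by (rule vector_derivative_lipschitz[OF deriv]) (use bound in simp)
  also have "\<dots> \<le> m * T" using s m by (intro mult_left_mono) auto
  finally show ?thesis using zero ps by (simp add: mult.commute)
qed

text \<open>
  Variation of constants over one period; the factor on the left is nonzero unless the free
  oscillation resonates with the period.
\<close>

lemma periodic_oscillator_bound:
  fixes z :: "real \<Rightarrow> complex"
  assumes deriv: "\<And>t. (z has_vector_derivative \<i> * of_real \<nu> * z t + e t) (at t)" and bound: "\<And>t. cmod (e t) \<le> m"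
    and per: "\<And>t. z (t + T) = z t" and T: "T > 0"
  shows "cmod (cis (- \<nu> * T) - 1) * cmod (z t) \<le> T * m"
proof -
  define y where "y t = cis (- \<nu> * t) * z t" for t
  have c: "((\<lambda>t. cis (- \<nu> * t)) has_vector_derivative (- \<nu>) *\<^sub>R (\<i> * cis (- \<nu> * t))) (at t)" for t
  proof -
    have "(\<lambda>t. cis (- \<nu> * t)) = (\<lambda>t. exp (t *\<^sub>R (- \<i> * of_real \<nu>)))"
      by (auto simp: fun_eq_iff cis_conv_exp scaleR_conv_of_real mult_ac)
    moreover have "((\<lambda>t. exp (t *\<^sub>R (- \<i> * of_real \<nu>))) has_vector_derivative
        exp (t *\<^sub>R (- \<i> * of_real \<nu>)) * (- \<i> * of_real \<nu>)) (at t)"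
      by (rule exp_scaleR_has_vector_derivative_right)
    ultimately show ?thesis
      by (auto elim!: has_vector_derivative_eq_rhs simp: cis_conv_exp scaleR_conv_of_real mult_ac)
  qed
  have y: "(y has_vector_derivative cis (- \<nu> * t) * e t) (at t)" for t
    unfolding y_def by (rule has_vector_derivative_eq_rhs[OF has_vector_derivative_mult[OF c deriv]])
      (simp add: scaleR_conv_of_real algebra_simps)
  have m: "m \<ge> 0" using bound[of 0] norm_ge_zero order_trans by blast
  have "norm (y (t + T) - y t) \<le> m * \<bar>t + T - t\<bar>"
    by (rule vector_derivative_lipschitz[OF y]) (use bound in \<open>simp add: norm_mult\<close>)
  moreover have "y (t + T) - y t = cis (- \<nu> * t) * ((cis (- \<nu> * T) - 1) * z t)"
    unfolding y_def per by (simp add: algebra_simps cis_mult)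
  ultimately show ?thesis using T by (simp add: norm_mult mult.commute)
qed

lemma cubic_diff: "cubic x - cubic y = of_real ((cmod x)\<^sup>2) * (x - y) + of_real ((x + y) \<bullet> (x - y)) * y"
proof -
  have "(cmod x)\<^sup>2 - (cmod y)\<^sup>2 = (x + y) \<bullet> (x - y)"
    by (simp add: power2_norm_eq_inner inner_add_left inner_diff_right inner_commute[of y x])
  then have "of_real ((x + y) \<bullet> (x - y)) = (of_real ((cmod x)\<^sup>2) - of_real ((cmod y)\<^sup>2) :: complex)"
    by (metis of_real_diff)
  then show ?thesis unfolding cubic_def by (simp only: left_diff_distrib right_diff_distrib) simp
qed

lemma abs_inner_le: "\<bar>x \<bullet> y\<bar> \<le> a * b" if "norm x \<le> a" "norm y \<le> b" for x y :: "'a::real_inner"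
  using Cauchy_Schwarz_ineq2[of x y] mult_mono[OF that] norm_ge_zero[of x] norm_ge_zero[of y] that
  by (meson order_trans)

lemma cubic_lipschitz:
  assumes "cmod x \<le> r" "cmod y \<le> r"
  shows "cmod (cubic x - cubic y) \<le> 3 * r\<^sup>2 * cmod (x - y)"
proof -
  have r: "r \<ge> 0" using assms(1) norm_ge_zero order_trans by blast
  have 1: "cmod (of_real ((cmod x)\<^sup>2) * (x - y)) \<le> r\<^sup>2 * cmod (x - y)"
    unfolding norm_mult norm_of_real using assms by (intro mult_right_mono) (auto intro: power_mono)
  have "cmod (x + y) \<le> 2 * r" using assms norm_triangle_ineq[of x y] by linarith
  then have "\<bar>(x + y) \<bullet> (x - y)\<bar> \<le> (2 * r) * cmod (x - y)" by (intro abs_inner_le) auto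
  then have 2: "cmod (of_real ((x + y) \<bullet> (x - y)) * y) \<le> (2 * r) * cmod (x - y) * r"
    unfolding norm_mult norm_of_real using assms r by (intro mult_mono) auto
  show ?thesis unfolding cubic_diff
    using norm_triangle_ineq[of "of_real ((cmod x)\<^sup>2) * (x - y)" "of_real ((x + y) \<bullet> (x - y)) * y"] 1 2
    by (simp add: power2_eq_square algebra_simps)
qed

text \<open>
  A two-point version of the linearisation, as needed for increments of solutions: the
  relative error is proportional to the distance of both points from a.
\<close>

lemma cubic_linearization:
  assumes a: "cmod a \<le> R" and x: "cmod (x - a) \<le> \<delta>" and y: "cmod (y - a) \<le> \<delta>" and \<delta>: "\<delta> \<le> 1"
  shows "cmod (cubic x - cubic y - (of_real ((cmod a)\<^sup>2) * (x - y) + 2 * of_real (a \<bullet> (x - y)) * a))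
      \<le> (6 * R + 3) * \<delta> * cmod (x - y)"
proof -
  define d where "d = x - y"
  have \<delta>0: "\<delta> \<ge> 0" using x norm_ge_zero order_trans by blast
  have R: "R \<ge> 0" using a norm_ge_zero order_trans by blast
  have eq: "cubic x - cubic y - (of_real ((cmod a)\<^sup>2) * d + 2 * of_real (a \<bullet> d) * a)
     = of_real ((cmod x)\<^sup>2 - (cmod a)\<^sup>2) * d + of_real ((x - a + (y - a)) \<bullet> d) * y + 2 * of_real (a \<bullet> d) * (y - a)"
  proof -
    have "(x - a + (y - a)) \<bullet> d = (x + y) \<bullet> d - 2 * (a \<bullet> d)"
      by (simp only: inner_add_left inner_diff_left)
    moreover have "X * d + P * y - (Y * d + 2 * s * a) = (X - Y) * d + (P - 2 * s) * y + 2 * s * (y - a)"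
      for X Y P s :: complex by (simp add: algebra_simps)
    ultimately show ?thesis
      unfolding cubic_diff d_def[symmetric] by (simp only: of_real_diff of_real_mult of_real_numeral)
  qed
  have nx: "cmod x \<le> R + \<delta>" "cmod y \<le> R + \<delta>"
    using norm_triangle_ineq[of "x - a" a] norm_triangle_ineq[of "y - a" a] a x y by auto
  have "(cmod x)\<^sup>2 - (cmod a)\<^sup>2 = (x + a) \<bullet> (x - a)"
    by (simp add: power2_norm_eq_inner inner_add_left inner_diff_right inner_commute[of a x])
  moreover have "cmod (x + a) \<le> 2 * R + 1" using norm_triangle_ineq[of x a] nx a \<delta> by linarith
  ultimately have "\<bar>(cmod x)\<^sup>2 - (cmod a)\<^sup>2\<bar> \<le> (2 * R + 1) * \<delta>" using x by (simp add: abs_inner_le)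
  then have 1: "cmod (of_real ((cmod x)\<^sup>2 - (cmod a)\<^sup>2) * d) \<le> (2 * R + 1) * \<delta> * cmod d"
    unfolding norm_mult norm_of_real by (intro mult_right_mono) auto
  have "cmod (x - a + (y - a)) \<le> 2 * \<delta>" using norm_triangle_ineq[of "x - a" "y - a"] x y by linarith
  then have "\<bar>(x - a + (y - a)) \<bullet> d\<bar> \<le> (2 * \<delta>) * cmod d" by (intro abs_inner_le) auto
  then have 2: "cmod (of_real ((x - a + (y - a)) \<bullet> d) * y) \<le> (2 * \<delta>) * cmod d * (R + 1)"
    unfolding norm_mult norm_of_real using nx(2) \<delta> \<delta>0 by (intro mult_mono) auto
  have "\<bar>a \<bullet> d\<bar> \<le> R * cmod d" using a by (intro abs_inner_le) auto
  then have 3: "cmod (2 * of_real (a \<bullet> d) * (y - a)) \<le> 2 * (R * cmod d) * \<delta>"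
    unfolding norm_mult norm_of_real using y R by (intro mult_mono) auto
  have "cmod (cubic x - cubic y - (of_real ((cmod a)\<^sup>2) * d + 2 * of_real (a \<bullet> d) * a))
     \<le> (2 * R + 1) * \<delta> * cmod d + (2 * \<delta>) * cmod d * (R + 1) + 2 * (R * cmod d) * \<delta>"
    unfolding eq by (rule norm_triangle_le[OF add_mono[OF norm_triangle_le[OF add_mono[OF 1 2]] 3]])
  also have "\<dots> = (6 * R + 3) * \<delta> * cmod d" by (simp add: algebra_simps)
  finally show ?thesis by (simp add: d_def)
qed

text \<open>
  The lattice equations in the frame rotating with frequency 1 + I.
\<close>

definition corotating :: "real \<Rightarrow> real \<Rightarrow> (real \<Rightarrow> 'n::finite state) \<Rightarrow> bool" where
  "corotating I \<epsilon> u \<longleftrightarrow> (\<forall>t j. ((\<lambda>t. u t $ j) has_vector_derivative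
      - \<i> * (of_real ((cmod (u t $ j))\<^sup>2 - I) * u t $ j + 2 * of_real \<epsilon> * coupling (u t) j)) (at t))"

text \<open>
  Let d be the increment of u over the time h, and D the supremum of its entries.  An unexcited
  component of d is a forced oscillator of frequency I, and I T is not a multiple of 2 pi because
  I / (1 + I) lies strictly between 0 and 1.  At an excited site the linear part is nilpotent: the
  radial component is driven by the error alone, and the phase component by the radial one; both
  vanish somewhere, being increments of periodic functions, so they are bounded by their
  derivatives.  As the error is at most K delta D, this gives D at most D / 2.
\<close>

lemma rigidity:
  fixes a :: "'n::finite state"
  assumes I: "I > 0" and T: "T = 2 * pi / (1 + I)"
    and a: "\<And>j. cmod (a $ j) = sqrt I \<or> a $ j = 0"
  shows "\<exists>\<delta>>0. \<forall>\<epsilon> u. 0 < \<epsilon> \<longrightarrow> \<epsilon> < \<delta> \<longrightarrow> corotating I \<epsilon> u \<longrightarrow> (\<forall>t. u (t + T) = u t) \<longrightarrow>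
      (\<forall>t j. cmod (u t $ j - a $ j) \<le> \<delta>) \<longrightarrow> (\<forall>t h. u (t + h) = u t)"
proof -
  define R where "R = sqrt I"
  have R: "R > 0" "R * R = I" using I by (simp_all add: R_def)
  have T0: "T > 0" using I T by simp
  define q where "q = cmod (cis (- I * T) - 1)"
  have q: "q > 0"
  proof -
    have "cis (- I * T) \<noteq> 1"
    proof
      assume "cis (- I * T) = 1"
      then have "cos (I * T) = 1" by (simp add: complex_eq_iff)
      then obtain n :: int where n: "I * T = of_int n * 2 * pi" by (auto simp: cos_one_2pi_int)
      then have "2 * pi * I = 2 * pi * (of_int n * (1 + I))" using I by (simp add: T field_simps)
      then have e: "I = of_int n * (1 + I)" by simp
      have "0 < of_int n * (1 + I)" "of_int n * (1 + I) < 1 * (1 + I)"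
        unfolding e[symmetric] using I by simp_all
      then have "0 < (of_int n :: real)" "(of_int n :: real) < 1"
        using I by (simp_all add: zero_less_mult_iff mult_less_cancel_right)
      then show False by simp
    qed
    then show ?thesis by (simp add: q_def)
  qed
  \<comment> \<open>All amplitudes stay below R + 1, so this bounds the arguments of the coupling.\<close>
  define \<rho> where "\<rho> = 2 * R + 2"
  define K where "K = 6 * R + 3 + 24 * \<rho>\<^sup>2"
  have K: "K > 0" using R by (simp add: K_def add_pos_nonneg)
  \<comment> \<open>The two summands are the bounds for an unexcited and for an excited site.\<close>
  define Q where "Q = T / q + (2 * T + 2 * T * T * I)"
  have Q: "Q > 0" using T0 q I by (simp add: Q_def add_pos_pos)
  define \<delta> where "\<delta> = min 1 (1 / (2 * Q * K))"
  have \<delta>: "\<delta> > 0" "\<delta> \<le> 1" "Q * (K * \<delta>) \<le> 1 / 2"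
  proof -
    show "\<delta> > 0" "\<delta> \<le> 1" using Q K by (simp_all add: \<delta>_def)
    have "Q * K * \<delta> \<le> Q * K * (1 / (2 * Q * K))" using Q K by (intro mult_left_mono) (auto simp: \<delta>_def)
    then show "Q * (K * \<delta>) \<le> 1 / 2" using Q K by (simp add: mult.assoc)
  qed
  have aR: "cmod (a $ j) \<le> R" for j using a[of j] R by (auto simp: R_def)
  have "u (t1 + h) = u t1" if \<epsilon>: "0 < \<epsilon>" "\<epsilon> < \<delta>" and ode: "corotating I \<epsilon> u" and per: "\<And>t. u (t + T) = u t"
    and near: "\<And>t j. cmod (u t $ j - a $ j) \<le> \<delta>" for \<epsilon> u t1 h
  proof -
    define d where "d t j = u (t + h) $ j - u t $ j" for t j
    define A where "A j z = - \<i> * (of_real ((cmod (a $ j))\<^sup>2 - I) * z + 2 * of_real (a $ j \<bullet> z) * a $ j)" for j z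
    define f where "f t j = - \<i> * (of_real ((cmod (u t $ j))\<^sup>2 - I) * u t $ j + 2 * of_real \<epsilon> * coupling (u t) j)" for t j
    define e where "e t j = f (t + h) j - f t j - A j (d t j)" for t j
    have uR: "cmod (u t $ j) \<le> R + 1" for t j
      using norm_triangle_ineq[of "u t $ j - a $ j" "a $ j"] near[of t j] aR[of j] \<delta>(2) by simp
    have u': "((\<lambda>t. u t $ j) has_vector_derivative f t j) (at t)" for t j
      using ode by (simp add: corotating_def f_def)
    have u'h: "((\<lambda>t. u (t + h) $ j) has_vector_derivative f (t + h) j) (at t)" for t j
    proof -
      have "((\<lambda>t. t + h) has_vector_derivative 1) (at t)" by (auto intro!: derivative_eq_intros)
      from vector_diff_chain_at[OF this u'[of j "t + h"]] show ?thesis by (simp add: o_def)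
    qed
    have d': "((\<lambda>t. d t j) has_vector_derivative A j (d t j) + e t j) (at t)" for t j
      unfolding d_def e_def by (rule has_vector_derivative_eq_rhs[OF has_vector_derivative_diff[OF u'h u']]) simp
    have dper: "d (t + T) j = d t j" for t j
    proof -
      have "t + T + h = t + h + T" by simp
      then show ?thesis unfolding d_def by (simp only: per)
    qed
    define D where "D = (SUP (t, j). cmod (d t j))"
    have bdd: "bdd_above (range (\<lambda>(t, j). cmod (d t j)))"
    proof (rule bdd_aboveI)
      fix x assume "x \<in> range (\<lambda>(t, j). cmod (d t j))"
      then obtain t j where "x = cmod (d t j)" by auto
      then show "x \<le> 2 * (R + 1)"
        using norm_triangle_ineq4[of "u (t + h) $ j" "u t $ j"] uR[of "t + h" j] uR[of t j]
        by (simp add: d_def)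
    qed
    have dD: "cmod (d t j) \<le> D" for t j
      unfolding D_def using cSUP_upper[OF _ bdd, of "(t, j)"] by simp
    have D0: "D \<ge> 0" using dD[of 0 0] norm_ge_zero order_trans by blast
    have eb: "cmod (e t j) \<le> K * \<delta> * D" for t j
    proof -
      have cp: "cmod (coupling (u (t + h)) j - coupling (u t) j) \<le> 12 * \<rho>\<^sup>2 * D"
      proof -
        have c1: "cmod (cubic (u (t + h) $ j - u (t + h) $ l) - cubic (u t $ j - u t $ l)) \<le> 6 * \<rho>\<^sup>2 * D" for l
        proof -
          have b: "cmod (u s $ j - u s $ l) \<le> \<rho>" for s
            using norm_triangle_ineq4[of "u s $ j" "u s $ l"] uR[of s j] uR[of s l] by (simp add: \<rho>_def)
          have "cmod (cubic (u (t + h) $ j - u (t + h) $ l) - cubic (u t $ j - u t $ l))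
             \<le> 3 * \<rho>\<^sup>2 * cmod ((u (t + h) $ j - u (t + h) $ l) - (u t $ j - u t $ l))"
            by (rule cubic_lipschitz[OF b b])
          also have "(u (t + h) $ j - u (t + h) $ l) - (u t $ j - u t $ l) = d t j - d t l" by (simp add: d_def)
          also have "3 * \<rho>\<^sup>2 * cmod (d t j - d t l) \<le> 3 * \<rho>\<^sup>2 * (2 * D)"
            using norm_triangle_ineq4[of "d t j" "d t l"] dD[of t j] dD[of t l] by (intro mult_left_mono) auto
          finally show ?thesis by simp
        qed
        have "coupling (u (t + h)) j - coupling (u t) j =
            (cubic (u (t + h) $ j - u (t + h) $ (j+1)) - cubic (u t $ j - u t $ (j+1)))
            + (cubic (u (t + h) $ j - u (t + h) $ (j-1)) - cubic (u t $ j - u t $ (j-1)))"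
          unfolding coupling_def by (rule add_diff_add)
        then have "cmod (coupling (u (t + h)) j - coupling (u t) j) \<le> 6 * \<rho>\<^sup>2 * D + 6 * \<rho>\<^sup>2 * D"
          using norm_triangle_le[OF add_mono[OF c1[of "j+1"] c1[of "j-1"]]] by metis
        then show ?thesis by (simp add: mult_ac)
      qed
      have cl: "cmod (cubic (u (t + h) $ j) - cubic (u t $ j) - (of_real ((cmod (a $ j))\<^sup>2) * d t j + 2 * of_real (a $ j \<bullet> d t j) * a $ j))
         \<le> (6 * R + 3) * \<delta> * D"
      proof -
        have "(6 * R + 3) * \<delta> * cmod (d t j) \<le> (6 * R + 3) * \<delta> * D"
          using dD[of t j] R \<delta> by (intro mult_left_mono) auto
        with cubic_linearization[OF aR[of j] near[of "t + h" j] near[of t j] \<delta>(2)]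
        show ?thesis unfolding d_def[symmetric] by (rule order_trans)
      qed
      have "e t j = - \<i> * ((cubic (u (t + h) $ j) - cubic (u t $ j) - (of_real ((cmod (a $ j))\<^sup>2) * d t j + 2 * of_real (a $ j \<bullet> d t j) * a $ j))
          + 2 * of_real \<epsilon> * (coupling (u (t + h)) j - coupling (u t) j))"
        unfolding e_def f_def A_def cubic_def by (simp add: d_def algebra_simps)
      then have "cmod (e t j) = cmod ((cubic (u (t + h) $ j) - cubic (u t $ j) - (of_real ((cmod (a $ j))\<^sup>2) * d t j + 2 * of_real (a $ j \<bullet> d t j) * a $ j))
          + 2 * of_real \<epsilon> * (coupling (u (t + h)) j - coupling (u t) j))"
        by (simp only: norm_mult norm_minus_cancel norm_ii mult_1_left)
      also have "\<dots> \<le> (6 * R + 3) * \<delta> * D + 2 * \<epsilon> * (12 * \<rho>\<^sup>2 * D)"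
      proof (rule norm_triangle_le[OF add_mono[OF cl]])
        show "cmod (2 * of_real \<epsilon> * (coupling (u (t + h)) j - coupling (u t) j)) \<le> 2 * \<epsilon> * (12 * \<rho>\<^sup>2 * D)"
          unfolding norm_mult using mult_left_mono[OF cp, of "2 * \<epsilon>"] \<epsilon> by simp
      qed
      also have "\<dots> \<le> (6 * R + 3) * \<delta> * D + 2 * \<delta> * (12 * \<rho>\<^sup>2 * D)"
        using \<epsilon> D0 by (intro add_left_mono mult_right_mono mult_nonneg_nonneg) auto
      also have "\<dots> = K * \<delta> * D" by (simp add: K_def algebra_simps)
      finally show ?thesis .
    qed
    define m where "m = K * \<delta> * D"
    have m0: "m \<ge> 0" using K \<delta> D0 by (simp add: m_def)
    have "cmod (d t j) \<le> Q * m" for t j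
    proof (cases "a $ j = 0")
      case True
      have "cmod (cis (- I * T) - 1) * cmod (d t j) \<le> T * m"
      proof (rule periodic_oscillator_bound)
        show "((\<lambda>t. d t j) has_vector_derivative \<i> * of_real I * d t j + e t j) (at t)" for t
          by (rule has_vector_derivative_eq_rhs[OF d']) (simp add: A_def True)
      qed (use eb dper T0 in \<open>auto simp: m_def\<close>)
      then have "q * cmod (d t j) \<le> T * m" unfolding q_def .
      then have "cmod (d t j) \<le> T / q * m" using q by (simp add: field_simps)
      also have "\<dots> \<le> Q * m" using m0 T0 I by (intro mult_right_mono) (auto simp: Q_def)
      finally show ?thesis .
    next
      case False
      let ?a = "a $ j"
      have na: "cmod ?a = R" "?a \<bullet> ?a = I" using a[of j] False R
        by (auto simp: R_def power2_norm_eq_inner[symmetric])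
      have nia: "cmod (\<i> * ?a) = R" using na by (simp add: norm_mult)
      have contu: "continuous_on UNIV (\<lambda>t. u t $ j)"
        using u' by (meson continuous_at_imp_continuous_on has_vector_derivative_continuous)
      define p where "p t = ?a \<bullet> d t j" for t
      define r where "r t = (\<i> * ?a) \<bullet> d t j" for t
      have lin: "((\<lambda>t. w \<bullet> d t j) has_vector_derivative w \<bullet> (A j (d t j) + e t j)) (at t)" for w t
        using bounded_linear.has_vector_derivative[OF bounded_linear_inner_right d'] .
      \<comment> \<open>The linear part sends the radial component to the phase direction and kills the latter.\<close>
      have A_eq: "A j z = (- 2 * (?a \<bullet> z)) *\<^sub>R (\<i> * ?a)" for z
        using na R by (simp add: A_def scaleR_conv_of_real power2_eq_square)
      have orth: "?a \<bullet> (\<i> * ?a) = 0" "(\<i> * ?a) \<bullet> (\<i> * ?a) = I"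
        using na(2) by (simp_all add: inner_complex_def)
      have p': "(p has_vector_derivative ?a \<bullet> e t j) (at t)" for t
        unfolding p_def by (rule has_vector_derivative_eq_rhs[OF lin]) (simp add: A_eq inner_add_right inner_diff_right orth)
      have r': "(r has_vector_derivative - 2 * I * p t + (\<i> * ?a) \<bullet> e t j) (at t)" for t
        unfolding r_def by (rule has_vector_derivative_eq_rhs[OF lin])
          (simp add: A_eq inner_add_right inner_diff_right orth p_def)
      have zero: "\<exists>t. w \<bullet> d t j = 0" for w
      proof -
        have "\<exists>t. w \<bullet> u (t + h) $ j - w \<bullet> u t $ j = 0"
          by (rule periodic_increment_has_zero[of "\<lambda>t. w \<bullet> u t $ j", OF _ _ T0])
             (auto intro!: continuous_intros contu simp: per)
        then show ?thesis by (simp add: d_def inner_diff_right)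
      qed
      have pb: "\<bar>p t\<bar> \<le> T * (R * m)" for t
      proof -
        obtain t0 where z: "p t0 = 0" using zero unfolding p_def by blast
        show ?thesis
        proof (rule periodic_with_zero_bound[OF p' _ _ T0 z])
          show "\<bar>?a \<bullet> e t j\<bar> \<le> R * m" for t using na eb by (intro abs_inner_le) (auto simp: m_def)
          show "p (t + T) = p t" for t by (simp add: p_def dper)
        qed
      qed
      have rb: "\<bar>r t\<bar> \<le> T * (2 * I * (T * (R * m)) + R * m)" for t
      proof -
        obtain t0 where z: "r t0 = 0" using zero unfolding r_def by blast
        show ?thesis
        proof (rule periodic_with_zero_bound[OF r' _ _ T0 z])
          show "\<bar>- 2 * I * p t + (\<i> * ?a) \<bullet> e t j\<bar> \<le> 2 * I * (T * (R * m)) + R * m" for t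
          proof -
            have "\<bar>(\<i> * ?a) \<bullet> e t j\<bar> \<le> R * m" using nia eb by (intro abs_inner_le) (auto simp: m_def)
            moreover have "\<bar>- 2 * I * p t\<bar> \<le> 2 * I * (T * (R * m))"
              using mult_left_mono[OF pb[of t], of "2 * I"] I by (simp add: abs_mult)
            ultimately show ?thesis by linarith
          qed
          show "r (t + T) = r t" for t by (simp add: r_def dper)
        qed
      qed
      have "R * cmod (d t j) \<le> \<bar>p t\<bar> + \<bar>r t\<bar>"
      proof -
        have "R * cmod (d t j) = cmod (cnj ?a * d t j)" by (simp add: norm_mult na)
        also have "\<dots> \<le> \<bar>Re (cnj ?a * d t j)\<bar> + \<bar>Im (cnj ?a * d t j)\<bar>" by (rule cmod_le)
        also have "Re (cnj ?a * d t j) = p t" by (simp add: p_def inner_complex_def)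
        also have "Im (cnj ?a * d t j) = r t" by (simp add: r_def inner_complex_def)
        finally show ?thesis .
      qed
      also have "\<dots> \<le> R * ((2 * T + 2 * T * T * I) * m)" using pb[of t] rb[of t] by (simp add: algebra_simps)
      finally have "cmod (d t j) \<le> (2 * T + 2 * T * T * I) * m" using R(1) by simp
      also have "\<dots> \<le> Q * m" using m0 T0 q by (intro mult_right_mono) (auto simp: Q_def)
      finally show ?thesis .
    qed
    then have "D \<le> Q * m" unfolding D_def by (intro cSUP_least) auto
    also have "Q * m \<le> 1 / 2 * D" using mult_right_mono[OF \<delta>(3) D0] by (simp add: m_def mult.assoc)
    finally have "D \<le> 0" by simp
    then have "d t1 j = 0" for j using dD[of t1 j] by (metis norm_le_zero_iff order_trans)
    then show ?thesis by (simp add: d_def vec_eq_iff)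
  qed
  then show ?thesis using \<delta>(1) by blast
qed

section \<open>Matrix exponential and eigenvalues\<close>

abbreviation cmat :: "real^'m^'n \<Rightarrow> complex^'m^'n" where
  "cmat M \<equiv> (\<chi> a b. complex_of_real (M $ a $ b))"

lemma cmat_mult: "cmat (M ** N) = cmat M ** cmat (N :: real^'k^'m::finite)"
  by (simp add: vec_eq_iff matrix_matrix_mult_def)

definition mpow :: "real^'n^'n::finite \<Rightarrow> nat \<Rightarrow> real^'n^'n" where
  "mpow B k = ((\<lambda>M. B ** M) ^^ k) (mat 1)"

lemma mpow_0 [simp]: "mpow B 0 = mat 1" and mpow_Suc [simp]: "mpow B (Suc k) = B ** mpow B k"
  by (simp_all add: mpow_def)

lemma mpow_commute: "mpow B k ** B = B ** mpow B k"
  by (induction k) (simp_all add: matrix_mul_assoc[symmetric])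

lemma mpow_bound: "\<bar>mpow B k $ a $ b\<bar> \<le> (1 + (\<Sum>a\<in>UNIV. \<Sum>b\<in>UNIV. \<bar>B $ a $ b\<bar>)) ^ k"
proof (induction k arbitrary: a b)
  case 0 then show ?case by (simp add: mat_def)
next
  case (Suc k)
  let ?S = "1 + (\<Sum>a\<in>UNIV. \<Sum>b\<in>UNIV. \<bar>B $ a $ b\<bar>)"
  have S: "(\<Sum>c\<in>UNIV. \<bar>B $ a $ c\<bar>) \<le> ?S"
    using member_le_sum[of a UNIV "\<lambda>a. \<Sum>b\<in>UNIV. \<bar>B $ a $ b\<bar>"] by (auto simp: sum_nonneg)
  have S0: "?S \<ge> 0" by (intro add_nonneg_nonneg sum_nonneg) auto
  have "\<bar>mpow B (Suc k) $ a $ b\<bar> \<le> (\<Sum>c\<in>UNIV. \<bar>B $ a $ c\<bar> * \<bar>mpow B k $ c $ b\<bar>)"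
    by (simp add: matrix_matrix_mult_def abs_mult[symmetric] sum_abs)
  also have "\<dots> \<le> (\<Sum>c\<in>UNIV. \<bar>B $ a $ c\<bar> * ?S ^ k)"
    by (intro sum_mono mult_left_mono Suc) auto
  also have "\<dots> \<le> ?S * ?S ^ k"
    unfolding sum_distrib_right[symmetric] using S S0 by (intro mult_right_mono) auto
  finally show ?case by simp
qed

text \<open>
  The exponential of t B, entrywise a power series in t, so that it can be differentiated term by
  term.
\<close>

definition mexp :: "real^'n^'n::finite \<Rightarrow> real \<Rightarrow> real^'n^'n" where
  "mexp B t = (\<chi> a b. \<Sum>k. mpow B k $ a $ b / fact k * t ^ k)"

lemma mexp_summable: "summable (\<lambda>k. mpow B k $ a $ b / fact k * t ^ k)"
proof (rule summable_comparison_test')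
  let ?S = "1 + (\<Sum>a\<in>UNIV. \<Sum>b\<in>UNIV. \<bar>B $ a $ b\<bar>)"
  show "summable (\<lambda>k. (?S * \<bar>t\<bar>) ^ k /\<^sub>R fact k)" by (rule summable_exp_generic)
  fix k
  have "norm (mpow B k $ a $ b / fact k * t ^ k) = \<bar>mpow B k $ a $ b\<bar> * (\<bar>t\<bar> ^ k / fact k)"
    by (simp add: abs_mult power_abs)
  also have "\<dots> \<le> ?S ^ k * (\<bar>t\<bar> ^ k / fact k)"
    by (intro mult_right_mono mpow_bound) auto
  also have "s ^ k * (\<bar>t\<bar> ^ k / fact k) = (s * \<bar>t\<bar>) ^ k /\<^sub>R fact k" for s :: real
    by (simp add: power_mult_distrib divide_inverse)
  finally show "norm (mpow B k $ a $ b / fact k * t ^ k) \<le> (?S * \<bar>t\<bar>) ^ k /\<^sub>R fact k" .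
qed

lemma mexp_0 [simp]: "mexp B 0 = mat 1"
  using powser_zero[of "\<lambda>k. mpow B k $ a $ b / fact k" for a b]
  by (simp add: vec_eq_iff mexp_def)

lemma has_vector_derivative_matrix:
  fixes f :: "real \<Rightarrow> real^'n::finite^'m::finite"
  assumes "\<And>a b. ((\<lambda>t. f t $ a $ b) has_real_derivative D $ a $ b) (at t)"
  shows "(f has_vector_derivative D) (at t)"
proof -
  have "((\<lambda>t. f t $ a $ b) has_derivative (\<lambda>h. (h *\<^sub>R D) $ a $ b)) (at t)" for a b
    by (rule has_derivative_eq_rhs[OF assms[unfolded has_field_derivative_def]]) (auto simp: mult.commute)
  then show ?thesis
    unfolding has_vector_derivative_def
    by (subst has_derivative_componentwise_within) (auto simp: Basis_vec_def inner_axis)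
qed

lemma mexp_deriv: "(mexp B has_vector_derivative B ** mexp B t) (at t)"
proof (rule has_vector_derivative_matrix)
  fix a b
  have "(B ** mexp B t) $ a $ b = (\<Sum>c\<in>UNIV. B $ a $ c * (\<Sum>k. mpow B k $ c $ b / fact k * t ^ k))"
    by (simp add: matrix_matrix_mult_def mexp_def)
  also have "\<dots> = (\<Sum>c\<in>UNIV. (\<Sum>k. B $ a $ c * (mpow B k $ c $ b / fact k * t ^ k)))"
    by (intro sum.cong refl suminf_mult[OF mexp_summable, symmetric])
  also have "\<dots> = (\<Sum>k. \<Sum>c\<in>UNIV. B $ a $ c * (mpow B k $ c $ b / fact k * t ^ k))"
    by (rule suminf_sum[symmetric]) (intro summable_mult mexp_summable)
  also have "\<dots> = (\<Sum>k. diffs (\<lambda>k. mpow B k $ a $ b / fact k) k * t ^ k)"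
    by (simp add: diffs_def matrix_matrix_mult_def sum_distrib_right sum_divide_distrib sum_distrib_left
        field_simps del: of_nat_Suc)
  finally show "((\<lambda>t. mexp B t $ a $ b) has_real_derivative (B ** mexp B t) $ a $ b) (at t)"
    using termdiffs_strong_converges_everywhere[OF mexp_summable, of B a b t]
    by (simp add: mexp_def)
qed

lemma mexp_commute: "mexp B t ** B = B ** mexp B t"
proof -
  have "(mexp B t ** B) $ a $ b = (B ** mexp B t) $ a $ b" for a b
  proof -
    have "(mexp B t ** B) $ a $ b = (\<Sum>c\<in>UNIV. \<Sum>k. B $ c $ b * (mpow B k $ a $ c / fact k * t ^ k))"
    proof -
      have "(mexp B t ** B) $ a $ b = (\<Sum>c\<in>UNIV. B $ c $ b * (\<Sum>k. mpow B k $ a $ c / fact k * t ^ k))"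
        by (simp add: matrix_matrix_mult_def mexp_def mult.commute[of "B $ _ $ b"])
      also have "\<dots> = (\<Sum>c\<in>UNIV. \<Sum>k. B $ c $ b * (mpow B k $ a $ c / fact k * t ^ k))"
        by (intro sum.cong refl suminf_mult[OF mexp_summable, symmetric])
      finally show ?thesis .
    qed
    also have "\<dots> = (\<Sum>k. \<Sum>c\<in>UNIV. B $ c $ b * (mpow B k $ a $ c / fact k * t ^ k))"
      by (rule suminf_sum[symmetric]) (intro summable_mult mexp_summable)
    also have "\<dots> = (\<Sum>k. (mpow B k ** B) $ a $ b / fact k * t ^ k)"
      by (intro suminf_cong)
        (simp add: matrix_matrix_mult_def sum_distrib_right sum_divide_distrib sum_distrib_left mult_ac)
    also have "\<dots> = (\<Sum>k. (B ** mpow B k) $ a $ b / fact k * t ^ k)"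
      by (simp only: mpow_commute)
    also have "\<dots> = (\<Sum>k. \<Sum>c\<in>UNIV. B $ a $ c * (mpow B k $ c $ b / fact k * t ^ k))"
      by (intro suminf_cong)
        (simp add: matrix_matrix_mult_def sum_distrib_right sum_divide_distrib sum_distrib_left mult_ac)
    also have "\<dots> = (\<Sum>c\<in>UNIV. \<Sum>k. B $ a $ c * (mpow B k $ c $ b / fact k * t ^ k))"
      by (rule suminf_sum) (intro summable_mult mexp_summable)
    also have "\<dots> = (B ** mexp B t) $ a $ b"
    proof -
      have "(B ** mexp B t) $ a $ b = (\<Sum>c\<in>UNIV. B $ a $ c * (\<Sum>k. mpow B k $ c $ b / fact k * t ^ k))"
        by (simp add: matrix_matrix_mult_def mexp_def)
      also have "\<dots> = (\<Sum>c\<in>UNIV. \<Sum>k. B $ a $ c * (mpow B k $ c $ b / fact k * t ^ k))"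
        by (intro sum.cong refl suminf_mult[OF mexp_summable, symmetric])
      finally show ?thesis by simp
    qed
    finally show ?thesis .
  qed
  then show ?thesis by (simp add: vec_eq_iff)
qed

lemma mexp_eigenvector:
  assumes "cmat B *v w = \<nu> *s w"
  shows "cmat (mexp B t) *v w = exp (\<nu> * of_real t) *s w"
proof -
  have pow: "cmat (mpow B k) *v w = \<nu> ^ k *s w" for k
  proof (induction k)
    case 0
    have "cmat (mat 1 :: real^'a^'a) = mat 1" by (simp add: vec_eq_iff mat_def)
    then show ?case by simp
  next
    case (Suc k)
    then show ?case
      by (simp add: cmat_mult matrix_vector_mul_assoc[symmetric] vec.scale assms vector_smult_assoc mult.commute)
  qed
  have sums: "(\<lambda>k. complex_of_real (mpow B k $ a $ b / fact k * t ^ k)) sums complex_of_real (mexp B t $ a $ b)" for a b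
    unfolding mexp_def vec_lambda_beta sums_of_real_iff by (rule summable_sums[OF mexp_summable])
  have "(cmat (mexp B t) *v w) $ a = (exp (\<nu> * of_real t) *s w) $ a" for a
  proof -
    have "(\<lambda>k. \<Sum>b\<in>UNIV. complex_of_real (mpow B k $ a $ b / fact k * t ^ k) * w $ b) sums
       (\<Sum>b\<in>UNIV. complex_of_real (mexp B t $ a $ b) * w $ b)"
      by (intro sums_sum sums_mult2 sums)
    moreover have "(\<Sum>b\<in>UNIV. complex_of_real (mpow B k $ a $ b / fact k * t ^ k) * w $ b)
        = ((\<nu> * of_real t) ^ k /\<^sub>R fact k) * w $ a" for k
    proof -
      have "(\<Sum>b\<in>UNIV. complex_of_real (mpow B k $ a $ b / fact k * t ^ k) * w $ b)
        = (cmat (mpow B k) *v w) $ a * of_real (t ^ k / fact k)"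
        by (simp add: matrix_vector_mult_def sum_distrib_right sum_divide_distrib sum_distrib_left mult_ac)
      then show ?thesis unfolding pow
        by (simp add: power_mult_distrib scaleR_conv_of_real field_simps)
    qed
    ultimately have "(\<lambda>k. ((\<nu> * of_real t) ^ k /\<^sub>R fact k) * w $ a) sums
       (\<Sum>b\<in>UNIV. complex_of_real (mexp B t $ a $ b) * w $ b)" by simp
    moreover have "(\<lambda>k. ((\<nu> * of_real t) ^ k /\<^sub>R fact k) * w $ a) sums (exp (\<nu> * of_real t) * w $ a)"
      by (intro sums_mult2 exp_converges)
    ultimately show ?thesis using sums_unique2 by (fastforce simp: matrix_vector_mult_def)
  qed
  then show ?thesis by (simp add: vec_eq_iff)
qed

text \<open>
  The vector p(C) v.
\<close>

definition apply_poly :: "complex^'n^'n::finite \<Rightarrow> complex^'n \<Rightarrow> complex poly \<Rightarrow> complex^'n" where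
  "apply_poly C v p = (\<Sum>i\<le>degree p. coeff p i *s (((\<lambda>x. C *v x) ^^ i) v))"

lemma apply_poly_bound: "degree p \<le> n \<Longrightarrow> apply_poly C v p = (\<Sum>i\<le>n. coeff p i *s (((\<lambda>x. C *v x) ^^ i) v))"
  unfolding apply_poly_def by (rule sum.mono_neutral_left) (auto simp: coeff_eq_0)

lemma apply_poly_linear_factor: "apply_poly C v ([:- \<nu>, 1:] * q) = C *v apply_poly C v q - \<nu> *s apply_poly C v q"
proof -
  let ?U = "\<lambda>i. ((\<lambda>x. C *v x) ^^ i) v"
  let ?n = "degree q"
  have "degree ([:- \<nu>, 1:] * q) \<le> Suc ?n" by (rule order_trans[OF degree_mult_le]) simp
  then have "apply_poly C v ([:- \<nu>, 1:] * q) = (\<Sum>i\<le>Suc ?n. coeff ([:- \<nu>, 1:] * q) i *s ?U i)"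
    by (rule apply_poly_bound)
  also have "\<dots> = (\<Sum>i\<le>Suc ?n. coeff (pCons 0 q) i *s ?U i) - (\<Sum>i\<le>Suc ?n. \<nu> *s (coeff q i *s ?U i))"
  proof -
    have "coeff ([:- \<nu>, 1:] * q) i = coeff (pCons 0 q) i - \<nu> * coeff q i" for i by simp
    then show ?thesis
      by (simp only: sum_subtractf[symmetric] vector_sub_rdistrib vector_smult_assoc)
  qed
  also have "(\<Sum>i\<le>Suc ?n. coeff (pCons 0 q) i *s ?U i) = (\<Sum>i\<le>?n. coeff q i *s (C *v ?U i))"
    by (subst sum.atMost_Suc_shift) simp
  also have "\<dots> = C *v apply_poly C v q" by (simp add: apply_poly_def vec.sum vec.scale)
  also have "(\<Sum>i\<le>Suc ?n. \<nu> *s (coeff q i *s ?U i)) = \<nu> *s apply_poly C v q"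
    by (subst apply_poly_bound[of q "Suc ?n"]) (simp_all add: vec.scale_sum_right)
  finally show ?thesis .
qed

lemma apply_poly_annihilator: "\<exists>p. p \<noteq> 0 \<and> apply_poly C v p = 0"
proof -
  let ?U = "\<lambda>i. ((\<lambda>x. C *v x) ^^ i) v"
  let ?d = "DIM(complex^'a)"
  show ?thesis
  proof (cases "inj_on ?U {..?d}")
    case False
    then obtain i j where ij: "i \<noteq> j" "?U i = ?U j" by (auto simp: inj_on_def)
    define p where "p = monom (1::complex) i - monom 1 j"
    have "coeff p i \<noteq> 0" using ij by (simp add: p_def)
    then have "p \<noteq> 0" by auto
    moreover have "apply_poly C v p = 0"
    proof -
      have "degree p \<le> max i j" unfolding p_def
        by (rule order_trans[OF degree_diff_le_max]) (simp add: degree_monom_eq)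
      then have "apply_poly C v p = (\<Sum>k\<le>max i j. coeff p k *s ?U k)" by (rule apply_poly_bound)
      also have "\<dots> = (\<Sum>k\<le>max i j. (if i = k then ?U k else 0) - (if j = k then ?U k else 0))"
        by (rule sum.cong) (auto simp: p_def vector_sub_rdistrib)
      also have "\<dots> = 0" using ij by (simp add: sum_subtractf)
      finally show ?thesis .
    qed
    ultimately show ?thesis by blast
  next
    case True
    have "card (?U ` {..?d}) > ?d" using True by (simp add: card_image)
    then have "dependent (?U ` {..?d})" by (intro dependent_biggerset) auto
    then obtain u where u: "\<exists>x\<in>?U ` {..?d}. u x \<noteq> 0" "(\<Sum>x\<in>?U ` {..?d}. u x *\<^sub>R x) = 0"
      by (auto simp: dependent_finite)
    define p where "p = (\<Sum>i\<le>?d. monom (complex_of_real (u (?U i))) i)"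
    have co: "coeff p i = (if i \<le> ?d then complex_of_real (u (?U i)) else 0)" for i
      by (simp add: p_def coeff_sum sum.delta del: DIM_cart)
    obtain i where "i \<le> ?d" "u (?U i) \<noteq> 0" using u(1) by blast
    then have "coeff p i \<noteq> 0" using co by simp
    then have "p \<noteq> 0" by auto
    have "degree p \<le> ?d" by (rule degree_le) (simp add: co)
    then have "apply_poly C v p = (\<Sum>i\<le>?d. coeff p i *s ?U i)" by (rule apply_poly_bound)
    also have "\<dots> = (\<Sum>i\<le>?d. u (?U i) *\<^sub>R ?U i)"
      by (rule sum.cong) (auto simp: co vec_eq_iff scaleR_conv_of_real[where 'a = complex])
    also have "\<dots> = 0" using u(2) unfolding sum.reindex[OF True] by (simp add: o_def)
    finally show ?thesis using \<open>p \<noteq> 0\<close> by blast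
  qed
qed

text \<open>
  A polynomial p of least degree with p(B) v = 0 has a root nu; dividing by the corresponding
  linear factor leaves q with q(B) v an eigenvector of B, and q(B) v is still an eigenvector of M.
\<close>

lemma common_eigenvector:
  assumes comm: "M ** B = B ** (M :: complex^'n^'n::finite)"
    and "v \<noteq> 0" "M *v v = \<mu> *s v"
  obtains w \<nu> where "w \<noteq> 0" "M *v w = \<mu> *s w" "B *v w = \<nu> *s w"
proof -
  define p where "p = arg_min degree (\<lambda>p. p \<noteq> 0 \<and> apply_poly B v p = 0)"
  obtain p0 where "p0 \<noteq> 0 \<and> apply_poly B v p0 = 0" using apply_poly_annihilator by blast
  then have p: "p \<noteq> 0 \<and> apply_poly B v p = 0" unfolding p_def by (rule arg_min_natI)
  have pmin: "degree p \<le> degree q" if "q \<noteq> 0 \<and> apply_poly B v q = 0" for q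
    unfolding p_def by (rule arg_min_nat_le) (rule that)
  have "degree p > 0"
  proof (rule ccontr)
    assume "\<not> degree p > 0"
    then have "apply_poly B v p = coeff p 0 *s v" by (simp add: apply_poly_def)
    moreover have "coeff p 0 \<noteq> 0"
      using p \<open>\<not> degree p > 0\<close> by (metis leading_coeff_0_iff not_gr_zero)
    ultimately
    show False using p assms(2) by (metis vec.scale_eq_0_iff)
  qed
  then obtain \<nu> where "poly p \<nu> = 0" 
    using fundamental_theorem_of_algebra[of p] by (auto simp: constant_degree)
  then have "[:- \<nu>, 1:] dvd p" by (simp add: poly_eq_0_iff_dvd)
  then obtain q where q: "p = [:- \<nu>, 1:] * q" by (rule dvdE)
  have "q \<noteq> 0" using p unfolding q by (metis mult_zero_right)
  have "degree p = Suc (degree q)" 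
    unfolding q by (subst degree_mult_eq) (use \<open>q \<noteq> 0\<close> in auto)
  then have "apply_poly B v q \<noteq> 0" using pmin[of q] \<open>q \<noteq> 0\<close> by auto
  moreover have "B *v apply_poly B v q = \<nu> *s apply_poly B v q"
    using apply_poly_linear_factor[of B v \<nu> q] p unfolding q[symmetric] by simp
  moreover have "M *v apply_poly B v q = \<mu> *s apply_poly B v q"
  proof -
    have U: "M *v (((\<lambda>x. B *v x) ^^ i) v) = \<mu> *s (((\<lambda>x. B *v x) ^^ i) v)" for i
    proof (induction i)
      case (Suc i)
      have "M *v (B *v x) = B *v (M *v x)" for x
        by (simp add: matrix_vector_mul_assoc comm)
      then show ?case using Suc by (simp add: vec.scale)
    qed (simp add: assms)
    show ?thesis
      by (simp add: apply_poly_def vec.sum vec.scale U vec.scale_sum_right vector_smult_assoc mult.commute)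
  qed
  ultimately show thesis using that by blast
qed

text \<open>
  The part of the spectral mapping theorem that is needed for stability: no multiplier arises
  other than from an exponent.
\<close>

lemma mexp_eigenvalue:
  assumes "is_complex_eigenvalue (mexp B t) \<mu>"
  obtains \<nu> where "is_complex_eigenvalue B \<nu>" "\<mu> = exp (\<nu> * of_real t)"
proof -
  obtain v where v: "v \<noteq> 0" "cmat (mexp B t) *v v = \<mu> *s v"
    using assms by (auto simp: is_complex_eigenvalue_def)
  have "cmat (mexp B t) ** cmat B = cmat B ** cmat (mexp B t)"
    by (simp only: cmat_mult[symmetric] mexp_commute)
  from common_eigenvector[OF this v] obtain w \<nu>
    where w: "w \<noteq> 0" "cmat (mexp B t) *v w = \<mu> *s w" "cmat B *v w = \<nu> *s w" by blast
  have "\<mu> *s w = exp (\<nu> * of_real t) *s w"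
    unfolding w(2)[symmetric] by (rule mexp_eigenvector[OF w(3)])
  then have "\<mu> = exp (\<nu> * of_real t)" using w(1) by (simp add: vec.scale_right_imp_eq)
  then show thesis using that w by (auto simp: is_complex_eigenvalue_def)
qed

section \<open>Monodromy matrix of a standing wave\<close>

text \<open>
  The derivative of the cubic at z in direction h; it is linear over the reals only.
\<close>

definition dcubic :: "complex \<Rightarrow> complex \<Rightarrow> complex" where
  "dcubic z h = of_real ((cmod z)\<^sup>2) * h + 2 * of_real (z \<bullet> h) * z"

lemma has_derivative_cubic:
  fixes f :: "'a::real_normed_vector \<Rightarrow> complex"
  assumes "(f has_derivative f') (at x)"
  shows "((\<lambda>x. cubic (f x)) has_derivative (\<lambda>h. dcubic (f x) (f' h))) (at x)"
  unfolding cubic_def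
  by (rule has_derivative_eq_rhs,
      rule has_derivative_mult[OF has_derivative_of_real[OF has_derivative_cmod_sq[OF assms]] assms])
     (simp add: dcubic_def fun_eq_iff mult_ac)

definition lin_field :: "real \<Rightarrow> 'n::finite state \<Rightarrow> 'n state \<Rightarrow> 'n state" where
  "lin_field \<epsilon> \<psi> h = (\<chi> j. - \<i> * (h $ j + dcubic (\<psi> $ j) (h $ j)
     + 2 * of_real \<epsilon> * (dcubic (\<psi> $ j - \<psi> $ (j+1)) (h $ j - h $ (j+1)) + dcubic (\<psi> $ j - \<psi> $ (j-1)) (h $ j - h $ (j-1)))))"

lemma has_derivative_vec_componentwise:
  fixes f :: "'a::real_normed_vector \<Rightarrow> 'b::euclidean_space^'n::finite"
  assumes "\<And>j. ((\<lambda>x. f x $ j) has_derivative (\<lambda>h. f' h $ j)) (at x)"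
  shows "(f has_derivative f') (at x)"
proof (subst has_derivative_componentwise_within, safe)
  fix i :: "'b^'n" assume "i \<in> Basis"
  then obtain j b where "i = axis j b" by (auto simp: Basis_vec_def)
  then show "((\<lambda>x. f x \<bullet> i) has_derivative (\<lambda>h. f' h \<bullet> i)) (at x)"
    using has_derivative_inner_left[OF assms[of j], of b] by (simp add: inner_axis)
qed

lemma has_derivative_vector_field: "(vector_field \<epsilon> has_derivative lin_field \<epsilon> \<psi>) (at \<psi>)"
proof (rule has_derivative_vec_componentwise)
  fix j
  show "((\<lambda>x. vector_field \<epsilon> x $ j) has_derivative (\<lambda>h. lin_field \<epsilon> \<psi> h $ j)) (at \<psi>)"
    unfolding vector_field_nth coupling_def lin_field_def vec_lambda_beta
    by (intro has_derivative_mult_right has_derivative_add has_derivative_cubic has_derivative_diff has_derivative_nth)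
qed

lemma linear_lin_field: "linear (lin_field \<epsilon> \<psi>)"
  by (rule has_derivative_linear[OF has_derivative_vector_field])

lemma linear_to_real: "linear to_real"
  by (rule linearI) (auto simp: to_real_def vec_eq_iff split: sum.split)

lemma linear_from_real: "linear from_real"
  by (rule linearI) (auto simp: from_real_def vec_eq_iff complex_eq_iff)

lemma from_to_real [simp]: "from_real (to_real \<psi>) = \<psi>"
  by (simp add: from_real_def to_real_def vec_eq_iff)

lemma to_from_real [simp]: "to_real (from_real x) = x"
  by (auto simp: from_real_def to_real_def vec_eq_iff split: sum.split)

text \<open>
  The matrix of a real-linear map of states in the coordinates (Re, Im).
\<close>

definition rmat :: "('n::finite state \<Rightarrow> 'n state) \<Rightarrow> real ^ ('n site + 'n site) ^ ('n site + 'n site)" where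
  "rmat f = matrix (\<lambda>x. to_real (f (from_real x)))"

lemma linear_real_form: "linear f \<Longrightarrow> linear (\<lambda>x. to_real (f (from_real x)))"
  using linear_compose[OF linear_compose[OF linear_from_real] linear_to_real] by (simp add: o_def)

lemma rmat_works: "linear f \<Longrightarrow> rmat f *v x = to_real (f (from_real x))"
  unfolding rmat_def by (rule matrix_works[OF linear_real_form[unfolded linear_matrix_vector_mul_eq[symmetric]], unfolded o_def]) 

lemma rmat_mult: "linear f \<Longrightarrow> linear g \<Longrightarrow> rmat f ** rmat g = rmat (\<lambda>h. f (g h))"
  unfolding rmat_def using matrix_compose[OF linear_real_form linear_real_form, of g f] by (simp add: o_def)

lemma rmat_id: "rmat (\<lambda>h. h) = mat 1"
  unfolding rmat_def using matrix_id_mat_1 by (simp add: id_def)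

lemma rmat_add: "linear f \<Longrightarrow> linear g \<Longrightarrow> rmat f + rmat g = rmat (\<lambda>h. f h + g h)"
  unfolding rmat_def matrix_def by (simp add: vec_eq_iff linear_add[OF linear_to_real])

lemma jacobian_real_vector_field:
  "jacobian (real_vector_field \<epsilon>) (at (to_real \<psi>)) = rmat (lin_field \<epsilon> \<psi>)"
proof -
  have bf: "bounded_linear from_real" "bounded_linear to_real"
    using linear_from_real linear_to_real by (simp_all add: linear_conv_bounded_linear)
  have "(vector_field \<epsilon> has_derivative lin_field \<epsilon> \<psi>) (at (from_real (to_real \<psi>)))"
    by (simp add: has_derivative_vector_field)
  from bounded_linear.has_derivative[OF bf(2) has_derivative_compose[OF bounded_linear_imp_has_derivative[OF bf(1)] this]]
  have "(real_vector_field \<epsilon> has_derivative (\<lambda>x. to_real (lin_field \<epsilon> \<psi> (from_real x)))) (at (to_real \<psi>))"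
    by (simp add: real_vector_field_def[abs_def])
  then show ?thesis unfolding jacobian_def rmat_def by (metis frechet_derivative_at)
qed

definition phase :: "complex \<Rightarrow> 'n::finite state \<Rightarrow> 'n state" where "phase c h = (\<chi> j. c * h $ j)"

lemma phase_nth [simp]: "phase c h $ j = c * h $ j" by (simp add: phase_def)

lemma linear_phase: "linear (phase c)"
  by (rule linearI) (simp_all add: vec_eq_iff algebra_simps)

lemma inner_mult_phase: "cmod c = 1 \<Longrightarrow> (c * x) \<bullet> (c * y) = x \<bullet> y"
proof -
  assume "cmod c = 1"
  then have "Re c * Re c + Im c * Im c = 1" by (simp add: cmod_def power2_eq_square)
  moreover have "(c * x) \<bullet> (c * y) = (Re c * Re c + Im c * Im c) * (x \<bullet> y)"
    by (simp add: inner_complex_def algebra_simps)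
  ultimately show ?thesis by simp
qed

lemma lin_field_phase:
  assumes "cmod c = 1"
  shows "lin_field \<epsilon> (phase c \<psi>) (phase c h) = phase c (lin_field \<epsilon> \<psi> h)"
proof -
  have d: "dcubic (c * z) (c * k) = c * dcubic z k" for z k
    using assms by (simp add: dcubic_def inner_mult_phase norm_mult algebra_simps)
  show ?thesis
    unfolding vec_eq_iff lin_field_def vec_lambda_beta phase_nth right_diff_distrib[symmetric] d
    by (simp add: distrib_left mult.left_commute[of c] right_diff_distrib)
qed

text \<open>
  The linearised field in the rotating frame, where a standing wave is an equilibrium and the
  variational equation is autonomous.
\<close>

definition rot_field :: "real \<Rightarrow> real \<Rightarrow> 'n::finite state \<Rightarrow> 'n state \<Rightarrow> 'n state" where
  "rot_field I \<epsilon> \<phi> h = lin_field \<epsilon> \<phi> h + phase (\<i> * of_real (1 + I)) h"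

lemma linear_rot_field: "linear (rot_field I \<epsilon> \<phi>)"
  unfolding rot_field_def by (rule linear_compose_add[OF linear_lin_field linear_phase])

lemma rot_field_parts:
  assumes "im_part \<phi> = 0"
  shows "re_part (rot_field I \<epsilon> \<phi> h) = Lm I \<epsilon> \<phi> (im_part h)" "im_part (rot_field I \<epsilon> \<phi> h) = - Lp I \<epsilon> \<phi> (re_part h)"
proof -
  have im: "Im (\<phi> $ j) = 0" for j using assms by (simp add: im_part_def vec_eq_iff)
  have c2: "(cmod (\<phi> $ j))\<^sup>2 = (Re (\<phi> $ j))\<^sup>2" for j by (simp add: cmod_power2 im)
  have j2: "jump \<phi> j = (Re (\<phi> $ (j+1)) - Re (\<phi> $ j))\<^sup>2" for j by (simp add: jump_def cmod_power2 im)
  have dr: "Re (dcubic z k) = 3 * (Re z)\<^sup>2 * Re k" "Im (dcubic z k) = (Re z)\<^sup>2 * Im k" if "Im z = 0" for z k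
    unfolding dcubic_def cmod_power2 using that by (simp_all add: inner_complex_def power2_eq_square)
  show "re_part (rot_field I \<epsilon> \<phi> h) = Lm I \<epsilon> \<phi> (im_part h)"
    by (simp add: vec_eq_iff re_part_def im_part_def rot_field_def lin_field_def Lm_def ring_op_nth c2 j2 dr im)
       (simp add: power2_eq_square algebra_simps)
  show "im_part (rot_field I \<epsilon> \<phi> h) = - Lp I \<epsilon> \<phi> (re_part h)"
    by (simp add: vec_eq_iff re_part_def im_part_def rot_field_def lin_field_def Lp_def ring_op_nth c2 j2 dr im)
       (simp add: power2_eq_square algebra_simps)
qed

lemma matrix_mult_add_left: "(A + B) ** C = A ** C + B ** (C :: real^'k^'m::finite)"
  by (simp add: vec_eq_iff matrix_matrix_mult_def sum.distrib distrib_right)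

lemma bounded_bilinear_matrix_mult:
  "bounded_bilinear ((**) :: real^'n::finite^'n \<Rightarrow> real^'n^'n \<Rightarrow> real^'n^'n)"
  unfolding bilinear_conv_bounded_bilinear[symmetric] bilinear_def
  by (auto intro!: linearI simp:
      vec_eq_iff matrix_matrix_mult_def sum.distrib algebra_simps sum_distrib_left)

lemma bounded_linear_rmat_phase: "bounded_linear (\<lambda>c. rmat (phase c :: 'n::finite state \<Rightarrow> 'n state))"
  unfolding linear_conv_bounded_linear[symmetric]
  by (rule linearI)
     (auto simp: rmat_def matrix_def vec_eq_iff to_real_def algebra_simps split: sum.split)

lemma eigenvalue_conj:
  fixes A P Q :: "real^'n^'n::finite"
  assumes "Q ** P = mat 1" "is_complex_eigenvalue (P ** A ** Q) \<mu>" "P ** Q = mat 1"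
  shows "is_complex_eigenvalue A \<mu>"
proof -
  obtain v where v: "v \<noteq> 0" "cmat (P ** A ** Q) *v v = \<mu> *s v"
    using assms(2) by (auto simp: is_complex_eigenvalue_def)
  have c1: "cmat (mat 1 :: real^'n^'n) = mat 1" by (simp add: vec_eq_iff mat_def)
  define w where "w = cmat Q *v v"
  have "cmat P *v w = cmat (P ** Q) *v v" by (simp only: w_def cmat_mult matrix_vector_mul_assoc)
  then have Pw: "cmat P *v w = v" unfolding assms(3) c1 by simp
  then have "w \<noteq> 0" using v(1) by auto
  moreover have "cmat A *v w = \<mu> *s w"
  proof -
    have "cmat A *v w = cmat (Q ** P) *v (cmat A *v w)" unfolding assms(1) c1 by simp
    also have "\<dots> = cmat Q *v (cmat (P ** A ** Q) *v v)"
      by (simp only: w_def cmat_mult matrix_vector_mul_assoc matrix_mul_assoc)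
    also have "\<dots> = \<mu> *s w" by (simp add: v w_def vec.scale)
    finally show ?thesis .
  qed
  ultimately show ?thesis by (auto simp: is_complex_eigenvalue_def)
qed

definition standing_wave :: "real \<Rightarrow> real \<Rightarrow> 'n::finite state \<Rightarrow> real \<Rightarrow> 'n state" where
  "standing_wave I \<alpha> \<phi> t = phase (cis (\<alpha> - (1 + I) * t)) \<phi>"

lemma cis_deriv: "((\<lambda>t. cis (\<alpha> - \<omega> * t)) has_vector_derivative - \<i> * of_real \<omega> * cis (\<alpha> - \<omega> * t)) (at t)"
proof -
  have e: "cis (\<alpha> - \<omega> * t) = cis \<alpha> * exp (t *\<^sub>R (- \<i> * of_real \<omega>))" for t
    by (simp add: cis_conv_exp scaleR_conv_of_real exp_add[symmetric] algebra_simps)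
  show ?thesis unfolding e
    by (rule has_vector_derivative_eq_rhs, rule has_vector_derivative_mult_right[OF exp_scaleR_has_vector_derivative_right])
       (simp only: mult_ac)
qed

text \<open>
  Floquet's theorem in explicit form: the fundamental solution is a rotation times the exponential
  of the linearisation in the rotating frame, and the rotation is back to its initial value after
  one period.
\<close>

lemma standing_wave_monodromy:
  fixes \<phi> :: "'n::finite state"
  assumes I: "I > 0"
  shows "is_monodromy_matrix \<epsilon> (2 * pi / (1 + I)) (standing_wave I \<alpha> \<phi>)
     (rmat (phase (cis \<alpha>)) ** mexp (rmat (rot_field I \<epsilon> \<phi>)) (2 * pi / (1 + I)) ** rmat (phase (cis (- \<alpha>))))"
proof -
  define \<omega> where "\<omega> = 1 + I"
  define T where "T = 2 * pi / \<omega>"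
  define c where "c t = cis (\<alpha> - \<omega> * t)" for t
  define B where "B = rmat (rot_field I \<epsilon> \<phi>)"
  define R :: "complex \<Rightarrow> real ^ ('n site + 'n site) ^ ('n site + 'n site)" where "R z = rmat (phase z)" for z
  define \<Phi> where "\<Phi> t = R (c t) ** mexp B t ** R (cis (- \<alpha>))" for t
  have RR: "R z ** R w = R (z * w)" for z w
    unfolding R_def rmat_mult[OF linear_phase linear_phase] by (rule arg_cong[of _ _ rmat]) (simp add: fun_eq_iff vec_eq_iff mult.assoc)
  have R1: "R 1 = mat 1"
    unfolding R_def rmat_id[symmetric] by (rule arg_cong[of _ _ rmat]) (simp add: fun_eq_iff vec_eq_iff)
  have "\<Phi> 0 = mat 1" by (simp add: \<Phi>_def c_def RR cis_mult R1)
  moreover have "(\<Phi> has_vector_derivative jacobian (real_vector_field \<epsilon>) (at (to_real (standing_wave I \<alpha> \<phi> t))) ** \<Phi> t) (at t)" for t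
  proof -
    have cn: "cmod (c t) = 1" by (simp add: c_def)
    have dR: "((\<lambda>t. R (c t)) has_vector_derivative R (- \<i> * of_real \<omega> * c t)) (at t)"
      unfolding R_def c_def by (rule bounded_linear.has_vector_derivative[OF bounded_linear_rmat_phase cis_deriv])
    have "((\<lambda>t. R (c t) ** mexp B t) has_vector_derivative
        R (c t) ** (B ** mexp B t) + R (- \<i> * of_real \<omega> * c t) ** mexp B t) (at t)"
      by (rule bounded_bilinear.has_vector_derivative[OF bounded_bilinear_matrix_mult dR mexp_deriv])
    from bounded_linear.has_vector_derivative[OF bounded_bilinear.bounded_linear_left[OF bounded_bilinear_matrix_mult] this, of "R (cis (- \<alpha>))"]
    have D: "(\<Phi> has_vector_derivative (R (c t) ** (B ** mexp B t) + R (- \<i> * of_real \<omega> * c t) ** mexp B t) ** R (cis (- \<alpha>))) (at t)"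
      by (simp add: \<Phi>_def[abs_def])
    have J: "jacobian (real_vector_field \<epsilon>) (at (to_real (standing_wave I \<alpha> \<phi> t))) = rmat (lin_field \<epsilon> (phase (c t) \<phi>))"
      by (simp add: jacobian_real_vector_field standing_wave_def c_def \<omega>_def)
    \<comment> \<open>The rotation intertwines the linearisations at the wave and at its phase shift; its time derivative supplies the frequency term.\<close>
    have key: "rmat (lin_field \<epsilon> (phase (c t) \<phi>)) ** R (c t) = R (c t) ** B + R (- \<i> * of_real \<omega> * c t)"
    proof -
      have "R (c t) ** B + R (- \<i> * of_real \<omega> * c t)
          = rmat (\<lambda>h. phase (c t) (rot_field I \<epsilon> \<phi> h) + phase (- \<i> * of_real \<omega> * c t) h)"
        unfolding R_def B_def rmat_mult[OF linear_phase linear_rot_field]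
        using linear_compose[OF linear_rot_field linear_phase] by (intro rmat_add linear_phase) (simp add: o_def)
      also have "\<dots> = rmat (\<lambda>h. lin_field \<epsilon> (phase (c t) \<phi>) (phase (c t) h))"
        unfolding lin_field_phase[OF cn]
        by (rule arg_cong[of _ _ rmat]) (simp add: fun_eq_iff vec_eq_iff rot_field_def \<omega>_def algebra_simps)
      finally show ?thesis unfolding R_def rmat_mult[OF linear_lin_field linear_phase] by simp
    qed
    have "rmat (lin_field \<epsilon> (phase (c t) \<phi>)) ** \<Phi> t = (rmat (lin_field \<epsilon> (phase (c t) \<phi>)) ** R (c t)) ** mexp B t ** R (cis (- \<alpha>))"
      by (simp add: \<Phi>_def matrix_mul_assoc)
    also have "\<dots> = (R (c t) ** (B ** mexp B t) + R (- \<i> * of_real \<omega> * c t) ** mexp B t) ** R (cis (- \<alpha>))"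
      unfolding key by (simp add: matrix_mult_add_left matrix_mul_assoc)
    finally show ?thesis using D J by simp
  qed
  moreover have "c T = cis \<alpha>"
  proof -
    have "\<omega> * T = 2 * pi" using I by (simp add: T_def \<omega>_def)
    then show ?thesis by (simp add: c_def complex_eq_iff cos_diff sin_diff)
  qed
  then have "\<Phi> T = R (cis \<alpha>) ** mexp B T ** R (cis (- \<alpha>))" by (simp add: \<Phi>_def)
  ultimately show ?thesis
    unfolding is_monodromy_matrix_def by (intro exI[of _ \<Phi>]) (simp add: T_def \<omega>_def R_def B_def)
qed

lemma rmat_phase_inverse: "rmat (phase (cis a)) ** rmat (phase (cis (- a))) = mat 1"
  unfolding rmat_mult[OF linear_phase linear_phase] rmat_id[symmetric]
  by (rule arg_cong[of _ _ rmat]) (simp add: fun_eq_iff vec_eq_iff mult.assoc[symmetric] cis_mult)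

lemma re_im_from_real: "re_part (from_real x) = (\<chi> j. x $ Inl j)" "im_part (from_real x) = (\<chi> j. x $ Inr j)"
  by (simp_all add: re_part_def im_part_def from_real_def)

lemma rot_matrix_parts:
  assumes "im_part \<phi> = 0"
  shows "(rmat (rot_field I \<epsilon> \<phi>) *v x) $ Inl j = Lm I \<epsilon> \<phi> (\<chi> j. x $ Inr j) $ j"
    "(rmat (rot_field I \<epsilon> \<phi>) *v x) $ Inr j = - Lp I \<epsilon> \<phi> (\<chi> j. x $ Inl j) $ j"
proof -
  have "(rmat (rot_field I \<epsilon> \<phi>) *v x) $ Inl j = re_part (rot_field I \<epsilon> \<phi> (from_real x)) $ j"
    by (simp add: rmat_works[OF linear_rot_field] to_real_def re_part_def)
  then show "(rmat (rot_field I \<epsilon> \<phi>) *v x) $ Inl j = Lm I \<epsilon> \<phi> (\<chi> j. x $ Inr j) $ j"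
    unfolding rot_field_parts[OF assms] re_im_from_real .
  have "(rmat (rot_field I \<epsilon> \<phi>) *v x) $ Inr j = im_part (rot_field I \<epsilon> \<phi> (from_real x)) $ j"
    by (simp add: rmat_works[OF linear_rot_field] to_real_def im_part_def)
  then show "(rmat (rot_field I \<epsilon> \<phi>) *v x) $ Inr j = - Lp I \<epsilon> \<phi> (\<chi> j. x $ Inl j) $ j"
    unfolding rot_field_parts[OF assms] re_im_from_real by simp
qed

lemma cmat_eigenvector_parts:
  assumes "cmat B *v x = \<mu> *s x"
  shows "B *v (\<chi> a. Re (x $ a)) = Re \<mu> *\<^sub>R (\<chi> a. Re (x $ a)) - Im \<mu> *\<^sub>R (\<chi> a. Im (x $ a))"
    "B *v (\<chi> a. Im (x $ a)) = Im \<mu> *\<^sub>R (\<chi> a. Re (x $ a)) + Re \<mu> *\<^sub>R (\<chi> a. Im (x $ a))"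
proof -
  have "(\<Sum>b\<in>UNIV. complex_of_real (B $ a $ b) * x $ b) = \<mu> * x $ a" for a
    using assms by (simp add: vec_eq_iff matrix_vector_mult_def)
  from arg_cong[OF this, of Re] arg_cong[OF this, of Im]
  show "B *v (\<chi> a. Re (x $ a)) = Re \<mu> *\<^sub>R (\<chi> a. Re (x $ a)) - Im \<mu> *\<^sub>R (\<chi> a. Im (x $ a))"
    "B *v (\<chi> a. Im (x $ a)) = Im \<mu> *\<^sub>R (\<chi> a. Re (x $ a)) + Re \<mu> *\<^sub>R (\<chi> a. Im (x $ a))"
    by (simp_all add: vec_eq_iff matrix_vector_mult_def algebra_simps)
qed

text \<open>
  For an eigenvector (u, v) of the linearisation with eigenvalue nu, the block equations give
  Lm Lp u = -nu^2 u, and u is nonzero if nu is.  So nu^2 is real and nonpositive.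
\<close>

lemma standing_wave_stable:
  fixes \<phi> :: "'n::finite state"
  assumes I: "I > 0" and T: "T = 2 * pi / (1 + I)" and real: "im_part \<phi> = 0"
    and spec: "\<And>p1 p2 l1 l2. Lm I \<epsilon> \<phi> (Lp I \<epsilon> \<phi> p1) = - (l1 *\<^sub>R p1 - l2 *\<^sub>R p2) \<Longrightarrow>
     Lm I \<epsilon> \<phi> (Lp I \<epsilon> \<phi> p2) = - (l1 *\<^sub>R p2 + l2 *\<^sub>R p1) \<Longrightarrow> p1 \<noteq> 0 \<or> p2 \<noteq> 0 \<Longrightarrow> l2 = 0 \<and> l1 \<le> 0"
  shows "linearly_stable \<epsilon> T (standing_wave I \<alpha> \<phi>)"
proof -
  let ?B = "rmat (rot_field I \<epsilon> \<phi>)"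
  have lin: "linear (Lm I \<epsilon> \<phi>)" "linear (Lp I \<epsilon> \<phi>)" unfolding Lm_def Lp_def by (rule linear_ring_op)+
  have imag: "Re \<nu> = 0" if ev: "is_complex_eigenvalue ?B \<nu>" for \<nu>
  proof (rule ccontr)
    assume nz: "Re \<nu> \<noteq> 0"
    obtain x where x: "x \<noteq> 0" "cmat ?B *v x = \<nu> *s x" using ev by (auto simp: is_complex_eigenvalue_def)
    define a b where "a = Re \<nu>" and "b = Im \<nu>"
    define u1 u2 v1 v2 :: "real ^ 'n site"
      where "u1 = (\<chi> j. Re (x $ Inl j))" and "u2 = (\<chi> j. Im (x $ Inl j))"
        and "v1 = (\<chi> j. Re (x $ Inr j))" and "v2 = (\<chi> j. Im (x $ Inr j))"
    note eqs = cmat_eigenvector_parts[OF x(2)]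
    have m1: "Lm I \<epsilon> \<phi> v1 = a *\<^sub>R u1 - b *\<^sub>R u2"
      using arg_cong[OF eqs(1), of "\<lambda>y. y $ Inl j" for j] by (simp add: vec_eq_iff rot_matrix_parts[OF real] u1_def u2_def v1_def a_def b_def)
    have m2: "Lm I \<epsilon> \<phi> v2 = b *\<^sub>R u1 + a *\<^sub>R u2"
      using arg_cong[OF eqs(2), of "\<lambda>y. y $ Inl j" for j] by (simp add: vec_eq_iff rot_matrix_parts[OF real] u1_def u2_def v2_def a_def b_def)
    have p1: "Lp I \<epsilon> \<phi> u1 = - (a *\<^sub>R v1 - b *\<^sub>R v2)"
    proof -
      have "- Lp I \<epsilon> \<phi> u1 = (a *\<^sub>R v1 - b *\<^sub>R v2)"
        using arg_cong[OF eqs(1), of "\<lambda>y. y $ Inr j" for j]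
        by (simp add: vec_eq_iff rot_matrix_parts[OF real] u1_def v1_def v2_def a_def b_def)
      then show ?thesis by (metis minus_minus)
    qed
    have p2: "Lp I \<epsilon> \<phi> u2 = - (b *\<^sub>R v1 + a *\<^sub>R v2)"
    proof -
      have "- Lp I \<epsilon> \<phi> u2 = (b *\<^sub>R v1 + a *\<^sub>R v2)"
        using arg_cong[OF eqs(2), of "\<lambda>y. y $ Inr j" for j]
        by (simp add: vec_eq_iff rot_matrix_parts[OF real] u2_def v1_def v2_def a_def b_def)
      then show ?thesis by (metis minus_minus)
    qed
    have "Lm I \<epsilon> \<phi> (Lp I \<epsilon> \<phi> u1) = - ((a\<^sup>2 - b\<^sup>2) *\<^sub>R u1 - (2 * a * b) *\<^sub>R u2)"
      unfolding p1 linear_neg[OF lin(1)] linear_diff[OF lin(1)] linear_scale[OF lin(1)] m1 m2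
      by (simp add: vec_eq_iff algebra_simps power2_eq_square)
    moreover have "Lm I \<epsilon> \<phi> (Lp I \<epsilon> \<phi> u2) = - ((a\<^sup>2 - b\<^sup>2) *\<^sub>R u2 + (2 * a * b) *\<^sub>R u1)"
      unfolding p2 linear_neg[OF lin(1)] linear_add[OF lin(1)] linear_scale[OF lin(1)] m1 m2
      by (simp add: vec_eq_iff algebra_simps power2_eq_square)
    moreover have "u1 \<noteq> 0 \<or> u2 \<noteq> 0"
    proof (rule ccontr)
      assume "\<not> (u1 \<noteq> 0 \<or> u2 \<noteq> 0)"
      then have z: "u1 = 0" "u2 = 0" by auto
      have "a *\<^sub>R v1 - b *\<^sub>R v2 = 0" "b *\<^sub>R v1 + a *\<^sub>R v2 = 0"
        using arg_cong[OF p1, of uminus] arg_cong[OF p2, of uminus]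
        unfolding z linear_0[OF lin(2)] minus_minus minus_zero by (simp_all only:)
      then have e: "a * v1 $ j = b * v2 $ j" "b * v1 $ j = - (a * v2 $ j)" for j
        by (simp_all add: vec_eq_iff eq_neg_iff_add_eq_0)
      have "v1 $ j = 0 \<and> v2 $ j = 0" for j
      proof -
        have "(a * a + b * b) * v1 $ j = a * (a * v1 $ j) + b * (b * v1 $ j)" by (simp add: algebra_simps)
        also have "\<dots> = 0" unfolding e by (simp add: algebra_simps)
        finally have "v1 $ j = 0" using nz by (simp add: a_def add_nonneg_eq_0_iff)
        then show ?thesis using e(2)[of j] nz by (simp add: a_def)
      qed
      then have "x $ k = 0" for k
        using z by (cases k) (auto simp: u1_def u2_def v1_def v2_def vec_eq_iff complex_eq_iff)
      then show False using x(1) by (simp add: vec_eq_iff)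
    qed
    ultimately have "2 * a * b = 0 \<and> a\<^sup>2 - b\<^sup>2 \<le> 0" by (rule spec)
    then show False using nz by (auto simp: a_def)
  qed
  have "cmod \<mu> = 1" if "is_complex_eigenvalue (rmat (phase (cis \<alpha>)) ** mexp ?B T ** rmat (phase (cis (- \<alpha>)))) \<mu>" for \<mu>
  proof -
    have "is_complex_eigenvalue (mexp ?B T) \<mu>"
      using eigenvalue_conj[OF _ that] rmat_phase_inverse[of \<alpha>] rmat_phase_inverse[of "- \<alpha>"] by simp
    then obtain \<nu> where "is_complex_eigenvalue ?B \<nu>" "\<mu> = exp (\<nu> * of_real T)" by (rule mexp_eigenvalue)
    then show ?thesis using imag by simp
  qed
  then show ?thesis
    unfolding linearly_stable_def T using standing_wave_monodromy[OF I] by blast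
qed

lemma standing_wave_unstable:
  fixes \<phi> :: "'n::finite state"
  assumes I: "I > 0" and T: "T = 2 * pi / (1 + I)" and real: "im_part \<phi> = 0"
    and eig: "Lm I \<epsilon> \<phi> v = l *\<^sub>R u" "Lp I \<epsilon> \<phi> u = - (l *\<^sub>R v)" "v \<noteq> 0" "l > 0"
  shows "linearly_unstable \<epsilon> T (standing_wave I \<alpha> \<phi>)"
proof -
  let ?B = "rmat (rot_field I \<epsilon> \<phi>)"
  let ?P = "rmat (phase (cis \<alpha>) :: 'n state \<Rightarrow> 'n state)" and ?Q = "rmat (phase (cis (- \<alpha>)) :: 'n state \<Rightarrow> 'n state)"
  define y where "y = (\<chi> k. case k of Inl j \<Rightarrow> u $ j | Inr j \<Rightarrow> v $ j)"
  define x where "x = (\<chi> k. complex_of_real (y $ k))"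
  have "?B *v y = l *\<^sub>R y"
  proof -
    have "(?B *v y) $ k = (l *\<^sub>R y) $ k" for k
      by (cases k) (simp_all add: rot_matrix_parts[OF real] y_def eig)
    then show ?thesis by (simp add: vec_eq_iff)
  qed
  then have "cmat ?B *v x = of_real l *s x"
    by (simp add: x_def vec_eq_iff matrix_vector_mult_def flip: of_real_mult of_real_sum)
  then have E: "cmat (mexp ?B T) *v x = exp (of_real l * of_real T) *s x" by (rule mexp_eigenvector)
  have x0: "x \<noteq> 0"
  proof
    assume "x = 0"
    then have "y $ Inr j = 0" for j by (simp add: x_def vec_eq_iff)
    then show False using eig(3) by (simp add: y_def vec_eq_iff)
  qed
  have Q: "?Q ** ?P = mat 1" "?P ** ?Q = mat 1"
    using rmat_phase_inverse[of \<alpha>] rmat_phase_inverse[of "- \<alpha>"] by simp_all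
  have "is_complex_eigenvalue (mexp ?B T) (exp (of_real l * of_real T))"
    using E x0 by (auto simp: is_complex_eigenvalue_def)
  moreover have "mexp ?B T = ?Q ** (?P ** mexp ?B T ** ?Q) ** ?P"
    by (metis Q(1) matrix_mul_assoc matrix_mul_lid matrix_mul_rid)
  ultimately have "is_complex_eigenvalue (?P ** mexp ?B T ** ?Q) (exp (of_real l * of_real T))"
    using eigenvalue_conj[OF Q(2), of "?P ** mexp ?B T ** ?Q"] Q(1) by metis
  moreover have "T > 0" using I T by simp
  then have "cmod (exp (of_real l * of_real T)) > 1" using eig(4) by simp
  ultimately show ?thesis
    unfolding linearly_unstable_def T using standing_wave_monodromy[OF I] by blast
qed

section \<open>Zeros depending on a parameter\<close>

text \<open>
  Apply Brouwer's theorem to the simplified Newton map z - B F(z,p), where B inverts the derivative at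
  (z0,p0).  The derivative controls this map on a small ball for p = p0, and uniform continuity on a compact
  set does the rest.
\<close>

lemma brouwer_implicit_zero:
  fixes F :: "'a::euclidean_space \<Rightarrow> 'p::euclidean_space \<Rightarrow> 'a"
  assumes cont: "continuous_on UNIV (\<lambda>(z, p). F z p)"
    and zero: "F z0 p0 = 0"
    and deriv: "((\<lambda>z. F z p0) has_derivative A) (at z0)"
    and inj: "\<And>z. A z = 0 \<Longrightarrow> z = 0"
    and "r > 0"
  shows "\<forall>\<^sub>F p in nhds p0. \<exists>z\<in>cball z0 r. F z p = 0"
proof -
  have linA: "linear A" using deriv by (rule has_derivative_linear)
  have "inj A" using linA inj by (simp add: linear_injective_0)
  then obtain B where B: "linear B" "B \<circ> A = id"
    using linear_injective_left_inverse[OF linA] by blast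
  have "surj B" using B(2) by (metis comp_apply id_apply surjI)
  then have "inj B" using B(1) linear_surjective_imp_injective by blast
  then have B0: "B x = 0 \<Longrightarrow> x = 0" for x using B(1) linear_injective_0 by blast
  obtain b where b: "b > 0" "\<And>x. norm (B x) \<le> b * norm x"
    using linear_bounded_pos[OF B(1)] by blast
  obtain d where d: "d > 0"
    "\<And>y. norm (y - z0) < d \<Longrightarrow> norm (F y p0 - A (y - z0)) \<le> 1 / (2 * b) * norm (y - z0)"
    using deriv b(1) unfolding has_derivative_at_alt zero
    by (metis diff_zero divide_pos_pos zero_less_mult_iff zero_less_numeral zero_less_one)
  define s where "s = min r (d / 2)"
  have s: "s > 0" "s \<le> r" "s < d" using \<open>r > 0\<close> d(1) by (auto simp: s_def)
  have "uniformly_continuous_on (cball z0 s \<times> cball p0 1) (\<lambda>(z, p). F z p)"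
    by (intro compact_uniformly_continuous continuous_on_subset[OF cont] compact_Times) auto
  moreover have "s / (2 * b) > 0" using s b by simp
  ultimately obtain e where e: "e > 0" "\<And>z p z' p'. \<lbrakk>z \<in> cball z0 s; p \<in> cball p0 1; z' \<in> cball z0 s;
      p' \<in> cball p0 1; dist (z', p') (z, p) < e\<rbrakk> \<Longrightarrow> dist (F z' p') (F z p) < s / (2 * b)"
    unfolding uniformly_continuous_on_def by (fastforce simp: split_beta)
  have "\<exists>z\<in>cball z0 r. F z p = 0" if p: "dist p p0 < min e 1" for p
  proof -
    define g where "g z = z - B (F z p)" for z
    have near: "norm (F z p - F z p0) < s / (2 * b)" if "z \<in> cball z0 s" for z
      using e(2)[of z p0 z p] that p by (auto simp: dist_Pair_Pair dist_norm norm_minus_commute)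
    have contF: "continuous_on (cball z0 s) (\<lambda>z. F z p)"
    proof -
      have "continuous_on (cball z0 s) ((\<lambda>(z, p). F z p) \<circ> (\<lambda>z. (z, p)))"
        by (intro continuous_on_compose continuous_intros continuous_on_subset[OF cont]) auto
      then show ?thesis by (simp add: o_def)
    qed
    have contg: "continuous_on (cball z0 s) g"
      unfolding g_def
      by (intro continuous_intros linear_continuous_on_compose[OF contF B(1)])
    have "g ` cball z0 s \<subseteq> cball z0 s"
    proof safe
      fix z assume z: "z \<in> cball z0 s"
      have BA: "B (A x) = x" for x using B(2) by (metis comp_apply id_apply)
      have "g z - z0 = - B (F z p - A (z - z0))"
        by (simp add: g_def linear_diff[OF B(1)] BA)
      then have "norm (g z - z0) \<le> b * norm (F z p - A (z - z0))" using b(2) by simp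
      also have "norm (F z p - A (z - z0)) \<le> norm (F z p - F z p0) + norm (F z p0 - A (z - z0))"
        by (metis norm_diff_triangle_ineq diff_add_cancel add_diff_cancel_right' add_diff_eq order_refl norm_triangle_ineq)
      also have "\<dots> \<le> s / (2 * b) + 1 / (2 * b) * s"
      proof (rule add_mono)
        show "norm (F z p - F z p0) \<le> s / (2 * b)" using near[OF z] by simp
        have n: "norm (z - z0) \<le> s" using z by (simp add: dist_norm norm_minus_commute)
        then have "norm (F z p0 - A (z - z0)) \<le> 1 / (2 * b) * norm (z - z0)"
          using d(2)[of z] s by auto
        also have "\<dots> \<le> 1 / (2 * b) * s" using n b(1) by (intro mult_left_mono) auto
        finally show "norm (F z p0 - A (z - z0)) \<le> 1 / (2 * b) * s" .
      qed
      finally have "norm (g z - z0) \<le> b * (s / (2 * b) + 1 / (2 * b) * s)" using b(1) by simp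
      also have "\<dots> = s" using b(1) by (simp add: field_simps)
      finally show "g z \<in> cball z0 s" by (simp add: dist_norm norm_minus_commute)
    qed
    then obtain z where z: "z \<in> cball z0 s" "g z = z"
      using brouwer_ball[OF s(1) contg] by blast
    then have "F z p = 0" using B0 by (simp add: g_def)
    then show ?thesis using z s by auto
  qed
  moreover have "\<forall>\<^sub>F p in nhds p0. dist p p0 < min e 1"
    using e(1) by (auto simp: eventually_nhds_metric intro!: exI[of _ "min e 1"])
  ultimately show ?thesis by (auto elim: eventually_mono)
qed

text \<open>
  The zeros near z0 need not be unique; choosing one that is nearly closest to z0 makes the choice
  convergent.
\<close>

lemma convergent_selection:
  fixes P :: "'a::metric_space \<Rightarrow> real \<Rightarrow> bool"
  assumes ev: "\<And>r. r > 0 \<Longrightarrow> \<forall>\<^sub>0\<epsilon>. \<exists>z\<in>cball z0 r. P z \<epsilon>"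
  shows "\<exists>\<zeta>. (\<forall>\<^sub>0\<epsilon>. P (\<zeta> \<epsilon>) \<epsilon>) \<and> (\<zeta> \<longlongrightarrow> z0) (at_right 0)"
proof -
  define m where "m \<epsilon> = (INF z\<in>{z. P z \<epsilon>}. dist z0 z)" for \<epsilon>
  define \<zeta> where "\<zeta> \<epsilon> = (SOME z. P z \<epsilon> \<and> dist z0 z < m \<epsilon> + \<epsilon>)" for \<epsilon>
  have bdd: "bdd_below (dist z0 ` A)" for A by (rule bdd_belowI[of _ 0]) auto
  have ex: "\<exists>z. P z \<epsilon> \<and> dist z0 z < m \<epsilon> + \<epsilon>" if "\<epsilon> > 0" "P z \<epsilon>" for \<epsilon> z
  proof -
    have "m \<epsilon> < m \<epsilon> + \<epsilon>" using that by simp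
    then show ?thesis unfolding m_def
      by (subst (asm) cINF_less_iff) (use that bdd in \<open>auto simp: m_def\<close>)
  qed
  have \<zeta>: "P (\<zeta> \<epsilon>) \<epsilon> \<and> dist z0 (\<zeta> \<epsilon>) < m \<epsilon> + \<epsilon>" if "\<epsilon> > 0" "P z \<epsilon>" for \<epsilon> z
    unfolding \<zeta>_def by (rule someI_ex) (rule ex[OF that])
  have pos: "\<forall>\<^sub>0\<epsilon>. \<epsilon> > 0" by (simp add: eventually_at_right_less)
  have 1: "\<forall>\<^sub>0\<epsilon>. P (\<zeta> \<epsilon>) \<epsilon>"
    using ev[OF zero_less_one] pos by eventually_elim (use \<zeta> in auto)
  have "(\<zeta> \<longlongrightarrow> z0) (at_right 0)"
  proof (rule tendstoI)
    fix e :: real assume "e > 0"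
    then have "\<forall>\<^sub>0\<epsilon>. \<exists>z\<in>cball z0 (e/2). P z \<epsilon>" by (intro ev) simp
    moreover have "\<forall>\<^sub>0\<epsilon>. \<epsilon> < e / 2"
      using \<open>e > 0\<close> by (intro eventually_at_rightI[of 0 "e/2"]) auto
    ultimately show "\<forall>\<^sub>0\<epsilon>. dist (\<zeta> \<epsilon>) z0 < e" using pos
    proof eventually_elim
      case (elim \<epsilon>)
      then obtain z where z: "P z \<epsilon>" "dist z0 z \<le> e / 2" by auto
      have "m \<epsilon> \<le> dist z0 z" unfolding m_def using z by (intro cINF_lower bdd) auto
      then show ?case using \<zeta>[of \<epsilon> z] z elim by (auto simp: dist_commute)
    qed
  qed
  with 1 show ?thesis by blast
qed

section \<open>Existence of standing waves and growing modes\<close>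

lemma continuous_on_fixed_if:
  "(b \<Longrightarrow> continuous_on A f) \<Longrightarrow> (\<not> b \<Longrightarrow> continuous_on A g) \<Longrightarrow> continuous_on A (\<lambda>x. if b then f x else g x)"
  by (cases b) simp_all

lemma has_derivative_component:
  "(f has_derivative f') F \<Longrightarrow> ((\<lambda>x. f x $ j) has_derivative (\<lambda>h. f' h $ j)) F"
  by (rule bounded_linear.has_derivative[OF bounded_linear_vec_nth])

lemma eventually_at_right_nhds: "eventually P (nhds (0::real)) \<Longrightarrow> eventually P (at_right 0)"
  using at_within_le_nhds filter_leD by blast

text \<open>
  At zero coupling the real standing wave equation decouples into x (x^2 - I) = 0, whose three
  roots are simple.
\<close>

lemma stationary_family_exists:
  fixes \<sigma> :: "'n::finite site \<Rightarrow> real"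
  assumes I: "I > 0" and \<sigma>: "\<And>j. \<sigma> j \<in> {0, 1, -1}"
  shows "\<exists>\<phi> :: real \<Rightarrow> 'n state. (\<forall>\<^sub>0\<epsilon>. stationary I \<epsilon> (\<phi> \<epsilon>))
     \<and> (\<phi> \<longlongrightarrow> (\<chi> j. of_real (\<sigma> j * sqrt I))) (at_right 0)"
proof -
  define F :: "real ^ 'n site \<Rightarrow> real \<Rightarrow> real ^ 'n site"
    where "F x \<epsilon> = (\<chi> j. ((x $ j)\<^sup>2 - I) * x $ j + 2 * \<epsilon> * ((x $ j - x $ (j+1)) ^ 3 + (x $ j - x $ (j-1)) ^ 3))" for x \<epsilon>
  define x0 :: "real ^ 'n site" where "x0 = (\<chi> j. \<sigma> j * sqrt I)"
  have x0: "(x0 $ j)\<^sup>2 = (\<sigma> j)\<^sup>2 * I" for j using I by (simp add: x0_def power_mult_distrib)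
  have s2: "(\<sigma> j)\<^sup>2 * I = 0 \<and> \<sigma> j = 0 \<or> (\<sigma> j)\<^sup>2 * I = I" for j using \<sigma>[of j] by auto
  have ev: "\<forall>\<^sub>0\<epsilon>. \<exists>x\<in>cball x0 r. F x \<epsilon> = 0" if "r > 0" for r
  proof (rule eventually_at_right_nhds, rule brouwer_implicit_zero)
    show "continuous_on UNIV (\<lambda>(x, \<epsilon>). F x \<epsilon>)"
      unfolding F_def split_beta by (intro continuous_on_vec_lambda continuous_on_component continuous_intros)
    show "F x0 0 = 0" using s2 by (auto simp: F_def vec_eq_iff x0) (auto simp: x0_def)
    show "((\<lambda>x. F x 0) has_derivative (\<lambda>h. \<chi> j. (3 * (x0 $ j)\<^sup>2 - I) * h $ j)) (at x0)"
    proof (rule has_derivative_vec_componentwise)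
      fix j
      have "((\<lambda>x. ((x $ j)\<^sup>2 - I) * x $ j) has_derivative (\<lambda>h. (3 * (x0 $ j)\<^sup>2 - I) * h $ j)) (at x0)"
        by (auto intro!: derivative_eq_intros has_derivative_nth simp: power2_eq_square algebra_simps)
      then show "((\<lambda>x. F x 0 $ j) has_derivative (\<lambda>h. (\<chi> j. (3 * (x0 $ j)\<^sup>2 - I) * h $ j) $ j)) (at x0)"
        by (simp add: F_def)
    qed
    fix h assume h: "(\<chi> j. (3 * (x0 $ j)\<^sup>2 - I) * h $ j) = (0 :: real ^ 'n site)"
    have "h $ j = 0" for j
    proof -
      have "(3 * ((\<sigma> j)\<^sup>2 * I) - I) * h $ j = 0" 
        using arg_cong[OF h, of "\<lambda>y. y $ j"] by (simp only: vec_lambda_beta x0 zero_index)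
      moreover have "3 * ((\<sigma> j)\<^sup>2 * I) - I \<noteq> 0" using s2[of j] I by auto
      ultimately show ?thesis by simp
    qed
    then show "h = 0" by (simp add: vec_eq_iff)
  qed (rule that)
  obtain x where x: "\<forall>\<^sub>0\<epsilon>. F (x \<epsilon>) \<epsilon> = 0" "(x \<longlongrightarrow> x0) (at_right 0)"
    using convergent_selection[of x0 "\<lambda>x \<epsilon>. F x \<epsilon> = 0", OF ev] by blast
  define \<phi> :: "real \<Rightarrow> 'n state" where "\<phi> \<epsilon> = (\<chi> j. of_real (x \<epsilon> $ j))" for \<epsilon>
  have cubic_real: "cubic (of_real a - of_real b) = of_real ((a - b) ^ 3)" for a b
    unfolding of_real_diff[symmetric] cubic_def norm_of_real power2_abs
    by (simp add: power2_eq_square power3_eq_cube)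
  have "\<forall>\<^sub>0\<epsilon>. stationary I \<epsilon> (\<phi> \<epsilon>)"
    using x(1)
  proof eventually_elim
    case (elim \<epsilon>)
    have "complex_of_real (F (x \<epsilon>) \<epsilon> $ j) = 0" for j using elim by simp
    then show ?case
      unfolding stationary_def coupling_def \<phi>_def vec_lambda_beta cubic_real norm_of_real power2_abs
      by (simp add: F_def)
  qed
  moreover have "(\<phi> \<longlongrightarrow> (\<chi> j. of_real (\<sigma> j * sqrt I))) (at_right 0)"
  proof -
    have "((\<lambda>\<epsilon>. \<chi> j. complex_of_real (x \<epsilon> $ j)) \<longlongrightarrow> (\<chi> j. of_real (x0 $ j))) (at_right 0)"
      by (intro tendsto_vec_lambda tendsto_of_real tendsto_vec_nth x(2))
    then show ?thesis by (simp add: \<phi>_def[abs_def] x0_def)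
  qed
  ultimately show ?thesis by blast
qed

context standing_wave_family
begin

text \<open>
  The limit of phi_j (Lm v)_j / eps at a core site, up to the factor 2 I sqrt I; the standing wave
  equation has been used to eliminate the potential.
\<close>

definition core_form :: "real ^ 'n site \<Rightarrow> 'n site \<Rightarrow> real" where
  "core_form v j = (\<sigma> (j+1) - \<sigma> j)\<^sup>2 * (v $ j * \<sigma> (j+1) - v $ (j+1) * \<sigma> j)
     + (\<sigma> j - \<sigma> (j-1))\<^sup>2 * (v $ j * \<sigma> (j-1) - v $ (j-1) * \<sigma> j)"

text \<open>
  With exponent sqrt eps n and u of order sqrt eps, the equations for a growing mode, after
  division by eps on the core, are polynomial in the unknowns (v, u, n) and in the parameters
  (x, eps), x being the wave.  At eps = 0 they reduce to the three-site eigenvalue problem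
  4 core_form V + sigma k V = 0 with n^2 = k I^2, and the derivative is injective exactly if the
  bordered three-site system, which expresses simplicity of the eigenvalue, has only the zero
  solution.
\<close>

lemma ev_growing_mode_of_simple_eigenvalue:
  assumes real: "\<forall>\<^sub>0\<epsilon>. im_part (\<phi> \<epsilon>) = 0"
    and V: "V \<noteq> 0" "\<And>j. j \<notin> S \<Longrightarrow> V $ j = 0"
    and k: "k > 0" "\<And>j. j \<in> S \<Longrightarrow> 4 * core_form V j + \<sigma> j * (k * V $ j) = 0"
    and simple: "\<And>h y. \<lbrakk>\<And>j. j \<notin> S \<Longrightarrow> h $ j = 0;
        \<And>j. j \<in> S \<Longrightarrow> 4 * core_form h j + \<sigma> j * (k * h $ j + 2 * y * V $ j) = 0; V \<bullet> h = 0\<rbrakk> \<Longrightarrow> h = 0 \<and> y = 0"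
  shows "\<forall>\<^sub>0\<epsilon>. \<exists>u v l. LM \<epsilon> v = l *\<^sub>R u \<and> LP \<epsilon> u = - (l *\<^sub>R v) \<and> v \<noteq> 0 \<and> l > 0"
proof -
  define r where "r = sqrt I"
  have r: "r > 0" "r\<^sup>2 = I" "r * r = I" using I_pos by (simp_all add: r_def)
  \<comment> \<open>From n^2 = k I^2; the second component follows from 2 I u + n v = 0 on the core.\<close>
  define n0 where "n0 = I * sqrt k"
  have n0: "n0 > 0" "n0 * n0 = k * I\<^sup>2" using I_pos k(1) by (simp_all add: n0_def power2_eq_square)
  define U where "U = (- n0 / (2 * I)) *\<^sub>R V"
  define z0 where "z0 = (V, U, n0)"
  define x0 :: "real ^ 'n site" where "x0 = (\<chi> j. \<sigma> j * r)"
  define w where "w x j = (x $ (j+1) - x $ j)\<^sup>2" for x :: "real ^ 'n site" and j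
  define F1 where "F1 v u n x \<epsilon> = (\<chi> j. if j \<in> S then
        2 * (w x j * (v $ j * x $ (j+1) - v $ (j+1) * x $ j) + w x (j-1) * (v $ j * x $ (j-1) - v $ (j-1) * x $ j)) - n * x $ j * u $ j
      else ((x $ j)\<^sup>2 - I) * v $ j + 2 * \<epsilon> * (w x j * (v $ j - v $ (j+1)) + w x (j-1) * (v $ j - v $ (j-1))) - \<epsilon> * n * u $ j)"
    for v u x :: "real ^ 'n site" and n \<epsilon> :: real
  define F2 where "F2 v u n x \<epsilon> = (\<chi> j. (3 * (x $ j)\<^sup>2 - I) * u $ j
      + 6 * \<epsilon> * (w x j * (u $ j - u $ (j+1)) + w x (j-1) * (u $ j - u $ (j-1))) + n * v $ j)"
    for v u x :: "real ^ 'n site" and n \<epsilon> :: real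
  define F where "F z p = (F1 (fst z) (fst (snd z)) (snd (snd z)) (fst p) (snd p),
      F2 (fst z) (fst (snd z)) (snd (snd z)) (fst p) (snd p), V \<bullet> fst z - V \<bullet> V)"
    for z :: "(real ^ 'n site) \<times> (real ^ 'n site) \<times> real" and p :: "(real ^ 'n site) \<times> real"
  define p0 :: "(real ^ 'n site) \<times> real" where "p0 = (x0, 0)"
  have sg: "(\<sigma> j)\<^sup>2 = (if j \<in> S then 1 else 0)" for j using sign[of j] sign_off[of j] by auto
  have x0sq: "(x0 $ j)\<^sup>2 = (if j \<in> S then I else 0)" for j
    using sg[of j] by (simp add: x0_def power_mult_distrib r)
  have base1: "F1 v u n x0 0 = (\<chi> j. if j \<in> S then r * (2 * I * core_form v j - n * \<sigma> j * u $ j) else - I * v $ j)" for v u n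
  proof -
    have "2 * (w x0 j * (v $ j * x0 $ (j+1) - v $ (j+1) * x0 $ j) + w x0 (j-1) * (v $ j * x0 $ (j-1) - v $ (j-1) * x0 $ j)) - n * x0 $ j * u $ j
      = r * (2 * (r * r) * core_form v j - n * \<sigma> j * u $ j)" for j
      by (simp add: w_def x0_def core_form_def power2_eq_square algebra_simps)
    then show ?thesis by (simp add: F1_def vec_eq_iff r x0sq)
  qed
  have base2: "F2 v u n x0 0 = (\<chi> j. (if j \<in> S then 2 * I else - I) * u $ j + n * v $ j)" for v u n
    by (simp add: F2_def vec_eq_iff x0sq)
  define A1 where "A1 h = (\<chi> j. if j \<in> S then r * (2 * I * core_form (fst h) j - \<sigma> j * (n0 * fst (snd h) $ j + snd (snd h) * U $ j))
      else - I * fst h $ j)" for h :: "(real ^ 'n site) \<times> (real ^ 'n site) \<times> real"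
  define A2 where "A2 h = (\<chi> j. (if j \<in> S then 2 * I else - I) * fst (snd h) $ j + (n0 * fst h $ j + snd (snd h) * V $ j))"
    for h :: "(real ^ 'n site) \<times> (real ^ 'n site) \<times> real"
  define A where "A h = (A1 h, A2 h, V \<bullet> fst h)" for h :: "(real ^ 'n site) \<times> (real ^ 'n site) \<times> real"
  have "\<forall>\<^sub>F p in nhds p0. \<exists>z\<in>cball z0 (n0 / 2). F z p = 0"
  proof (rule brouwer_implicit_zero)
    show "continuous_on UNIV (\<lambda>(z, p). F z p)"
      unfolding F_def F1_def F2_def w_def split_beta
      by (intro continuous_on_Pair continuous_on_vec_lambda continuous_on_fixed_if continuous_on_component continuous_intros)
    show "F z0 p0 = 0"
    proof -
      have "r * (2 * I * core_form V j - n0 * \<sigma> j * U $ j) = 0" if "j \<in> S" for j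
      proof -
        have "2 * I * core_form V j - n0 * \<sigma> j * U $ j = 2 * I * core_form V j + (n0 * n0) / (2 * I) * \<sigma> j * V $ j"
          by (simp add: U_def)
        also have "\<dots> = I / 2 * (4 * core_form V j + \<sigma> j * (k * V $ j))"
          unfolding n0(2) using I_pos by (simp add: field_simps power2_eq_square)
        also have "\<dots> = 0" using k(2)[OF that] by simp
        finally show ?thesis by simp
      qed
      then have "F1 V U n0 x0 0 = 0" unfolding base1 using V(2) by (simp add: vec_eq_iff)
      moreover have "F2 V U n0 x0 0 = 0" unfolding base2 using V(2) I_pos by (simp add: vec_eq_iff U_def)
      ultimately show ?thesis by (simp add: F_def z0_def p0_def zero_prod_def)
    qed
    show "((\<lambda>z. F z p0) has_derivative A) (at z0)"
    proof -
      have cf: "((\<lambda>z. core_form (fst z) j) has_derivative (\<lambda>h. core_form (fst h) j)) (at z0)" for j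
        unfolding core_form_def
        by (auto intro!: derivative_eq_intros has_derivative_component)
      have d1: "((\<lambda>z. F1 (fst z) (fst (snd z)) (snd (snd z)) x0 0) has_derivative A1) (at z0)"
      proof (rule has_derivative_vec_componentwise)
        fix j
        show "((\<lambda>z. F1 (fst z) (fst (snd z)) (snd (snd z)) x0 0 $ j) has_derivative (\<lambda>h. A1 h $ j)) (at z0)"
        proof (cases "j \<in> S")
          case True
          have "((\<lambda>z. r * (2 * I * core_form (fst z) j - snd (snd z) * \<sigma> j * fst (snd z) $ j)) has_derivative
              (\<lambda>h. r * (2 * I * core_form (fst h) j - \<sigma> j * (n0 * fst (snd h) $ j + snd (snd h) * U $ j)))) (at z0)"
            unfolding z0_def
            by (auto intro!: derivative_eq_intros cf[unfolded z0_def] has_derivative_component simp: algebra_simps)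
          then show ?thesis by (simp add: base1 A1_def True)
        next
          case False
          have "((\<lambda>z. - I * fst z $ j) has_derivative (\<lambda>h. - I * fst h $ j)) (at z0)"
            by (auto intro!: derivative_eq_intros has_derivative_component)
          then show ?thesis by (simp add: base1 A1_def False)
        qed
      qed
      have d2: "((\<lambda>z. F2 (fst z) (fst (snd z)) (snd (snd z)) x0 0) has_derivative A2) (at z0)"
      proof (rule has_derivative_vec_componentwise)
        fix j
        have "((\<lambda>z. (if j \<in> S then 2 * I else - I) * fst (snd z) $ j + snd (snd z) * fst z $ j) has_derivative
          (\<lambda>h. (if j \<in> S then 2 * I else - I) * fst (snd h) $ j + (n0 * fst h $ j + snd (snd h) * V $ j))) (at z0)"
          by (rule has_derivative_add, auto intro!: derivative_eq_intros has_derivative_component simp: z0_def algebra_simps)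
        then show "((\<lambda>z. F2 (fst z) (fst (snd z)) (snd (snd z)) x0 0 $ j) has_derivative (\<lambda>h. A2 h $ j)) (at z0)"
          by (simp add: base2 A2_def)
      qed
      have d3: "((\<lambda>z. V \<bullet> fst z - V \<bullet> V) has_derivative (\<lambda>h. V \<bullet> fst h)) (at z0)"
        by (auto intro!: derivative_eq_intros)
      show ?thesis unfolding F_def A_def p0_def fst_conv snd_conv by (intro has_derivative_Pair d1 d2 d3)
    qed
    fix q assume "A q = 0"
    then obtain h g m where q: "q = (h, g, m)" and a1: "A1 (h, g, m) = 0" and a2: "A2 (h, g, m) = 0" and a3: "V \<bullet> h = 0"
      by (cases q) (auto simp: A_def zero_prod_def)
    have off: "h $ j = 0" if "j \<notin> S" for j
      using arg_cong[OF a1, of "\<lambda>y. y $ j"] that I_pos by (simp add: A1_def)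
    have g: "(if j \<in> S then 2 * I else - I) * g $ j = - (n0 * h $ j + m * V $ j)" for j
      using arg_cong[OF a2, of "\<lambda>y. y $ j"] unfolding A2_def by (simp add: eq_neg_iff_add_eq_0 del: mult_minus_left)
    have "h = 0 \<and> n0 * m / I\<^sup>2 = 0"
    proof (rule simple)
      fix j assume j: "j \<in> S"
      have "r * (2 * I * core_form h j - \<sigma> j * (n0 * g $ j + m * U $ j)) = 0"
        using arg_cong[OF a1, of "\<lambda>y. y $ j"] j by (simp add: A1_def)
      then have "2 * I * core_form h j - \<sigma> j * (n0 * g $ j + m * U $ j) = 0" using r(1) by simp
      then have f: "2 * I * (2 * I * core_form h j) - \<sigma> j * (n0 * (2 * I * g $ j) + m * (2 * I * U $ j)) = 0"
        by (metis (no_types, opaque_lifting) mult_zero_right right_diff_distrib mult.left_commute distrib_left)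
      have gj: "2 * I * g $ j = - (n0 * h $ j + m * V $ j)" using g[of j] j by simp
      have uj: "2 * I * U $ j = - n0 * V $ j" using I_pos by (simp add: U_def)
      have "4 * I\<^sup>2 * core_form h j + \<sigma> j * ((n0 * n0) * h $ j + 2 * (n0 * m) * V $ j) = 0"
        using f[unfolded gj uj] by (simp add: algebra_simps power2_eq_square)
      then have "I\<^sup>2 * (4 * core_form h j + \<sigma> j * (k * h $ j + 2 * (n0 * m / I\<^sup>2) * V $ j)) = 0"
        unfolding n0(2) using I_pos by (simp add: field_simps)
      then show "4 * core_form h j + \<sigma> j * (k * h $ j + 2 * (n0 * m / I\<^sup>2) * V $ j) = 0" using I_pos by simp
    qed (use off a3 in auto)
    then have "h = 0" "m = 0" using n0(1) I_pos by auto
    moreover from this have "g $ j = 0" for j using g[of j] I_pos by (simp split: if_splits)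
    ultimately show "q = 0" by (simp add: q zero_prod_def vec_eq_iff)
  qed (use n0 in simp)
  moreover have "((\<lambda>\<epsilon>. (re_part (\<phi> \<epsilon>), \<epsilon>)) \<longlongrightarrow> p0) (at_right 0)"
  proof -
    have "((\<lambda>\<epsilon>. Re (\<phi> \<epsilon> $ j)) \<longlongrightarrow> \<sigma> j * r) (at_right 0)" for j
      using tendsto_Re[OF limit[of j]] by (simp add: r_def)
    then have "((\<lambda>\<epsilon>. re_part (\<phi> \<epsilon>)) \<longlongrightarrow> x0) (at_right 0)"
      unfolding re_part_def x0_def by (intro tendsto_vec_lambda)
    then show ?thesis unfolding p0_def by (intro tendsto_Pair tendsto_ident_at)
  qed
  ultimately have sol: "\<forall>\<^sub>0\<epsilon>. \<exists>z\<in>cball z0 (n0 / 2). F z (re_part (\<phi> \<epsilon>), \<epsilon>) = 0"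
    by (rule eventually_compose_filterlim)
  have nz: "\<forall>\<^sub>0\<epsilon>. \<forall>j\<in>S. re_part (\<phi> \<epsilon>) $ j \<noteq> 0"
  proof (rule eventually_ball_finite)
    show "\<forall>j\<in>S. \<forall>\<^sub>0\<epsilon>. re_part (\<phi> \<epsilon>) $ j \<noteq> 0"
    proof
      fix j assume "j \<in> S"
      then have "\<sigma> j * r \<noteq> 0" using sign[of j] r by auto
      moreover have "((\<lambda>\<epsilon>. re_part (\<phi> \<epsilon>) $ j) \<longlongrightarrow> \<sigma> j * r) (at_right 0)"
        using tendsto_Re[OF limit[of j]] by (simp add: r_def re_part_def)
      ultimately show "\<forall>\<^sub>0\<epsilon>. re_part (\<phi> \<epsilon>) $ j \<noteq> 0" by (rule tendsto_imp_eventually_ne[rotated])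
    qed
  qed simp
  show ?thesis using sol nz real ev_stationary ev_pos
  proof eventually_elim
    case (elim \<epsilon>)
    let ?x = "re_part (\<phi> \<epsilon>)"
    obtain v u n where z: "(v, u, n) \<in> cball z0 (n0 / 2)" and F0: "F (v, u, n) (?x, \<epsilon>) = 0"
      using elim(1) by auto
    then have f1: "F1 v u n ?x \<epsilon> = 0" and f2: "F2 v u n ?x \<epsilon> = 0" and f3: "V \<bullet> v = V \<bullet> V"
      by (auto simp: F_def zero_prod_def)
    have "\<bar>n - n0\<bar> \<le> norm ((v, u, n) - z0)"
      unfolding z0_def using order_trans[OF norm_snd_le[of "n - n0" "u - U"] norm_snd_le[of "(u - U, n - n0)" "v - V"]] by simp
    then have n: "n > 0" using z n0 by (simp add: dist_norm norm_minus_commute abs_le_iff)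
    have v0: "v \<noteq> 0" using f3 V(1) by auto
    have im: "Im (\<phi> \<epsilon> $ j) = 0" for j using elim(3) by (simp add: im_part_def vec_eq_iff)
    have c2: "(cmod (\<phi> \<epsilon> $ j))\<^sup>2 = (?x $ j)\<^sup>2" for j by (simp add: cmod_power2 im re_part_def)
    have jw: "jump (\<phi> \<epsilon>) j = w ?x j" for j by (simp add: jump_def cmod_power2 im re_part_def w_def)
    have "LM \<epsilon> v $ j = \<epsilon> * n * u $ j" for j
    proof (cases "j \<in> S")
      case False
      then show ?thesis using arg_cong[OF f1, of "\<lambda>y. y $ j"]
        by (simp add: F1_def Lm_def ring_op_nth c2 jw algebra_simps)
    next
      case True
      have "?x $ j * LM \<epsilon> v $ j = flux \<epsilon> v (j-1) - flux \<epsilon> v j"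
        using wronskian_step[of ?x j "\<lambda>j. (cmod (\<phi> \<epsilon> $ j))\<^sup>2 - I" "\<lambda>j. 2 * \<epsilon> * jump (\<phi> \<epsilon>) j" v]
          stationary_kernel(1)[OF elim(4)] by (simp add: Lm_def)
      also have "\<dots> = \<epsilon> * (2 * (w ?x j * (v $ j * ?x $ (j+1) - v $ (j+1) * ?x $ j) + w ?x (j-1) * (v $ j * ?x $ (j-1) - v $ (j-1) * ?x $ j)))"
        by (simp add: wronskian_def jw algebra_simps)
      also have "2 * (w ?x j * (v $ j * ?x $ (j+1) - v $ (j+1) * ?x $ j) + w ?x (j-1) * (v $ j * ?x $ (j-1) - v $ (j-1) * ?x $ j)) = n * ?x $ j * u $ j"
        using arg_cong[OF f1, of "\<lambda>y. y $ j"] True by (simp add: F1_def)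
      finally have "?x $ j * LM \<epsilon> v $ j = ?x $ j * (\<epsilon> * n * u $ j)" by (simp add: mult_ac)
      then show ?thesis using elim(2) True by (metis mult_left_cancel)
    qed
    moreover have "LP \<epsilon> u $ j = - (n * v $ j)" for j
      using arg_cong[OF f2, of "\<lambda>y. y $ j"]
      by (simp add: F2_def Lp_def ring_op_nth c2 jw algebra_simps eq_neg_iff_add_eq_0)
    ultimately have L: "LM \<epsilon> v = (\<epsilon> * n) *\<^sub>R u" "LP \<epsilon> u = - (n *\<^sub>R v)"
      by (simp_all add: vec_eq_iff)
    \<comment> \<open>Undo the scaling of the exponent and of u.\<close>
    define s where "s = sqrt \<epsilon>"
    have s: "s > 0" "s * s = \<epsilon>" using elim(5) by (simp_all add: s_def)
    have lin: "linear (LP \<epsilon>)" unfolding Lp_def by (rule linear_ring_op)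
    show ?case
    proof (intro exI conjI)
      show "LM \<epsilon> v = (s * n) *\<^sub>R (s *\<^sub>R u)" 
      proof -
        have "(s * n) *\<^sub>R (s *\<^sub>R u) = (s * s * n) *\<^sub>R u" by (simp add: mult_ac)
        then show ?thesis using L(1) s(2) by simp
      qed
      show "LP \<epsilon> (s *\<^sub>R u) = - ((s * n) *\<^sub>R v)" unfolding linear_scale[OF lin] L(2) by simp
    qed (use s n v0 in auto)
  qed
qed

text \<open>
  For v = sigma y the core form is -4 times the graph Laplacian of y over the out-of-phase bonds, so k
  is 16 times an eigenvalue of that Laplacian.  A single bond has the simple eigenvalue 2, with
  eigenvector v = (1,1) on its ends; the path of two bonds has the simple eigenvalue 1, with
  antisymmetric eigenvector.
\<close>

lemma ev_growing_mode:
  assumes real: "\<forall>\<^sub>0\<epsilon>. im_part (\<phi> \<epsilon>) = 0"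
    and anti: "\<sigma> 1 = - 1 \<or> \<sigma> (-1) = - 1"
  shows "\<forall>\<^sub>0\<epsilon>. \<exists>u v l. LM \<epsilon> v = l *\<^sub>R u \<and> LP \<epsilon> u = - (l *\<^sub>R v) \<and> v \<noteq> 0 \<and> l > 0"
proof -
  have s2: "\<sigma> 2 = 0" "\<sigma> (-2) = 0" using distinct sign_off by auto
  have s1: "\<sigma> 1 = 1 \<or> \<sigma> 1 = -1" "\<sigma> (-1) = 1 \<or> \<sigma> (-1) = -1" using sign in_S by auto
  define mk :: "real \<Rightarrow> real \<Rightarrow> real \<Rightarrow> real ^ 'n site"
    where "mk a b c = (\<chi> j. if j = -1 then a else if j = 0 then b else if j = 1 then c else 0)" for a b c
  have mk: "mk a b c $ (-1) = a" "mk a b c $ 0 = b" "mk a b c $ 1 = c" for a b c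
    using distinct by (simp_all add: mk_def)
  have mk_off: "mk a b c $ j = 0" if "j \<notin> S" for a b c j using that by (auto simp: mk_def S_def)
  have off2: "h $ 2 = 0 \<and> h $ (-2) = 0" if "\<And>j. j \<notin> S \<Longrightarrow> h $ j = 0" for h :: "real ^ 'n site"
    using that distinct by blast
  have zero: "h = 0" if "\<And>j. j \<notin> S \<Longrightarrow> h $ j = 0" "h $ (-1) = 0" "h $ 0 = 0" "h $ 1 = 0" for h :: "real ^ 'n site"
  proof -
    have "h $ j = 0" for j by (cases "j \<in> S") (use that in \<open>auto simp: S_def\<close>)
    then show ?thesis by (simp add: vec_eq_iff)
  qed
  have dot: "mk a b c \<bullet> h = a * h $ (-1) + b * h $ 0 + c * h $ 1" if "\<And>j. j \<notin> S \<Longrightarrow> h $ j = 0" for a b c h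
  proof -
    have "mk a b c \<bullet> h = (\<Sum>j\<in>S. mk a b c $ j * h $ j)"
      unfolding inner_vec_def inner_real_def by (rule sum.mono_neutral_right) (use that in auto)
    then show ?thesis using distinct(5,6) mk unfolding S_def by simp
  qed
  have cf: "core_form h 1 = - h $ 2 * \<sigma> 1 + (\<sigma> 1 - 1)\<^sup>2 * (h $ 1 - h $ 0 * \<sigma> 1)"
    "core_form h 0 = (\<sigma> 1 - 1)\<^sup>2 * (h $ 0 * \<sigma> 1 - h $ 1) + (1 - \<sigma> (-1))\<^sup>2 * (h $ 0 * \<sigma> (-1) - h $ (-1))"
    "core_form h (-1) = (1 - \<sigma> (-1))\<^sup>2 * (h $ (-1) - h $ 0 * \<sigma> (-1)) - h $ (-2) * \<sigma> (-1)" for h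
    using s1 by (auto simp: core_form_def s2 sign_0)
  consider (a) "\<sigma> 1 = -1" "\<sigma> (-1) = 1" | (b) "\<sigma> 1 = 1" "\<sigma> (-1) = -1" | (c) "\<sigma> 1 = -1" "\<sigma> (-1) = -1"
    using s1 anti by auto
  then show ?thesis
  proof cases
    case a
    show ?thesis
    proof (rule ev_growing_mode_of_simple_eigenvalue[OF real, of "mk 0 1 1" 32])
      show "mk 0 1 1 \<noteq> 0" using mk(2)[of 0 1 1] by auto
      show "4 * core_form (mk 0 1 1) j + \<sigma> j * (32 * mk 0 1 1 $ j) = 0" if "j \<in> S" for j
        using that off2[OF mk_off] by (auto simp: S_def cf mk a sign_0)
      fix h y assume h: "\<And>j. j \<notin> S \<Longrightarrow> h $ j = 0"
        and e: "\<And>j. j \<in> S \<Longrightarrow> 4 * core_form h j + \<sigma> j * (32 * h $ j + 2 * y * mk 0 1 1 $ j) = 0"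
        and o: "mk 0 1 1 \<bullet> h = 0"
      have "mk 0 1 1 \<bullet> h = 0 * h $ (-1) + 1 * h $ 0 + 1 * h $ 1" by (rule dot) (rule h)
      then have d: "0 * h $ (-1) + 1 * h $ 0 + 1 * h $ 1 = 0" using o by simp
      show "h = 0 \<and> y = 0"
        using e[OF in_S(1)] e[OF in_S(2)] e[OF in_S(3)] off2[OF h] d
        unfolding cf mk a sign_0 by (intro conjI zero[OF h]) auto
    qed (use mk_off in auto)
  next
    case b
    show ?thesis
    proof (rule ev_growing_mode_of_simple_eigenvalue[OF real, of "mk 1 1 0" 32])
      show "mk 1 1 0 \<noteq> 0" using mk(2)[of 1 1 0] by auto
      show "4 * core_form (mk 1 1 0) j + \<sigma> j * (32 * mk 1 1 0 $ j) = 0" if "j \<in> S" for j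
        using that off2[OF mk_off] by (auto simp: S_def cf mk b sign_0)
      fix h y assume h: "\<And>j. j \<notin> S \<Longrightarrow> h $ j = 0"
        and e: "\<And>j. j \<in> S \<Longrightarrow> 4 * core_form h j + \<sigma> j * (32 * h $ j + 2 * y * mk 1 1 0 $ j) = 0"
        and o: "mk 1 1 0 \<bullet> h = 0"
      have "mk 1 1 0 \<bullet> h = 1 * h $ (-1) + 1 * h $ 0 + 0 * h $ 1" by (rule dot) (rule h)
      then have d: "1 * h $ (-1) + 1 * h $ 0 + 0 * h $ 1 = 0" using o by simp
      show "h = 0 \<and> y = 0"
        using e[OF in_S(1)] e[OF in_S(2)] e[OF in_S(3)] off2[OF h] d
        unfolding cf mk b sign_0 by (intro conjI zero[OF h]) auto
    qed (use mk_off in auto)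
  next
    case c
    show ?thesis
    proof (rule ev_growing_mode_of_simple_eigenvalue[OF real, of "mk (-1) 0 1" 16])
      show "mk (-1) 0 1 \<noteq> 0" using mk(3)[of "-1" 0 1] by auto
      show "4 * core_form (mk (-1) 0 1) j + \<sigma> j * (16 * mk (-1) 0 1 $ j) = 0" if "j \<in> S" for j
        using that off2[OF mk_off] by (auto simp: S_def cf mk c sign_0)
      fix h y assume h: "\<And>j. j \<notin> S \<Longrightarrow> h $ j = 0"
        and e: "\<And>j. j \<in> S \<Longrightarrow> 4 * core_form h j + \<sigma> j * (16 * h $ j + 2 * y * mk (-1) 0 1 $ j) = 0"
        and o: "mk (-1) 0 1 \<bullet> h = 0"
      have "mk (-1) 0 1 \<bullet> h = -1 * h $ (-1) + 0 * h $ 0 + 1 * h $ 1" by (rule dot) (rule h)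
      then have d: "-1 * h $ (-1) + 0 * h $ 0 + 1 * h $ 1 = 0" using o by simp
      show "h = 0 \<and> y = 0"
        using e[OF in_S(1)] e[OF in_S(2)] e[OF in_S(3)] off2[OF h] d
        unfolding cf mk c sign_0 by (intro conjI zero[OF h]) auto
    qed (use mk_off in auto)
  qed
qed

end

section \<open>Continuations and their stability\<close>

lemma norm_phase: "cmod c = 1 \<Longrightarrow> norm (phase c h) = norm h"
  by (simp add: norm_vec_def norm_mult)

lemma phase_phase: "phase c (phase d h) = phase (c * d) h"
  by (simp add: vec_eq_iff mult.assoc)

lemma vector_field_phase:
  "cmod c = 1 \<Longrightarrow> vector_field \<epsilon> (phase c \<psi>) = phase c (vector_field \<epsilon> \<psi>)"
  using coupling_phase[of c \<psi>]
  by (simp add: vec_eq_iff vector_field_nth cubic_mult phase_def algebra_simps)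

lemma stationary_vector_field:
  "stationary I \<epsilon> \<phi> \<longleftrightarrow> (\<forall>j. vector_field \<epsilon> \<phi> $ j = - \<i> * of_real (1 + I) * \<phi> $ j)"
proof -
  have "(of_real ((cmod z)\<^sup>2 - I) * z + 2 * of_real \<epsilon> * k = 0)
      \<longleftrightarrow> (- \<i> * (z + cubic z + 2 * of_real \<epsilon> * k) = - \<i> * of_real (1 + I) * z)" for z k
  proof -
    have "- \<i> * (z + cubic z + 2 * of_real \<epsilon> * k) - (- \<i> * of_real (1 + I) * z)
        = - \<i> * (of_real ((cmod z)\<^sup>2 - I) * z + 2 * of_real \<epsilon> * k)"
      by (simp add: cubic_def algebra_simps)
    then show ?thesis by (metis complex_i_not_zero eq_iff_diff_eq_0 mult_eq_0_iff neg_equal_0_iff_equal)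
  qed
  then show ?thesis unfolding stationary_def vector_field_nth by blast
qed

lemma stationary_phase: "cmod c = 1 \<Longrightarrow> stationary I \<epsilon> (phase c \<phi>) \<longleftrightarrow> stationary I \<epsilon> \<phi>"
proof -
  assume c: "cmod c = 1"
  then have "c \<noteq> 0" by auto
  then have "c * x = - \<i> * of_real (1 + I) * (c * y) \<longleftrightarrow> x = - \<i> * of_real (1 + I) * y" for x y
    by (metis mult.left_commute mult_left_cancel)
  then show ?thesis unfolding stationary_vector_field vector_field_phase[OF c] phase_nth by simp
qed

lemma standing_wave_periodic_solution:
  assumes "stationary I \<epsilon> \<phi>" "I > 0"
  shows "is_periodic_solution \<epsilon> (2 * pi / (1 + I)) (standing_wave I \<alpha> \<phi>)"
  unfolding is_periodic_solution_def is_solution_def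
proof (intro conjI allI)
  fix t
  let ?c = "cis (\<alpha> - (1 + I) * t)"
  have bl: "bounded_linear (\<lambda>c. phase c \<phi>)"
    unfolding linear_conv_bounded_linear[symmetric] by (rule linearI) (simp_all add: vec_eq_iff algebra_simps)
  have "(standing_wave I \<alpha> \<phi> has_vector_derivative phase (- \<i> * of_real (1 + I) * ?c) \<phi>) (at t)"
    unfolding standing_wave_def[abs_def] by (rule bounded_linear.has_vector_derivative[OF bl cis_deriv])
  moreover have "phase (- \<i> * of_real (1 + I) * ?c) \<phi> = vector_field \<epsilon> (standing_wave I \<alpha> \<phi> t)"
    using assms(1) by (simp add: standing_wave_def vector_field_phase vec_eq_iff stationary_vector_field mult_ac)
  ultimately show "(standing_wave I \<alpha> \<phi> has_vector_derivative vector_field \<epsilon> (standing_wave I \<alpha> \<phi> t)) (at t)" by simp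
  have "\<alpha> - (1 + I) * (t + 2 * pi / (1 + I)) = (\<alpha> - (1 + I) * t) - 2 * pi"
    using assms(2) by (simp add: field_simps)
  moreover have "cis (x - 2 * pi) = cis x" for x by (simp add: complex_eq_iff cos_diff sin_diff)
  ultimately have "cis (\<alpha> - (1 + I) * (t + 2 * pi / (1 + I))) = ?c" by metis
  then show "standing_wave I \<alpha> \<phi> (t + 2 * pi / (1 + I)) = standing_wave I \<alpha> \<phi> t"
    by (simp add: standing_wave_def)
qed

lemma unperturbed_orbit_standing_wave:
  assumes S: "S = ({-1, 0, 1} :: 'n::finite site set)"
    and \<sigma>: "\<And>j. \<sigma> j = (if j \<in> S then cos (\<theta> 0 - \<theta> j) else 0)" and sin: "\<And>j. j \<in> S \<Longrightarrow> sin (\<theta> 0 - \<theta> j) = 0"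
  shows "unperturbed_orbit S I \<theta> = standing_wave I (- \<theta> 0) (\<chi> j. of_real (\<sigma> j * sqrt I))"
proof -
  have "of_real (sqrt I) * exp (- \<i> * of_real ((1 + I) * t + \<theta> j)) = cis (- \<theta> 0 - (1 + I) * t) * of_real (\<sigma> j * sqrt I)"
    if "j \<in> S" for j t
  proof -
    have "cis (\<theta> 0 - \<theta> j) = of_real (\<sigma> j)" using sin[OF that] \<sigma>[of j] that by (simp add: complex_eq_iff)
    moreover have "exp (- \<i> * of_real ((1 + I) * t + \<theta> j)) = cis (- \<theta> 0 - (1 + I) * t) * cis (\<theta> 0 - \<theta> j)"
    proof -
      have "- \<theta> 0 - (1 + I) * t + (\<theta> 0 - \<theta> j) = - ((1 + I) * t + \<theta> j)" by simp
      moreover have "exp (- \<i> * of_real x) = cis (- x)" for x by (simp add: cis_conv_exp)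
      ultimately show ?thesis unfolding cis_mult by (simp only:)
    qed
    ultimately show ?thesis by (simp add: mult_ac)
  qed
  then show ?thesis
    by (auto simp: fun_eq_iff unperturbed_orbit_def standing_wave_def vec_eq_iff \<sigma>)
qed

lemma corotating_frame:
  assumes sol: "is_solution \<epsilon> \<psi>"
  shows "corotating I \<epsilon> (\<lambda>t. phase (cis (\<alpha> - (- (1 + I)) * t)) (\<psi> t))"
  unfolding corotating_def
proof (intro allI)
  fix t j
  let ?c = "\<lambda>t. cis (\<alpha> - (- (1 + I)) * t)"
  have cn: "cmod (?c t) = 1" by simp
  have "((\<lambda>t. \<psi> t $ j) has_vector_derivative vector_field \<epsilon> (\<psi> t) $ j) (at t)"
    by (rule bounded_linear.has_vector_derivative[OF bounded_linear_vec_nth])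
       (use sol in \<open>simp add: is_solution_def\<close>)
  from has_vector_derivative_mult[OF cis_deriv[of \<alpha> "- (1 + I)" t] this]
  have "((\<lambda>t. phase (?c t) (\<psi> t) $ j) has_vector_derivative
      ?c t * vector_field \<epsilon> (\<psi> t) $ j + (- \<i> * of_real (- (1 + I)) * ?c t) * \<psi> t $ j) (at t)"
    by simp
  moreover have "?c t * vector_field \<epsilon> (\<psi> t) $ j + (- \<i> * of_real (- (1 + I)) * ?c t) * \<psi> t $ j
     = - \<i> * (of_real ((cmod (phase (?c t) (\<psi> t) $ j))\<^sup>2 - I) * phase (?c t) (\<psi> t) $ j
         + 2 * of_real \<epsilon> * coupling (phase (?c t) (\<psi> t)) j)"
  proof -
    have "?c t * vector_field \<epsilon> (\<psi> t) $ j = vector_field \<epsilon> (phase (?c t) (\<psi> t)) $ j"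
      using vector_field_phase[OF cn, of \<epsilon> "\<psi> t"] by simp
    then show ?thesis unfolding vector_field_nth by (simp add: cubic_def algebra_simps)
  qed
  ultimately show "((\<lambda>t. phase (?c t) (\<psi> t) $ j) has_vector_derivative
      - \<i> * (of_real ((cmod (phase (?c t) (\<psi> t) $ j))\<^sup>2 - I) * phase (?c t) (\<psi> t) $ j
         + 2 * of_real \<epsilon> * coupling (phase (?c t) (\<psi> t)) j)) (at t)" by simp
qed

lemma constant_corotating_stationary:
  assumes "corotating I \<epsilon> (\<lambda>t. \<phi>)" shows "stationary I \<epsilon> \<phi>"
  unfolding stationary_def
proof
  fix j
  have "((\<lambda>t::real. \<phi> $ j) has_vector_derivative - \<i> * (of_real ((cmod (\<phi> $ j))\<^sup>2 - I) * \<phi> $ j + 2 * of_real \<epsilon> * coupling \<phi> j)) (at 0)"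
    using assms by (simp add: corotating_def)
  moreover have "((\<lambda>t::real. \<phi> $ j) has_vector_derivative 0) (at 0)" by (rule has_vector_derivative_const)
  ultimately have "- \<i> * (of_real ((cmod (\<phi> $ j))\<^sup>2 - I) * \<phi> $ j + 2 * of_real \<epsilon> * coupling \<phi> j) = 0"
    by (rule vector_derivative_unique_at)
  then show "of_real ((cmod (\<phi> $ j))\<^sup>2 - I) * \<phi> $ j + 2 * of_real \<epsilon> * coupling \<phi> j = 0"
    by (metis complex_i_not_zero mult_eq_0_iff neg_equal_0_iff_equal)
qed

text \<open>
  Rigidity makes each member of the continuation constant in the rotating frame.  The phase of its
  central site is then removed, which is possible since that site is excited, and the wave becomes
  real.
\<close>

lemma continuation_is_standing_wave:
  fixes \<sigma> :: "'n::finite site \<Rightarrow> real"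
  assumes card: "6 \<le> CARD('n)" and S: "S = {-1, 0, 1}" and I: "I > 0" and T: "T = 2 * pi / (1 + I)"
    and sign: "\<And>j. j \<in> S \<Longrightarrow> \<sigma> j = 1 \<or> \<sigma> j = - 1" "\<sigma> 0 = 1" "\<And>j. j \<notin> S \<Longrightarrow> \<sigma> j = 0"
    and cont: "is_continuation T (standing_wave I \<beta> (\<chi> j. of_real (\<sigma> j * sqrt I))) \<psi>"
  shows "\<exists>\<phi> \<alpha>. standing_wave_family I S \<phi> \<sigma> \<and> (\<forall>\<^sub>0\<epsilon>. im_part (\<phi> \<epsilon>) = 0)
     \<and> (\<forall>\<^sub>0\<epsilon>. \<psi> \<epsilon> = standing_wave I (\<alpha> \<epsilon>) (\<phi> \<epsilon>))"
proof -
  define a :: "'n state" where "a = (\<chi> j. of_real (\<sigma> j * sqrt I))"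
  define c where "c t = cis (- \<beta> - (- (1 + I)) * t)" for t
  have cn: "cmod (c t) = 1" for t by (simp add: c_def)
  define u where "u \<epsilon> t = phase (c t) (\<psi> \<epsilon> t)" for \<epsilon> t
  have cinv: "cis (\<beta> - (1 + I) * t) * c t = 1" for t
  proof -
    have "\<beta> - (1 + I) * t + (- \<beta> - (- (1 + I)) * t) = 0" by (simp add: algebra_simps)
    then show ?thesis unfolding c_def cis_mult by (simp only: cis_zero)
  qed
  have \<psi>u: "\<psi> \<epsilon> t = phase (cis (\<beta> - (1 + I) * t)) (u \<epsilon> t)" for \<epsilon> t
    by (simp add: u_def phase_phase cinv) (simp add: vec_eq_iff)
  have u_near: "norm (u \<epsilon> t - a) = dist (\<psi> \<epsilon> t) (standing_wave I \<beta> a t)" for \<epsilon> t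
  proof -
    have "u \<epsilon> t - a = phase (c t) (\<psi> \<epsilon> t - standing_wave I \<beta> a t)"
      using cinv[of t] by (simp add: u_def standing_wave_def vec_eq_iff right_diff_distrib mult.assoc[symmetric] mult.commute[of "c t"])
    then show ?thesis using norm_phase[OF cn] by (simp add: dist_norm)
  qed
  have acase: "cmod (a $ j) = sqrt I \<or> a $ j = 0" for j
    using sign(1)[of j] sign(3)[of j] I by (cases "j \<in> S") (auto simp: a_def norm_mult)
  obtain \<delta> where \<delta>: "\<delta> > 0" and rigid: "\<And>\<epsilon> u. \<lbrakk>0 < \<epsilon>; \<epsilon> < \<delta>; corotating I \<epsilon> u; \<forall>t. u (t + T) = u t;
      \<forall>t j. cmod (u t $ j - a $ j) \<le> \<delta>\<rbrakk> \<Longrightarrow> \<forall>t h. u (t + h) = u t"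
    using rigidity[OF I T acase] by blast
  obtain e where e: "e > 0" "\<And>\<epsilon>. 0 < \<epsilon> \<Longrightarrow> \<epsilon> < e \<Longrightarrow> is_periodic_solution \<epsilon> T (\<psi> \<epsilon>)"
    using cont by (auto simp: is_continuation_def)
  have unif: "\<forall>\<^sub>0\<epsilon>. \<forall>t. norm (u \<epsilon> t - a) < d" if "d > 0" for d
    using cont that unfolding is_continuation_def a_def[symmetric] u_near by (auto dest: uniform_limitD)
  have pos: "\<forall>\<^sub>0\<epsilon>. 0 < \<epsilon>" by (rule eventually_at_right_less)
  have lt: "\<forall>\<^sub>0\<epsilon>. \<epsilon> < min e \<delta>"
    using e(1) \<delta> by (intro eventually_at_rightI[of 0 "min e \<delta>"]) auto
  have const: "\<forall>\<^sub>0\<epsilon>. \<forall>t. u \<epsilon> t = u \<epsilon> 0"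
    and stat: "\<forall>\<^sub>0\<epsilon>. stationary I \<epsilon> (u \<epsilon> 0)"
  proof -
    have "\<forall>\<^sub>0\<epsilon>. (\<forall>t. u \<epsilon> t = u \<epsilon> 0) \<and> stationary I \<epsilon> (u \<epsilon> 0)"
      using pos lt unif[OF \<delta>]
    proof eventually_elim
      case (elim \<epsilon>)
      have ps: "is_periodic_solution \<epsilon> T (\<psi> \<epsilon>)" using e(2) elim by simp
      then have co: "corotating I \<epsilon> (u \<epsilon>)"
        unfolding u_def[abs_def] c_def by (intro corotating_frame) (simp add: is_periodic_solution_def)
      have "u \<epsilon> (t + T) = u \<epsilon> t" for t
      proof -
        have "- \<beta> - (- (1 + I)) * (t + T) = (- \<beta> - (- (1 + I)) * t) + 2 * pi"
          using I by (simp add: T field_simps)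
        moreover have "cis (x + 2 * pi) = cis x" for x by (simp add: complex_eq_iff)
        ultimately have "c (t + T) = c t" unfolding c_def by metis
        then show ?thesis using ps by (simp add: u_def is_periodic_solution_def)
      qed
      moreover have "cmod (u \<epsilon> t $ j - a $ j) \<le> \<delta>" for t j
      proof -
        have "cmod ((u \<epsilon> t - a) $ j) \<le> norm (u \<epsilon> t - a)" by (rule Finite_Cartesian_Product.norm_nth_le)
        then show ?thesis using elim(3) by (metis less_imp_le order_trans vector_minus_component)
      qed
      ultimately have "\<forall>t h. u \<epsilon> (t + h) = u \<epsilon> t" using rigid co elim by simp
      then have k: "\<forall>t. u \<epsilon> t = u \<epsilon> 0" by (metis add_0)
      then have "u \<epsilon> = (\<lambda>t. u \<epsilon> 0)" by auto
      then have "corotating I \<epsilon> (\<lambda>t. u \<epsilon> 0)" using co by metis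
      then show ?case using k constant_corotating_stationary by blast
    qed
    then show "\<forall>\<^sub>0\<epsilon>. \<forall>t. u \<epsilon> t = u \<epsilon> 0" "\<forall>\<^sub>0\<epsilon>. stationary I \<epsilon> (u \<epsilon> 0)"
      by (auto elim: eventually_mono)
  qed
  have lim: "((\<lambda>\<epsilon>. u \<epsilon> 0) \<longlongrightarrow> a) (at_right 0)"
  proof (rule tendstoI)
    fix d :: real assume "d > 0"
    from unif[OF this] show "\<forall>\<^sub>0\<epsilon>. dist (u \<epsilon> 0) a < d"
      by eventually_elim (simp add: dist_norm)
  qed
  define s where "s \<epsilon> = Arg (u \<epsilon> 0 $ 0)" for \<epsilon>
  define \<phi> where "\<phi> \<epsilon> = phase (cis (- s \<epsilon>)) (u \<epsilon> 0)" for \<epsilon>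
  have a0: "a $ 0 = of_real (sqrt I)" by (simp add: a_def sign(2))
  have lims: "((\<lambda>\<epsilon>. cis (- s \<epsilon>)) \<longlongrightarrow> 1) (at_right 0)"
  proof -
    have z0: "((\<lambda>\<epsilon>. u \<epsilon> 0 $ 0) \<longlongrightarrow> of_real (sqrt I)) (at_right 0)"
      using tendsto_vec_nth[OF lim, of 0] by (simp add: a0)
    have nz: "complex_of_real (sqrt I) \<noteq> 0" using I by simp
    have l1: "((\<lambda>\<epsilon>. cnj (sgn (u \<epsilon> 0 $ 0))) \<longlongrightarrow> cnj (sgn (of_real (sqrt I)))) (at_right 0)"
      by (intro tendsto_cnj tendsto_sgn z0 nz)
    have l2: "cnj (sgn (complex_of_real (sqrt I))) = 1" using I by (simp add: sgn_of_real)
    have l3: "\<forall>\<^sub>0\<epsilon>. cnj (sgn (u \<epsilon> 0 $ 0)) = cis (- s \<epsilon>)"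
      using tendsto_imp_eventually_ne[OF z0 nz]
      by eventually_elim (simp add: s_def cis_Arg flip: cis_cnj)
    from Lim_transform_eventually[OF l1 l3] show ?thesis unfolding l2 .
  qed
  have "standing_wave_family I S \<phi> \<sigma>"
  proof
    show "\<forall>\<^sub>0\<epsilon>. stationary I \<epsilon> (\<phi> \<epsilon>)"
      using stat by eventually_elim (simp add: \<phi>_def stationary_phase)
    fix j
    have "((\<lambda>\<epsilon>. cis (- s \<epsilon>) * u \<epsilon> 0 $ j) \<longlongrightarrow> 1 * a $ j) (at_right 0)"
      by (intro tendsto_mult lims tendsto_vec_nth lim)
    then show "((\<lambda>\<epsilon>. \<phi> \<epsilon> $ j) \<longlongrightarrow> of_real (\<sigma> j * sqrt I)) (at_right 0)"
      by (simp add: \<phi>_def a_def)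
  qed (use card S I sign in auto)
  moreover from this have "\<forall>\<^sub>0\<epsilon>. im_part (\<phi> \<epsilon>) = 0"
  proof (rule standing_wave_family.ev_real)
    have "Im (\<phi> \<epsilon> $ 0) = 0" for \<epsilon>
    proof -
      have "\<phi> \<epsilon> $ 0 = cis (- s \<epsilon>) * (of_real (cmod (u \<epsilon> 0 $ 0)) * cis (s \<epsilon>))"
        unfolding \<phi>_def phase_nth s_def by (metis rcis_cmod_Arg rcis_def)
      then show ?thesis by (simp add: algebra_simps)
    qed
    then show "\<forall>\<^sub>0\<epsilon>. Im (\<phi> \<epsilon> $ 0) = 0" by simp
  qed
  moreover have "\<forall>\<^sub>0\<epsilon>. \<psi> \<epsilon> = standing_wave I (\<beta> + s \<epsilon>) (\<phi> \<epsilon>)"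
    using const
  proof eventually_elim
    case (elim \<epsilon>)
    show ?case
    proof
      fix t
      have "\<psi> \<epsilon> t = phase (cis (\<beta> - (1 + I) * t)) (u \<epsilon> 0)" using \<psi>u[of \<epsilon> t] elim by metis
      also have "\<dots> = standing_wave I (\<beta> + s \<epsilon>) (\<phi> \<epsilon>) t"
        by (simp add: standing_wave_def \<phi>_def phase_phase cis_mult algebra_simps)
      finally show "\<psi> \<epsilon> t = standing_wave I (\<beta> + s \<epsilon>) (\<phi> \<epsilon>) t" .
    qed
  qed
  ultimately show ?thesis by (intro exI[of _ \<phi>] exI[of _ "\<lambda>\<epsilon>. \<beta> + s \<epsilon>"]) auto
qed

theorem mainTheorem5:
  fixes N :: nat and Istar \<omega> T :: real and S :: "'n::finite site set"
  assumes "CARD('n) = N" and "6 \<le> N" and "N \<le> 10"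
    and "S = {-1, 0, 1}"
    and "Istar > 0"
    and "\<omega> = 1 + Istar"
    and "\<And>k::int. k \<noteq> 0 \<Longrightarrow>
           of_int k * \<omega> + 1 \<noteq> 0 \<and> of_int k * \<omega> - 1 \<noteq> 0
         \<and> of_int k * \<omega> + 2 \<noteq> 0 \<and> of_int k * \<omega> - 2 \<noteq> 0"
    and "T = 2 * pi / \<omega>"
  shows
    "(\<forall>\<theta> q2 q3. q2 = \<theta> 0 - \<theta> (-1) \<and> q3 = \<theta> 1 - \<theta> 0
        \<and> (q2, q3) \<in> {(0, 0), (0, pi), (pi, 0), (pi, pi)}
        \<longrightarrow> can_be_continued T (unperturbed_orbit S Istar \<theta>))
     \<and> (\<forall>\<theta> q2 q3 \<psi>. q2 = \<theta> 0 - \<theta> (-1) \<and> q3 = \<theta> 1 - \<theta> 0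
        \<and> (q2, q3) = (0, 0)
        \<and> is_continuation T (unperturbed_orbit S Istar \<theta>) \<psi>
        \<longrightarrow> (\<exists>\<epsilon>1>0. \<forall>\<epsilon>. 0 < \<epsilon> \<and> \<epsilon> < \<epsilon>1 \<longrightarrow> linearly_stable \<epsilon> T (\<psi> \<epsilon>)))
     \<and> (\<forall>\<theta> q2 q3 \<psi>. q2 = \<theta> 0 - \<theta> (-1) \<and> q3 = \<theta> 1 - \<theta> 0
        \<and> (q2, q3) \<in> {(0, pi), (pi, 0), (pi, pi)}
        \<and> is_continuation T (unperturbed_orbit S Istar \<theta>) \<psi>
        \<longrightarrow> (\<exists>\<epsilon>1>0. \<forall>\<epsilon>. 0 < \<epsilon> \<and> \<epsilon> < \<epsilon>1 \<longrightarrow> linearly_unstable \<epsilon> T (\<psi> \<epsilon>)))"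
proof -
  have card: "6 \<le> CARD('n)" and I: "Istar > 0" and T: "T = 2 * pi / (1 + Istar)" and S: "S = {-1, 0, 1}"
    using assms by simp_all
  define sg :: "('n site \<Rightarrow> real) \<Rightarrow> 'n site \<Rightarrow> real"
    where "sg \<theta> j = (if j \<in> S then cos (\<theta> 0 - \<theta> j) else 0)" for \<theta> j
  define a :: "('n site \<Rightarrow> real) \<Rightarrow> 'n state" where "a \<theta> = (\<chi> j. of_real (sg \<theta> j * sqrt Istar))" for \<theta>
  have phases: "sg \<theta> 0 = 1" "sg \<theta> (-1) = (if \<theta> 0 - \<theta> (-1) = 0 then 1 else -1)" "sg \<theta> 1 = (if \<theta> 1 - \<theta> 0 = 0 then 1 else -1)"
    "\<And>j. j \<in> S \<Longrightarrow> sin (\<theta> 0 - \<theta> j) = 0"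
    if "\<theta> 0 - \<theta> (-1) \<in> {0, pi}" "\<theta> 1 - \<theta> 0 \<in> {0, pi}" for \<theta> :: "'n site \<Rightarrow> real"
  proof -
    have c1: "cos (\<theta> 0 - \<theta> 1) = cos (\<theta> 1 - \<theta> 0)" by (metis cos_minus minus_diff_eq)
    have s1: "sin (\<theta> 0 - \<theta> 1) = - sin (\<theta> 1 - \<theta> 0)" by (metis sin_minus minus_diff_eq)
    show "sg \<theta> 0 = 1" by (simp add: sg_def S)
    show "sg \<theta> (-1) = (if \<theta> 0 - \<theta> (-1) = 0 then 1 else -1)"
      using that(1) by (elim insertE) (simp_all add: sg_def S)
    show "sg \<theta> 1 = (if \<theta> 1 - \<theta> 0 = 0 then 1 else -1)"
      using that(2) by (elim insertE) (simp_all add: sg_def S c1)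
    have "sin (\<theta> 0 - \<theta> (-1)) = 0" "sin (\<theta> 0 - \<theta> 1) = 0" unfolding s1 using that by auto
    then show "sin (\<theta> 0 - \<theta> j) = 0" if "j \<in> S" for j using that by (auto simp: S)
  qed
  have orbit: "unperturbed_orbit S Istar \<theta> = standing_wave Istar (- \<theta> 0) (a \<theta>)"
    if "\<theta> 0 - \<theta> (-1) \<in> {0, pi}" "\<theta> 1 - \<theta> 0 \<in> {0, pi}" for \<theta>
    unfolding a_def by (rule unperturbed_orbit_standing_wave[OF S]) (use phases[OF that] in \<open>auto simp: sg_def\<close>)
  have sign: "j \<in> S \<Longrightarrow> sg \<theta> j = 1 \<or> sg \<theta> j = - 1" "j \<notin> S \<Longrightarrow> sg \<theta> j = 0"
    if "\<theta> 0 - \<theta> (-1) \<in> {0, pi}" "\<theta> 1 - \<theta> 0 \<in> {0, pi}" for \<theta> j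
  proof -
    show "sg \<theta> j = 1 \<or> sg \<theta> j = - 1" if "j \<in> S"
      using that phases(1-3)[OF \<open>\<theta> 0 - \<theta> (-1) \<in> {0, pi}\<close> \<open>\<theta> 1 - \<theta> 0 \<in> {0, pi}\<close>]
      unfolding S by (elim insertE) (simp_all split: if_splits)
    show "sg \<theta> j = 0" if "j \<notin> S" using that by (simp add: sg_def)
  qed
  have exist: "can_be_continued T (unperturbed_orbit S Istar \<theta>)"
    if q: "\<theta> 0 - \<theta> (-1) \<in> {0, pi}" "\<theta> 1 - \<theta> 0 \<in> {0, pi}" for \<theta>
  proof -
    have "sg \<theta> j \<in> {0, 1, -1}" for j using sign[OF q, of j] by auto
    then obtain \<phi> where \<phi>: "\<forall>\<^sub>0\<epsilon>. stationary Istar \<epsilon> (\<phi> \<epsilon>)" "(\<phi> \<longlongrightarrow> a \<theta>) (at_right 0)"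
      using stationary_family_exists[OF I, of "sg \<theta>"] unfolding a_def by blast
    obtain e where e: "e > 0" "\<And>\<epsilon>. 0 < \<epsilon> \<Longrightarrow> \<epsilon> < e \<Longrightarrow> stationary Istar \<epsilon> (\<phi> \<epsilon>)"
      using \<phi>(1) by (auto simp: eventually_at_right_field)
    have "uniform_limit UNIV (\<lambda>\<epsilon>. standing_wave Istar (- \<theta> 0) (\<phi> \<epsilon>)) (standing_wave Istar (- \<theta> 0) (a \<theta>)) (at_right 0)"
    proof (rule uniform_limitI)
      fix d :: real assume "d > 0"
      with \<phi>(2) have "\<forall>\<^sub>0\<epsilon>. dist (\<phi> \<epsilon>) (a \<theta>) < d" by (rule tendstoD)
      then show "\<forall>\<^sub>0\<epsilon>. \<forall>t\<in>UNIV. dist (standing_wave Istar (- \<theta> 0) (\<phi> \<epsilon>) t) (standing_wave Istar (- \<theta> 0) (a \<theta>) t) < d"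
      proof eventually_elim
        case (elim \<epsilon>)
        have "standing_wave Istar (- \<theta> 0) (\<phi> \<epsilon>) t - standing_wave Istar (- \<theta> 0) (a \<theta>) t
            = phase (cis (- \<theta> 0 - (1 + Istar) * t)) (\<phi> \<epsilon> - a \<theta>)" for t
          by (simp add: standing_wave_def linear_diff[OF linear_phase])
        then show ?case using elim by (simp add: dist_norm norm_phase)
      qed
    qed
    moreover have "is_periodic_solution \<epsilon> T (standing_wave Istar (- \<theta> 0) (\<phi> \<epsilon>))" if "0 < \<epsilon> \<and> \<epsilon> < e" for \<epsilon>
      unfolding T by (rule standing_wave_periodic_solution[OF _ I]) (use e(2) that in blast)
    ultimately show ?thesis
      unfolding can_be_continued_def is_continuation_def orbit[OF q]
      by (intro exI[of _ "\<lambda>\<epsilon>. standing_wave Istar (- \<theta> 0) (\<phi> \<epsilon>)"] conjI exI[of _ e]) (simp_all add: e(1))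
  qed
  have wave: "\<exists>\<phi> \<alpha>. standing_wave_family Istar S \<phi> (sg \<theta>) \<and> (\<forall>\<^sub>0\<epsilon>. im_part (\<phi> \<epsilon>) = 0)
     \<and> (\<forall>\<^sub>0\<epsilon>. \<psi> \<epsilon> = standing_wave Istar (\<alpha> \<epsilon>) (\<phi> \<epsilon>))"
    if q: "\<theta> 0 - \<theta> (-1) \<in> {0, pi}" "\<theta> 1 - \<theta> 0 \<in> {0, pi}"
      and "is_continuation T (unperturbed_orbit S Istar \<theta>) \<psi>" for \<theta> \<psi>
  proof (rule continuation_is_standing_wave[where \<sigma> = "sg \<theta>" and \<beta> = "- \<theta> 0", OF card S I T])
    show "is_continuation T (standing_wave Istar (- \<theta> 0) (\<chi> j. of_real (sg \<theta> j * sqrt Istar))) \<psi>"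
      using that(3) unfolding orbit[OF q] a_def .
  qed (use sign[OF q] phases(1)[OF q] in auto)
  have stable: "\<exists>\<epsilon>1>0. \<forall>\<epsilon>. 0 < \<epsilon> \<and> \<epsilon> < \<epsilon>1 \<longrightarrow> linearly_stable \<epsilon> T (\<psi> \<epsilon>)"
    if q: "\<theta> 0 - \<theta> (-1) = 0" "\<theta> 1 - \<theta> 0 = 0"
      and c: "is_continuation T (unperturbed_orbit S Istar \<theta>) \<psi>" for \<theta> \<psi>
  proof -
    have q': "\<theta> 0 - \<theta> (-1) \<in> {0, pi}" "\<theta> 1 - \<theta> 0 \<in> {0, pi}" using q by auto
    obtain \<phi> \<alpha> where fam: "standing_wave_family Istar S \<phi> (sg \<theta>)" and real: "\<forall>\<^sub>0\<epsilon>. im_part (\<phi> \<epsilon>) = 0"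
      and \<psi>: "\<forall>\<^sub>0\<epsilon>. \<psi> \<epsilon> = standing_wave Istar (\<alpha> \<epsilon>) (\<phi> \<epsilon>)"
      using wave[OF q' c] by blast
    have "sg \<theta> 1 = 1" "sg \<theta> (-1) = 1" using phases(2,3)[OF q'] q by simp_all
    from standing_wave_family.ev_eigenvalues_nonpositive[OF fam this] real \<psi>
    have "\<forall>\<^sub>0\<epsilon>. linearly_stable \<epsilon> T (\<psi> \<epsilon>)"
    proof eventually_elim
      case (elim \<epsilon>)
      show ?case unfolding elim(3) by (rule standing_wave_stable[OF I T elim(2)]) (use elim(1) in blast)
    qed
    then show ?thesis by (auto simp: eventually_at_right_field)
  qed
  have unstable: "\<exists>\<epsilon>1>0. \<forall>\<epsilon>. 0 < \<epsilon> \<and> \<epsilon> < \<epsilon>1 \<longrightarrow> linearly_unstable \<epsilon> T (\<psi> \<epsilon>)"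
    if q: "(\<theta> 0 - \<theta> (-1), \<theta> 1 - \<theta> 0) \<in> {(0, pi), (pi, 0), (pi, pi)}"
      and c: "is_continuation T (unperturbed_orbit S Istar \<theta>) \<psi>" for \<theta> \<psi>
  proof -
    have q': "\<theta> 0 - \<theta> (-1) \<in> {0, pi}" "\<theta> 1 - \<theta> 0 \<in> {0, pi}" using q by auto
    obtain \<phi> \<alpha> where fam: "standing_wave_family Istar S \<phi> (sg \<theta>)" and real: "\<forall>\<^sub>0\<epsilon>. im_part (\<phi> \<epsilon>) = 0"
      and \<psi>: "\<forall>\<^sub>0\<epsilon>. \<psi> \<epsilon> = standing_wave Istar (\<alpha> \<epsilon>) (\<phi> \<epsilon>)"
      using wave[OF q' c] by blast
    have "sg \<theta> 1 = - 1 \<or> sg \<theta> (-1) = - 1" using phases(2,3)[OF q'] q by auto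
    from standing_wave_family.ev_growing_mode[OF fam real this] real \<psi>
    have "\<forall>\<^sub>0\<epsilon>. linearly_unstable \<epsilon> T (\<psi> \<epsilon>)"
    proof eventually_elim
      case (elim \<epsilon>)
      then obtain u v l where "Lm Istar \<epsilon> (\<phi> \<epsilon>) v = l *\<^sub>R u" "Lp Istar \<epsilon> (\<phi> \<epsilon>) u = - (l *\<^sub>R v)" "v \<noteq> 0" "l > 0" by blast
      then show ?case unfolding elim(3) by (rule standing_wave_unstable[OF I T elim(2)])
    qed
    then show ?thesis by (auto simp: eventually_at_right_field)
  qed
  show ?thesis
  proof (intro conjI allI impI)
    fix \<theta> :: "'n site \<Rightarrow> real" and q2 q3 :: real
    assume "q2 = \<theta> 0 - \<theta> (-1) \<and> q3 = \<theta> 1 - \<theta> 0 \<and> (q2, q3) \<in> {(0, 0), (0, pi), (pi, 0), (pi, pi)}"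
    then show "can_be_continued T (unperturbed_orbit S Istar \<theta>)" by (intro exist) auto
  next
    fix \<theta> :: "'n site \<Rightarrow> real" and q2 q3 :: real and \<psi>
    assume "q2 = \<theta> 0 - \<theta> (-1) \<and> q3 = \<theta> 1 - \<theta> 0 \<and> (q2, q3) = (0, 0)
        \<and> is_continuation T (unperturbed_orbit S Istar \<theta>) \<psi>"
    then show "\<exists>\<epsilon>1>0. \<forall>\<epsilon>. 0 < \<epsilon> \<and> \<epsilon> < \<epsilon>1 \<longrightarrow> linearly_stable \<epsilon> T (\<psi> \<epsilon>)" by (intro stable[where \<theta> = \<theta> and \<psi> = \<psi>]) auto
  next
    fix \<theta> :: "'n site \<Rightarrow> real" and q2 q3 :: real and \<psi>
    assume "q2 = \<theta> 0 - \<theta> (-1) \<and> q3 = \<theta> 1 - \<theta> 0 \<and> (q2, q3) \<in> {(0, pi), (pi, 0), (pi, pi)}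
        \<and> is_continuation T (unperturbed_orbit S Istar \<theta>) \<psi>"
    then show "\<exists>\<epsilon>1>0. \<forall>\<epsilon>. 0 < \<epsilon> \<and> \<epsilon> < \<epsilon>1 \<longrightarrow> linearly_unstable \<epsilon> T (\<psi> \<epsilon>)" by (intro unstable[where \<theta> = \<theta> and \<psi> = \<psi>]) auto
  qed
qed

end
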